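(* (a) The set $\{Q_n^{-m} : m\in\mathbb{N}_0,\ n\in\mathbb{Z},\ |n|\le m\}$ is a Schauder basis of $\mathrm{CSH}^-$. In particular, $\mathrm{CSH}^-=\mathcal{H}(\mathbb{S}^2_{\mathbb{C}})$, and each $Q\in\mathcal{H}(\mathbb{S}^2_{\mathbb{C}})$ has a unique representation as $$Q(\mathbf{z})=\sum_{m=0}^\infty\sum_{n=-m}^m c_{n,m}\,Q_n^{-m}(\mathbf{z}),\qquad c_{n,m}\in\mathbb{C}.$$ This series converges absolutely and locally uniformly in $\mathbb{S}^2_{\mathbb{C}}$, and the Schauder coefficients $c_{\pm n,m}$ ($0\le n\le m$) of $Q$ are given by $$c_{\pm n,m}=(2m+1)\binom{m}{n}^{-1}\binom{m+n}{n}\int_{\mathbb{S}^2_{\mathbb{R}}}Q(\mathbf{x})\,\overline{Q_{\pm n}^{-m}(\mathbf{x})}\,d\mathbf{x}.$$ (b) The map $\langle\cdot,\cdot\rangle_{\mathbb{S}^2_{\mathbb{R}}}:\mathcal{H}(\mathbb{S}^2_{\mathbb{C}})\times\mathcal{H}(\mathbb{S}^2_{\mathbb{C}})\to\mathbb{C}$ defined by $$\langle Q,P\rangle_{\mathbb{S}^2_{\mathbb{R}}}=\int_{\mathbb{S}^2_{\mathbb{R}}}Q(\mathbf{x})\,\overline{P(\mathbf{x})}\,d\mathbf{x}$$ is an inner product on $\mathcal{H}(\mathbb{S}^2_{\mathbb{C}})$. In particular, $(\mathrm{CSH}(m),\langle\cdot,\cdot\rangle_{\mathbb{S}^2_{\mathbb{R}}})$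 is a $(2m+1)$-dimensional Hilbert space for all $m\in\mathbb{N}_0$, and $\{Q_n^{-m}:|n|\le m\}$ is an orthogonal basis of it. Moreover, the spaces $\mathrm{CSH}(m)$ and $\mathrm{CSH}(p)$, for $m,p\in\mathbb{N}_0$ with $m\ne p$, are orthogonal with respect to $\langle\cdot,\cdot\rangle_{\mathbb{S}^2_{\mathbb{R}}}$.
   Context: $\mathbb{N}_0=\{0,1,2,\dots\}$, $\widehat{\mathbb{C}}=\mathbb{C}\cup\{\infty\}$, with the conventions $\infty\cdot 0=0\cdot\infty=1$ and $\infty\cdot z=z\cdot\infty=\infty$ for $z\in\widehat{\mathbb{C}}\setminus\{0\}$. $\Omega=\{(z,w)\in\widehat{\mathbb{C}}^2 : z\cdot w\ne 1\}$, open in $\widehat{\mathbb{C}}^2$; $\mathcal{H}(\Omega)$ is the space of holomorphic functions $\Omega\to\mathbb{C}$. Laplacian and eigenspaces: for $F\in\mathcal{H}(\Omega)$, $\Delta_{zw}F(z,w)=4(1-zw)^2\partial_z\partial_wF(z,w)$ (understood by holomorphic extension at points with a coordinate $\infty$), and $X_\lambda(\Omega)=\{F\in\mathcal{H}(\Omega):\Delta_{zw}F=\lambda F\}$. Poisson Fourier modes: for $m\in\mathbb{N}_0$, $n\in\mathbb{Z}$, $P_n^{-m}:\Omega\to\mathbb{C}$ is $$P_n^{-m}(z,w)=(-1)^n\binom{m}{|n|}(1-zw)^{-m}\,{}_2F_1(-m,|n|-m;|n|+1;zw)\cdot\begin{cases}w^n & n\ge 0\\ z^{|n|} & n\le 0\end{cases}$$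 with $\binom{m}{|n|}=0$ if $|n|>m$ and ${}_2F_1(a,b;c;t)=\sum_{k\ge0}\frac{(a)_k(b)_k}{(c)_k}\frac{t^k}{k!}$ (a finite sum here), $(a)_k=a(a+1)\cdots(a+k-1)$. Equivalently, for $n\ge0$, $P_n^{-m}(z,w)=(-1)^n\sum_{k=0}^{m-n}\binom{m}{k+n}\binom{m}{k}\frac{z^kw^{k+n}}{(1-zw)^m}=P_{-n}^{-m}(w,z)$. At points of $\Omega$ with a coordinate equal to $\infty$ the formulas are understood via the (unique) holomorphic extension. Complex two-sphere: $\mathbb{S}^2_{\mathbb{C}}=\{(z_1,z_2,z_3)\in\mathbb{C}^3:z_1^2+z_2^2+z_3^2=1\}$, $\mathbb{S}^2_{\mathbb{R}}=\mathbb{S}^2_{\mathbb{C}}\cap\mathbb{R}^3$, $d\mathbf{x}$ is the normalized (total mass 1) area measure on $\mathbb{S}^2_{\mathbb{R}}$. $\mathcal{H}(\mathbb{S}^2_{\mathbb{C}})$ is the space of holomorphic functions on $\mathbb{S}^2_{\mathbb{C}}$ with the topology of locally uniform convergence. The biholomorphic map $S^{-1}:\mathbb{S}^2_{\mathbb{C}}\to\Omega$ is $S^{-1}(z_1,z_2,z_3)=\left(\frac{z_1+iz_2}{1-z_3},-\frac{z_1-iz_2}{1-z_3}\right)$ if $z_3\ne1$; $=(1/z_1,\infty)$ if $z_3=1,\ z_2=iz_1$; $=(\infty,-1/z_1)$ if $z_3=1,\ z_2=-iz_1$ (with $1/0=\infty$). Define $Q_n^{-m}=P_n^{-m}\circ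 S^{-1}$; $\mathrm{CSH}(m)=\mathrm{span}\{F\circ S^{-1}:F\in X_{4m(m+1)}(\Omega)\}$ for $m\in\mathbb{N}_0$; $\mathrm{CSH}$ is the set of all finite linear combinations of elements of $\bigcup_{m\in\mathbb{N}_0}\mathrm{CSH}(m)$; $\mathrm{CSH}^-$ is the closure of $\mathrm{CSH}$ with respect to locally uniform convergence on $\mathbb{S}^2_{\mathbb{C}}$. *)

theory Defs
  imports "HOL-Analysis.Analysis" "HOL-Library.Function_Algebras"
begin

section \<open>Holomorphic functions of several variables\<close>

text \<open>
  Complex differentiability at every point, the Frechet derivative being the complex linear
  form with coefficients \<open>a\<close>. Only meant for open \<open>U\<close>.
\<close>

definition holomorphic_vec_on :: "(complex^'n \<Rightarrow> complex) \<Rightarrow> (complex^'n) set \<Rightarrow> bool" where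
  "holomorphic_vec_on f U \<longleftrightarrow>
     (\<forall>x\<in>U. \<exists>a::complex^'n. (f has_derivative (\<lambda>h. \<Sum>i\<in>UNIV. a $ i * h $ i)) (at x))"


section \<open>The Riemann sphere and the domain \<open>\<Omega>\<close>\<close>

datatype riemann_sphere = Fin complex | Infty

text \<open>The convention is \<open>\<infinity> \<cdot> 0 = 0 \<cdot> \<infinity> = 1\<close>.\<close>

fun rs_mult :: "riemann_sphere \<Rightarrow> riemann_sphere \<Rightarrow> riemann_sphere" where
  "rs_mult (Fin z) (Fin w) = Fin (z * w)"
| "rs_mult (Fin z) Infty = (if z = 0 then Fin 1 else Infty)"
| "rs_mult Infty (Fin w) = (if w = 0 then Fin 1 else Infty)"
| "rs_mult Infty Infty = Infty"

definition rs_recip :: "complex \<Rightarrow> riemann_sphere" where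
  "rs_recip u = (if u = 0 then Infty else Fin (1 / u))"

definition Omega :: "(riemann_sphere \<times> riemann_sphere) set" where
  "Omega = {(z, w). rs_mult z w \<noteq> Fin 1}"

text \<open>
  Holomorphy is tested in the four product charts of \<open>\<Omega>\<close> whose factors are the inverse charts
  \<^const>\<open>Fin\<close> and \<^const>\<open>rs_recip\<close> of the Riemann sphere. Functions on \<open>\<Omega>\<close> are represented by total
  functions that vanish outside \<open>\<Omega>\<close>, so that equality of functions is equality on \<open>\<Omega>\<close>;
  functions on the complex sphere below are treated in the same way.
\<close>

definition hol_Omega :: "(riemann_sphere \<times> riemann_sphere \<Rightarrow> complex) set" where
  "hol_Omega =
     {F. (\<forall>\<phi>\<in>{Fin, rs_recip}. \<forall>\<psi>\<in>{Fin, rs_recip}.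
            holomorphic_vec_on (\<lambda>x::complex^2. F (\<phi> (x $ 1), \<psi> (x $ 2)))
                               {x. (\<phi> (x $ 1), \<psi> (x $ 2)) \<in> Omega})
         \<and> (\<forall>p. p \<notin> Omega \<longrightarrow> F p = 0)}"

text \<open>
  The holomorphic function on \<open>\<Omega>\<close> given by the formula \<open>g\<close> at the finite points; it is unique
  because these are dense in \<open>\<Omega>\<close>.
\<close>

definition hol_ext :: "(complex \<Rightarrow> complex \<Rightarrow> complex) \<Rightarrow> riemann_sphere \<times> riemann_sphere \<Rightarrow> complex" where
  "hol_ext g = (THE F. F \<in> hol_Omega \<and> (\<forall>z w. z * w \<noteq> 1 \<longrightarrow> F (Fin z, Fin w) = g z w))"

definition laplacian_zw ::
    "(riemann_sphere \<times> riemann_sphere \<Rightarrow> complex) \<Rightarrow> riemann_sphere \<times> riemann_sphere \<Rightarrow> complex" where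
  "laplacian_zw F =
     hol_ext (\<lambda>z w. 4 * (1 - z * w)\<^sup>2 * deriv (\<lambda>\<zeta>. deriv (\<lambda>\<omega>. F (Fin \<zeta>, Fin \<omega>)) w) z)"

definition eigenspace :: "complex \<Rightarrow> (riemann_sphere \<times> riemann_sphere \<Rightarrow> complex) set" where
  "eigenspace l = {F \<in> hol_Omega. \<forall>p\<in>Omega. laplacian_zw F p = l * F p}"


section \<open>Poisson Fourier modes\<close>

definition hyp2F1 :: "complex \<Rightarrow> complex \<Rightarrow> complex \<Rightarrow> complex \<Rightarrow> complex" where
  "hyp2F1 a b c t =
     (\<Sum>k. pochhammer a k * pochhammer b k / pochhammer c k * (t ^ k / fact k))"

text \<open>\<open>poisson_mode m n\<close> is \<open>P\<^sub>n\<close> with upper index \<open>-m\<close>.\<close>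

definition poisson_mode :: "nat \<Rightarrow> int \<Rightarrow> riemann_sphere \<times> riemann_sphere \<Rightarrow> complex" where
  "poisson_mode m n =
     hol_ext (\<lambda>z w. (- 1) ^ nat \<bar>n\<bar> * of_nat (m choose nat \<bar>n\<bar>) * inverse ((1 - z * w) ^ m)
        * hyp2F1 (- of_nat m) (of_int (\<bar>n\<bar> - int m)) (of_int (\<bar>n\<bar> + 1)) (z * w)
        * (if n \<ge> 0 then w ^ nat n else z ^ nat \<bar>n\<bar>))"


section \<open>The complex two-sphere\<close>

definition csphere :: "(complex^3) set" where
  "csphere = {z. (z $ 1)\<^sup>2 + (z $ 2)\<^sup>2 + (z $ 3)\<^sup>2 = 1}"

definition rsphere :: "(complex^3) set" where
  "rsphere = csphere \<inter> {z. \<forall>i. z $ i \<in> \<real>}"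

text \<open>
  Normalized surface area in spherical coordinates \<open>(\<phi>, \<theta>)\<close>: the area element is
  \<open>sin \<theta> d\<phi> d\<theta>\<close> and the total area is \<open>4\<pi>\<close>.
\<close>

definition sphere_coords :: "real \<times> real \<Rightarrow> complex^3" where
  "sphere_coords = (\<lambda>(\<phi>, \<theta>). vector [complex_of_real (sin \<theta> * cos \<phi>),
                                      complex_of_real (sin \<theta> * sin \<phi>),
                                      complex_of_real (cos \<theta>)])"

definition sphere_area :: "(complex^3) measure" where
  "sphere_area =
     distr (density lborel
              (\<lambda>(\<phi>, \<theta>). ennreal (indicator ({0..2 * pi} \<times> {0..pi}) (\<phi>, \<theta>) * (sin \<theta> / (4 * pi)))))
           (restrict_space borel rsphere) sphere_coords"

text \<open>
  Holomorphic functions on the complex submanifold \<^const>\<open>csphere\<close> of \<open>\<complex>\<^sup>3\<close> are those that are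
  locally restrictions of holomorphic functions on open subsets of \<open>\<complex>\<^sup>3\<close>.
\<close>

definition hol_csphere :: "(complex^3 \<Rightarrow> complex) set" where
  "hol_csphere =
     {f. (\<forall>z\<in>csphere. \<exists>U g. open U \<and> z \<in> U \<and> holomorphic_vec_on g U
                          \<and> (\<forall>x\<in>U \<inter> csphere. f x = g x))
         \<and> (\<forall>z. z \<notin> csphere \<longrightarrow> f z = 0)}"

text \<open>
  The map \<open>S\<^sup>-\<^sup>1\<close>. On the sphere, \<open>z\<^sub>3 = 1\<close> and \<open>z\<^sub>2 \<noteq> \<i> z\<^sub>1\<close> force \<open>z\<^sub>2 = - \<i> z\<^sub>1\<close>; at \<open>(0, 0, 1)\<close> both cases
  give \<open>(\<infinity>, \<infinity>)\<close>.
\<close>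

definition S_inv :: "complex^3 \<Rightarrow> riemann_sphere \<times> riemann_sphere" where
  "S_inv z =
     (if z $ 3 \<noteq> 1 then (Fin ((z $ 1 + \<i> * z $ 2) / (1 - z $ 3)),
                         Fin (- ((z $ 1 - \<i> * z $ 2) / (1 - z $ 3))))
      else if z $ 2 = \<i> * z $ 1 then (rs_recip (z $ 1), Infty)
      else (Infty, rs_recip (- (z $ 1))))"

definition pullback_S ::
    "(riemann_sphere \<times> riemann_sphere \<Rightarrow> complex) \<Rightarrow> complex^3 \<Rightarrow> complex" where
  "pullback_S F = (\<lambda>z. if z \<in> csphere then F (S_inv z) else 0)"

definition Q_mode :: "nat \<Rightarrow> int \<Rightarrow> complex^3 \<Rightarrow> complex" where
  "Q_mode m n = pullback_S (poisson_mode m n)"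


section \<open>Complex vector spaces of functions\<close>

definition cfun_scale :: "complex \<Rightarrow> ('a \<Rightarrow> complex) \<Rightarrow> 'a \<Rightarrow> complex" where
  "cfun_scale c f = (\<lambda>x. c * f x)"

global_interpretation cfun: vector_space "cfun_scale :: complex \<Rightarrow> ('a \<Rightarrow> complex) \<Rightarrow> 'a \<Rightarrow> complex"
  by unfold_locales (auto simp: cfun_scale_def fun_eq_iff algebra_simps)

definition complex_inner_product_on ::
    "('a \<Rightarrow> complex) set \<Rightarrow> (('a \<Rightarrow> complex) \<Rightarrow> ('a \<Rightarrow> complex) \<Rightarrow> complex) \<Rightarrow> bool" where
  "complex_inner_product_on V ip \<longleftrightarrow>
     cfun.subspace V
     \<and> (\<forall>f\<in>V. \<forall>g\<in>V. \<forall>h\<in>V. ip (f + g) h = ip f h + ip g h)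
     \<and> (\<forall>c. \<forall>f\<in>V. \<forall>g\<in>V. ip (cfun_scale c f) g = c * ip f g)
     \<and> (\<forall>f\<in>V. \<forall>g\<in>V. ip g f = cnj (ip f g))
     \<and> (\<forall>f\<in>V. ip f f \<in> \<real> \<and> 0 \<le> Re (ip f f))
     \<and> (\<forall>f\<in>V. ip f f = 0 \<longleftrightarrow> f = 0)"

definition ip_norm ::
    "(('a \<Rightarrow> complex) \<Rightarrow> ('a \<Rightarrow> complex) \<Rightarrow> complex) \<Rightarrow> ('a \<Rightarrow> complex) \<Rightarrow> real" where
  "ip_norm ip f = sqrt (Re (ip f f))"

definition complex_hilbert_space_on ::
    "('a \<Rightarrow> complex) set \<Rightarrow> (('a \<Rightarrow> complex) \<Rightarrow> ('a \<Rightarrow> complex) \<Rightarrow> complex) \<Rightarrow> bool" where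
  "complex_hilbert_space_on V ip \<longleftrightarrow>
     complex_inner_product_on V ip
     \<and> (\<forall>X::nat \<Rightarrow> 'a \<Rightarrow> complex.
          (\<forall>k. X k \<in> V) \<and> (\<forall>e>0. \<exists>N. \<forall>j\<ge>N. \<forall>k\<ge>N. ip_norm ip (X j - X k) < e) \<longrightarrow>
          (\<exists>f\<in>V. (\<lambda>k. ip_norm ip (X k - f)) \<longlonglongrightarrow> 0))"

definition loc_uniform_limit ::
    "'a::topological_space set \<Rightarrow> (nat \<Rightarrow> 'a \<Rightarrow> complex) \<Rightarrow> ('a \<Rightarrow> complex) \<Rightarrow> bool" where
  "loc_uniform_limit S f l \<longleftrightarrow>
     (\<forall>x\<in>S. \<exists>U. open U \<and> x \<in> U \<and> uniform_limit (U \<inter> S) f l sequentially)"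

text \<open>Schauder bases with respect to locally uniform convergence on \<open>S\<close>.\<close>

definition schauder_basis_on ::
    "'a::topological_space set \<Rightarrow> ('a \<Rightarrow> complex) set \<Rightarrow> (nat \<Rightarrow> 'a \<Rightarrow> complex) \<Rightarrow> bool" where
  "schauder_basis_on S V b \<longleftrightarrow>
     (\<forall>k. b k \<in> V) \<and>
     (\<forall>f\<in>V. \<exists>!c::nat \<Rightarrow> complex. loc_uniform_limit S (\<lambda>N x. \<Sum>k<N. c k * b k x) f)"


section \<open>Complex spherical harmonics\<close>

definition CSH_deg :: "nat \<Rightarrow> (complex^3 \<Rightarrow> complex) set" where
  "CSH_deg m = cfun.span (pullback_S ` eigenspace (of_nat (4 * m * (m + 1))))"

definition CSH :: "(complex^3 \<Rightarrow> complex) set" where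
  "CSH = cfun.span (\<Union>m. CSH_deg m)"

text \<open>
  Locally uniform convergence on \<^const>\<open>csphere\<close> is metrizable, hence the closure is the set of
  limits of sequences.
\<close>

definition CSH_closure :: "(complex^3 \<Rightarrow> complex) set" where
  "CSH_closure =
     {f. (\<forall>z. z \<notin> csphere \<longrightarrow> f z = 0)
         \<and> (\<exists>g. (\<forall>k. g k \<in> CSH) \<and> loc_uniform_limit csphere g f)}"

definition mode_index :: "(nat \<times> int) set" where
  "mode_index = {(m, n). \<bar>n\<bar> \<le> int m}"

definition sphere_ip :: "(complex^3 \<Rightarrow> complex) \<Rightarrow> (complex^3 \<Rightarrow> complex) \<Rightarrow> complex" where
  "sphere_ip f g = (LINT x|sphere_area. f x * cnj (g x))"

end

theory Submission
  imports Defs "HOL-Complex_Analysis.Complex_Analysis"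
begin

text \<open>
  The coordinates \<open>a = z\<^sub>1 + \<i> z\<^sub>2\<close>, \<open>b = z\<^sub>1 - \<i> z\<^sub>2\<close>, \<open>c = z\<^sub>3\<close> turn the complex sphere into the quadric
  \<open>a b = 1 - c\<^sup>2\<close>. A holomorphic function \<open>f\<close> on it has, for fixed \<open>c\<close>, a Laurent expansion in
  \<open>a \<in> \<complex> - {0}\<close>. The coefficient of \<open>a\<^sup>n\<close> with \<open>n \<ge> 0\<close> is an entire function of \<open>c\<close>; the coefficient of
  \<open>a\<^sup>-\<^sup>n\<close> is an entire function divisible by \<open>(1 - c\<^sup>2)\<^sup>n\<close>, and because \<open>1 - c\<^sup>2 = a b\<close> the quotient is the
  coefficient of \<open>b\<^sup>n\<close>. Taylor expansion in \<open>1 + c\<close> therefore writes \<open>f\<close> as a series in the monomials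
  \<open>b\<^sup>n (1 + c)\<^sup>k\<close> and \<open>a\<^sup>n (1 + c)\<^sup>k\<close>. The circles in the Cauchy estimates can be taken arbitrarily
  large, so the coefficients decay faster than every geometric sequence (\<open>sep_holomorphic_expansion\<close>).

  For fixed \<open>n\<close> the powers of \<open>1 + c\<close> are exchanged for the Jacobi polynomials with both parameters \<open>n\<close>.
  The entries of this triangular change of basis grow at most geometrically, so the coefficients stay
  rapidly decreasing (\<open>lmon_series_eq_mode_series\<close>). The resulting functions \<open>md n N\<close>, of degree
  \<open>m = |n| + N\<close>, are exactly the pulled back Poisson modes (\<open>poisson_mode_eq_lift_md\<close>). Hence every
  holomorphic function is a series of modes that converges absolutely and uniformly on bounded sets.
  Conversely every such series is holomorphic on all of \<open>\<complex>\<^sup>3\<close>.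

  On the real sphere \<open>b\<^sup>n\<close> and \<open>a\<^sup>n\<close> become \<open>sin\<^sup>n \<theta>\<close> times a character of the circle, so that the modes are
  orthogonal by the orthogonality of the characters and of the Jacobi polynomials, with an explicit
  norm (\<open>md_orthogonal\<close>). Locally uniform convergence is uniform on the compact real sphere; hence the
  coefficients of any convergent expansion are Fourier coefficients (\<open>mode_coeff_unique\<close>). This
  gives uniqueness, the coefficient formula, the independence of the enumeration and the definiteness of the
  inner product.

  The operator \<open>4 (1 - z w)\<^sup>2 \<partial>\<^sub>z \<partial>\<^sub>w\<close> acts on mode series term by term and multiplies a mode of degree \<open>m\<close> by
  \<open>4 m (m + 1)\<close> (\<open>laplacian_mode_series\<close>). Comparing coefficients, the eigenspace for \<open>4 m (m + 1)\<close> is the span of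
  the \<open>2 m + 1\<close> modes of degree \<open>m\<close> (\<open>CSH_deg_eq_span\<close>), which yields the dimensions, the orthogonality and
  the completeness of these spaces.

  The expansion uses of \<open>f\<close> only its continuity and its holomorphy in \<open>a\<close> and in \<open>c\<close> separately. These properties
  pass to locally uniform limits by one-variable arguments, and so the closure of the span of the
  modes consists of holomorphic functions (\<open>CSH_closure_eq\<close>).
\<close>

section \<open>Jacobi polynomials\<close>

text \<open>
  The sum is an \<open>N\<close>-th finite difference in \<open>x\<close>, and by Pascal's rule each difference lowers \<open>j\<close> by one.
  For \<open>j < N\<close> it vanishes; this is what makes the Jacobi polynomials orthogonal to lower powers.
\<close>

lemma binomial_finite_difference:
  "(\<Sum>k\<le>N. (-1) ^ k * of_nat (N choose k) * of_nat ((x + k) choose j) :: 'a :: comm_ring_1)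
   = (-1) ^ N * (if N \<le> j then of_nat (x choose (j - N)) else 0)"
proof (induction N arbitrary: x)
  case 0
  show ?case by simp
next
  case (Suc N)
  let ?T = "\<lambda>N x k. (-1) ^ k * of_nat (N choose k) * of_nat ((x + k) choose j) :: 'a"
  have "(\<Sum>k\<le>Suc N. ?T (Suc N) x k) = ?T (Suc N) x 0 + (\<Sum>k\<le>N. ?T (Suc N) x (Suc k))"
    by (rule sum.atMost_Suc_shift)
  also have "(\<Sum>k\<le>N. ?T (Suc N) x (Suc k)) = (\<Sum>k\<le>N. ?T N x (Suc k)) - (\<Sum>k\<le>N. ?T N (Suc x) k)"
    unfolding sum_subtractf[symmetric] by (intro sum.cong refl) (simp add: algebra_simps)
  also have "?T (Suc N) x 0 + ((\<Sum>k\<le>N. ?T N x (Suc k)) - (\<Sum>k\<le>N. ?T N (Suc x) k))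
      = (\<Sum>k\<le>Suc N. ?T N x k) - (\<Sum>k\<le>N. ?T N (Suc x) k)"
    by (subst sum.atMost_Suc_shift) simp
  also have "(\<Sum>k\<le>Suc N. ?T N x k) = (\<Sum>k\<le>N. ?T N x k)" by (simp add: binomial_eq_0)
  also have "\<dots> - (\<Sum>k\<le>N. ?T N (Suc x) k) =
     (-1) ^ N * (if N \<le> j then of_nat (x choose (j - N)) - of_nat (Suc x choose (j - N)) else 0)"
    unfolding Suc.IH by (simp add: algebra_simps)
  also have "\<dots> = (-1) ^ Suc N * (if Suc N \<le> j then of_nat (x choose (j - Suc N)) else 0)"
  proof (cases "Suc N \<le> j")
    case True
    then obtain i where "j - N = Suc i" "j - Suc N = i" by (metis Suc_diff_le diff_Suc_Suc)
    then show ?thesis using True by simp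
  next
    case False
    then have "j - N = 0" by simp
    then show ?thesis using False by simp
  qed
  finally show ?case .
qed

text \<open>
  The beta integral after the substitution \<open>u = cos t\<close>. The induction integrates by parts: the function
  \<open>(1 + cos t)\<^sup>i\<^sup>+\<^sup>1 (1 - cos t)\<^sup>j\<^sup>+\<^sup>1\<close> vanishes at both ends of the interval.
\<close>

lemma sin_cos_beta_integral:
  "((\<lambda>t. sin t * (1 + cos t) ^ i * (1 - cos t) ^ j) has_integral
     (2 ^ (i + j + 1) * fact i * fact j / fact (i + j + 1) :: real)) {0..pi}"
proof (induction i arbitrary: j)
  case 0
  have "((\<lambda>t. sin t * (1 - cos t) ^ j) has_integral
     ((1 - cos pi) ^ Suc j / real (Suc j) - (1 - cos 0) ^ Suc j / real (Suc j))) {0..pi}"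
    by (rule fundamental_theorem_of_calculus, simp)
       (auto intro!: derivative_eq_intros simp: has_real_derivative_iff_has_vector_derivative[symmetric]
          simp del: power_Suc of_nat_Suc)
  then show ?case by (simp add: divide_simps fact_reduce)
next
  case (Suc i)
  have "((\<lambda>t. real (Suc j) * (sin t * (1 + cos t) ^ Suc i * (1 - cos t) ^ j)
         - real (Suc i) * (sin t * (1 + cos t) ^ i * (1 - cos t) ^ Suc j)) has_integral
     ((1 + cos pi) ^ Suc i * (1 - cos pi) ^ Suc j - (1 + cos 0) ^ Suc i * (1 - cos 0) ^ Suc j)) {0..pi}"
    by (rule fundamental_theorem_of_calculus, simp)
       (auto intro!: derivative_eq_intros simp: has_real_derivative_iff_has_vector_derivative[symmetric]
          mult_ac simp del: power_Suc of_nat_Suc)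
  then have "((\<lambda>t. real (Suc j) * (sin t * (1 + cos t) ^ Suc i * (1 - cos t) ^ j)
         - real (Suc i) * (sin t * (1 + cos t) ^ i * (1 - cos t) ^ Suc j)) has_integral 0) {0..pi}"
    by simp
  from has_integral_add[OF this has_integral_mult_right[OF Suc.IH[of "Suc j"], of "real (Suc i)"]]
  have "((\<lambda>t. real (Suc j) * (sin t * (1 + cos t) ^ Suc i * (1 - cos t) ^ j)) has_integral
      real (Suc i) * (2 ^ (i + Suc j + 1) * fact i * fact (Suc j) / fact (i + Suc j + 1))) {0..pi}"
    by simp
  from has_integral_mult_right[OF this, of "1 / real (Suc j)"]
  have "((\<lambda>t. sin t * (1 + cos t) ^ Suc i * (1 - cos t) ^ j) has_integral
      real (Suc i) * (2 ^ (i + Suc j + 1) * fact i * fact (Suc j) / fact (i + Suc j + 1)) / real (Suc j)) {0..pi}"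
    by (simp add: mult_ac del: of_nat_Suc fact_Suc power_Suc)
  also have "real (Suc i) * (2 ^ (i + Suc j + 1) * fact i * fact (Suc j) / fact (i + Suc j + 1)) / real (Suc j)
     = 2 ^ (Suc i + j + 1) * fact (Suc i) * fact j / fact (Suc i + j + 1)"
    by (simp add: field_simps del: of_nat_Suc)
  finally show ?case .
qed

text \<open>
  This is \<open>(-1)\<^sup>N 2\<^sup>-\<^sup>n\<close> times the Jacobi polynomial of degree \<open>N\<close> with both parameters equal to \<open>n\<close>. The
  normalization is the one for which the Poisson modes need no further factor.
\<close>

definition jac :: "nat \<Rightarrow> nat \<Rightarrow> complex \<Rightarrow> complex" where
  "jac n N c = (\<Sum>k\<le>N. of_nat ((n + N) choose k) * of_nat ((n + N) choose (k + n)) * (-1) ^ k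
                  * (1 + c) ^ k * (1 - c) ^ (N - k)) / 2 ^ (n + N)"

lemma sum_choose_product: "(\<Sum>k\<le>N. ((n + N) choose k) * ((n + N) choose (k + n))) = (2 * (n + N)) choose N"
proof -
  have "(\<Sum>k\<le>N. ((n + N) choose k) * ((n + N) choose (k + n)))
      = (\<Sum>k\<le>N. ((n + N) choose k) * ((n + N) choose (N - k)))"
  proof (intro sum.cong refl)
    fix k assume k: "k \<in> {..N}"
    have "(n + N) choose (k + n) = (n + N) choose (n + N - (k + n))"
      by (rule binomial_symmetric) (use k in auto)
    then show "((n + N) choose k) * ((n + N) choose (k + n)) = ((n + N) choose k) * ((n + N) choose (N - k))"
      using k by (simp add: add.commute)
  qed
  also have "\<dots> = (2 * (n + N)) choose N"
    using vandermonde[of "n + N" "n + N" N] by (simp only: mult_2)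
  finally show ?thesis .
qed

text \<open>
  Growth at most geometric in the degree is all that the convergence arguments need, so the sum is
  estimated term by term.
\<close>

lemma norm_jac_le: "norm (jac n N c) \<le> (2 * (1 + norm c)) ^ (n + N)"
proof -
  have "norm (\<Sum>k\<le>N. of_nat ((n + N) choose k) * of_nat ((n + N) choose (k + n)) * (-1) ^ k
                  * (1 + c) ^ k * (1 - c) ^ (N - k))
     \<le> (\<Sum>k\<le>N. real (((n + N) choose k) * ((n + N) choose (k + n))) * (1 + norm c) ^ N)"
  proof (rule sum_norm_le)
    fix k assume k: "k \<in> {..N}"
    have "norm (1 + c) ^ k * norm (1 - c) ^ (N - k) \<le> (1 + norm c) ^ k * (1 + norm c) ^ (N - k)"
      by (intro mult_mono power_mono) (use norm_triangle_ineq[of 1 c] norm_triangle_ineq4[of 1 c] in auto)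
    also have "\<dots> = (1 + norm c) ^ N" using k by (simp flip: power_add)
    finally show "norm (of_nat ((n + N) choose k) * of_nat ((n + N) choose (k + n)) * (-1) ^ k
                  * (1 + c) ^ k * (1 - c) ^ (N - k)) \<le> real (((n + N) choose k) * ((n + N) choose (k + n))) * (1 + norm c) ^ N"
      by (simp add: norm_mult norm_power mult.assoc mult_left_mono)
  qed
  also have "\<dots> = real ((2 * (n + N)) choose N) * (1 + norm c) ^ N"
    unfolding sum_choose_product[symmetric] of_nat_sum sum_distrib_right ..
  also have "\<dots> \<le> 4 ^ (n + N) * (1 + norm c) ^ (n + N)"
  proof (intro mult_mono)
    have "(2 * (n + N)) choose N \<le> 2 ^ (2 * (n + N))" by (rule binomial_le_pow2)
    then have "real ((2 * (n + N)) choose N) \<le> real (2 ^ (2 * (n + N)))" by (simp only: of_nat_le_iff)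
    also have "real (2 ^ (2 * (n + N))) = (2\<^sup>2) ^ (n + N)" by (simp only: power_mult of_nat_power of_nat_numeral)
    finally show "real ((2 * (n + N)) choose N) \<le> 4 ^ (n + N)" by simp
  qed (auto intro: power_increasing)
  finally have "norm (jac n N c) \<le> 4 ^ (n + N) * (1 + norm c) ^ (n + N) / 2 ^ (n + N)"
    unfolding jac_def by (simp add: norm_divide norm_power divide_right_mono)
  also have "\<dots> = (4 * (1 + norm c) / 2) ^ (n + N)" by (simp only: power_mult_distrib power_divide)
  also have "4 * (1 + norm c) / 2 = 2 * (1 + norm c)" by simp
  finally show ?thesis .
qed

text \<open>
  The explicit leading coefficient serves twice: it is nonzero, which makes the change between the powers
  of \<open>1 + c\<close> and the Jacobi polynomials invertible, and it determines the norm.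
\<close>

lemma jac_power_expansion:
  obtains \<delta> where "\<And>c. jac n N c = (\<Sum>j\<le>N. \<delta> j * (1 + c) ^ j)"
    and "\<delta> N = (-1) ^ N * of_nat ((2 * (n + N)) choose N) / 2 ^ (n + N)"
proof -
  define q :: "nat \<Rightarrow> complex poly" where "q = (\<lambda>k. [:0, 1:] ^ k * [:2, -1:] ^ (N - k))"
  define a where "a = (\<lambda>k. of_nat ((n + N) choose k) * of_nat ((n + N) choose (k + n)) * (-1) ^ k / 2 ^ (n + N) :: complex)"
  define p where "p = (\<Sum>k\<le>N. smult (a k) (q k))"
  have degq: "degree (q k) = N" and lcq: "coeff (q k) N = (-1) ^ (N - k)" if "k \<le> N" for k
  proof -
    have 1: "degree (q k) = k + (N - k)"
      unfolding q_def by (subst degree_mult_eq) (auto simp: degree_power_eq)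
    have 2: "lead_coeff (q k) = (-1) ^ (N - k)"
      unfolding q_def by (simp add: lead_coeff_mult lead_coeff_power)
    show "degree (q k) = N" using 1 that by simp
    then show "coeff (q k) N = (-1) ^ (N - k)" using 2 by simp
  qed
  have degp: "degree p \<le> N"
    unfolding p_def by (rule degree_sum_le) (auto simp: degq intro: order_trans[OF degree_smult_le])
  have "jac n N c = (\<Sum>j\<le>N. coeff p j * (1 + c) ^ j)" for c
  proof -
    have "poly p (1 + c) = (\<Sum>j\<le>N. coeff p j * (1 + c) ^ j)"
      unfolding poly_altdef by (rule sum.mono_neutral_left) (use degp in \<open>auto simp: coeff_eq_0\<close>)
    moreover have "poly p (1 + c) = jac n N c"
      unfolding p_def q_def a_def jac_def poly_sum sum_divide_distrib
      by (intro sum.cong refl) (simp add: algebra_simps)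
    ultimately show ?thesis by simp
  qed
  moreover have "coeff p N = (-1) ^ N * of_nat ((2 * (n + N)) choose N) / 2 ^ (n + N)"
  proof -
    have "coeff p N = (\<Sum>k\<le>N. a k * (-1) ^ (N - k))"
      unfolding p_def coeff_sum by (intro sum.cong refl) (simp add: lcq)
    also have "\<dots> = (\<Sum>k\<le>N. (-1) ^ N * of_nat (((n + N) choose k) * ((n + N) choose (k + n))) / 2 ^ (n + N))"
    proof (intro sum.cong refl)
      fix k assume "k \<in> {..N}"
      then have "(-1) ^ k * (-1) ^ (N - k) = ((-1) ^ N :: complex)" by (simp flip: power_add)
      then show "a k * (-1) ^ (N - k) = (-1) ^ N * of_nat (((n + N) choose k) * ((n + N) choose (k + n))) / 2 ^ (n + N)"
        unfolding a_def by (simp add: algebra_simps)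
    qed
    also have "\<dots> = (-1) ^ N * of_nat ((2 * (n + N)) choose N) / 2 ^ (n + N)"
      unfolding sum_choose_product[symmetric] of_nat_sum sum_distrib_left sum_divide_distrib ..
    finally show ?thesis .
  qed
  ultimately show ?thesis using that by blast
qed

definition jac_moment :: "nat \<Rightarrow> nat \<Rightarrow> nat \<Rightarrow> complex" where
  "jac_moment n N j = (-1) ^ N * 2 ^ (n + j + 1) * fact (n + N) ^ 2 * fact j / (fact N * fact (2 * n + N + j + 1))
     * (if N \<le> j then of_nat ((n + j) choose (j - N)) else 0)"

text \<open>
  The weight \<open>sin\<^sup>2\<^sup>n\<^sup>+\<^sup>1 t\<close> equals \<open>sin t (1 + cos t)\<^sup>n (1 - cos t)\<^sup>n\<close>, so each term of the polynomial gives a beta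
  integral. Their alternating sum is a finite difference of order \<open>N\<close>.
\<close>

lemma jac_moment_integral:
  "((\<lambda>t. of_real (sin t ^ (2 * n + 1)) * jac n N (of_real (cos t)) * (1 + of_real (cos t)) ^ j)
     has_integral jac_moment n N j) {0..pi}"
proof -
  define a where "a = (\<lambda>k. of_nat ((n + N) choose k) * of_nat ((n + N) choose (k + n)) * (-1) ^ k / 2 ^ (n + N) :: complex)"
  define b where "b = (\<lambda>k. 2 ^ (2 * n + N + j + 1) * fact (n + k + j) * fact (n + N - k) / fact (2 * n + N + j + 1) :: real)"
  have eq: "of_real (sin t ^ (2 * n + 1)) * jac n N (of_real (cos t)) * (1 + of_real (cos t)) ^ j
      = (\<Sum>k\<le>N. a k * of_real (sin t * (1 + cos t) ^ (n + k + j) * (1 - cos t) ^ (n + N - k)))" for t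
  proof -
    have s: "sin t ^ (2 * n + 1) = sin t * (1 + cos t) ^ n * (1 - cos t) ^ n"
    proof -
      have "(sin t)\<^sup>2 = (1 + cos t) * (1 - cos t)"
        by (simp add: sin_squared_eq algebra_simps power2_eq_square)
      then have "sin t ^ (2 * n) = ((1 + cos t) * (1 - cos t)) ^ n"
        by (simp only: power_mult)
      then show ?thesis by (simp add: power_mult_distrib)
    qed
    show ?thesis unfolding s jac_def a_def sum_divide_distrib sum_distrib_left sum_distrib_right
    proof (intro sum.cong refl)
      fix k assume "k \<in> {..N}"
      then have e: "n + N - k = n + (N - k)" by simp
      show "complex_of_real (sin t * (1 + cos t) ^ n * (1 - cos t) ^ n) *
         (of_nat (n + N choose k) * of_nat (n + N choose (k + n)) * (- 1) ^ k * (1 + complex_of_real (cos t)) ^ k *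
          (1 - complex_of_real (cos t)) ^ (N - k) / 2 ^ (n + N)) * (1 + complex_of_real (cos t)) ^ j =
         of_nat (n + N choose k) * of_nat (n + N choose (k + n)) * (- 1) ^ k / 2 ^ (n + N) *
         complex_of_real (sin t * (1 + cos t) ^ (n + k + j) * (1 - cos t) ^ (n + N - k))"
        unfolding e by (simp add: power_add)
    qed
  qed
  have hi: "((\<lambda>t. \<Sum>k\<le>N. a k * of_real (sin t * (1 + cos t) ^ (n + k + j) * (1 - cos t) ^ (n + N - k)))
        has_integral (\<Sum>k\<le>N. a k * of_real (b k))) {0..pi}"
  proof (intro has_integral_sum has_integral_mult_right has_integral_of_real)
    fix k assume k: "k \<in> {..N}"
    have "(n + k + j) + (n + N - k) + 1 = 2 * n + N + j + 1" using k by simp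
    then show "((\<lambda>t. sin t * (1 + cos t) ^ (n + k + j) * (1 - cos t) ^ (n + N - k)) has_integral b k) {0..pi}"
      using sin_cos_beta_integral[of "n + k + j" "n + N - k"] unfolding b_def by (simp only:)
  qed simp
  have "(\<Sum>k\<le>N. a k * of_real (b k)) = jac_moment n N j"
  proof -
    define F :: complex where "F = fact (2 * n + N + j + 1)"
    have F: "F \<noteq> 0" unfolding F_def by (rule fact_nonzero)
    define D :: complex where "D = 2 ^ (n + j + 1) * fact (n + N) ^ 2 * fact j / (fact N * F)"
    have t: "a k * of_real (b k) = D * ((-1) ^ k * of_nat (N choose k) * of_nat ((n + j + k) choose j))"
      if k: "k \<le> N" for k
    proof -
      have 1: "of_nat ((n + N) choose k) = (fact (n + N) / (fact k * fact (n + N - k)) :: complex)"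
        by (rule binomial_fact) (use k in auto)
      have 2: "of_nat ((n + N) choose (k + n)) = (fact (n + N) / (fact (k + n) * fact (N - k)) :: complex)"
        using binomial_fact[of "k + n" "n + N", where ?'a=complex] k by (simp add: add.commute)
      have 3: "of_nat (N choose k) = (fact N / (fact k * fact (N - k)) :: complex)"
        by (rule binomial_fact) (use k in auto)
      have 4: "of_nat ((n + j + k) choose j) = (fact (n + k + j) / (fact j * fact (k + n)) :: complex)"
        using binomial_fact[of j "n + j + k", where ?'a=complex] by (simp add: add_ac)
      have 5: "(2::complex) ^ (2 * n + N + j + 1) = 2 ^ (n + N) * 2 ^ (n + j + 1)"
        unfolding power_add[symmetric] by (rule arg_cong[where f = "power 2"]) simp
      show ?thesis
        unfolding a_def b_def D_def 1 2 3 4 of_real_mult of_real_divide of_real_power of_real_numeral of_real_fact 5 F_def[symmetric]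
        using F by (simp add: field_simps power2_eq_square)
    qed
    have "(\<Sum>k\<le>N. a k * of_real (b k)) = D * (\<Sum>k\<le>N. (-1) ^ k * of_nat (N choose k) * of_nat ((n + j + k) choose j))"
      unfolding sum_distrib_left by (intro sum.cong refl t) simp
    also have "\<dots> = jac_moment n N j"
      unfolding binomial_finite_difference jac_moment_def D_def F_def by simp
    finally show ?thesis .
  qed
  then show ?thesis using hi unfolding eq by simp
qed

definition jac_norm :: "nat \<Rightarrow> nat \<Rightarrow> real" where
  "jac_norm n N = 2 * fact (n + N) ^ 2 / (fact N * fact (2 * n + N) * (2 * (n + N) + 1))"

lemma jac_norm_pos: "jac_norm n N > 0"
  unfolding jac_norm_def by (intro divide_pos_pos mult_pos_pos zero_less_power) (auto simp: add_pos_nonneg)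

text \<open>
  Against a factor of lower degree, expanded in powers of \<open>1 + c\<close>, all moments vanish; for equal degrees
  only the top power contributes.
\<close>

lemma jac_orthogonal:
  "((\<lambda>t. of_real (sin t ^ (2 * n + 1)) * jac n N (of_real (cos t)) * jac n M (of_real (cos t)))
     has_integral (if N = M then of_real (jac_norm n N) else 0)) {0..pi}"
proof -
  have *: "((\<lambda>t. of_real (sin t ^ (2 * n + 1)) * jac n N (of_real (cos t)) * jac n M (of_real (cos t)))
     has_integral (if N = M then of_real (jac_norm n N) else 0)) {0..pi}" if NM: "M \<le> N" for N M
  proof -
    obtain \<delta> where \<delta>: "\<And>c. jac n M c = (\<Sum>j\<le>M. \<delta> j * (1 + c) ^ j)"
      and \<delta>M: "\<delta> M = (-1) ^ M * of_nat ((2 * (n + M)) choose M) / 2 ^ (n + M)"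
      using jac_power_expansion[of n M] by blast
    have "((\<lambda>t. \<Sum>j\<le>M. \<delta> j * (of_real (sin t ^ (2 * n + 1)) * jac n N (of_real (cos t)) * (1 + of_real (cos t)) ^ j))
       has_integral (\<Sum>j\<le>M. \<delta> j * jac_moment n N j)) {0..pi}"
      by (intro has_integral_sum has_integral_mult_right jac_moment_integral) simp
    also have "(\<Sum>j\<le>M. \<delta> j * jac_moment n N j) = (if N = M then \<delta> M * jac_moment n M M else 0)"
    proof -
      have "(\<Sum>j\<le>M. \<delta> j * jac_moment n N j) = (\<Sum>j\<le>M. if j = M then (if N = M then \<delta> M * jac_moment n M M else 0) else 0)"
        by (intro sum.cong refl) (use NM in \<open>auto simp: jac_moment_def\<close>)
      then show ?thesis by simp
    qed
    also have "\<delta> M * jac_moment n M M = of_real (jac_norm n M)"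
    proof -
      have 1: "of_nat ((2 * (n + M)) choose M) = (fact (2 * (n + M)) / (fact M * fact (2 * n + M)) :: complex)"
        using binomial_fact[of M "2 * (n + M)", where ?'a=complex] by (simp add: algebra_simps)
      have 2: "(2::complex) ^ (n + M + 1) = 2 * 2 ^ (n + M)" by simp
      define X :: complex where "X = of_nat (2 * (n + M) + 1)"
      have X: "X \<noteq> 0" unfolding X_def of_nat_eq_0_iff by simp
      have 3: "fact (2 * n + M + M + 1) = X * fact (2 * (n + M))"
      proof -
        have "2 * n + M + M + 1 = Suc (2 * (n + M))" by simp
        then show ?thesis unfolding X_def by (simp only: fact_Suc) simp
      qed
      have 4: "of_real (jac_norm n M) = 2 * fact (n + M) ^ 2 / (fact M * fact (2 * n + M) * X)"
        unfolding jac_norm_def X_def by simp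
      have "(-1) ^ M * (-1) ^ M = (1::complex)" by (simp flip: power_mult_distrib)
      then have "\<delta> M * jac_moment n M M = (-1) ^ M * (-1) ^ M * (of_nat ((2 * (n + M)) choose M) / 2 ^ (n + M) *
         (2 ^ (n + M + 1) * fact (n + M) ^ 2 * fact M / (fact M * fact (2 * n + M + M + 1))))"
        unfolding \<delta>M jac_moment_def by simp
      also have "\<dots> = of_real (jac_norm n M)"
        unfolding \<open>(-1) ^ M * (-1) ^ M = (1::complex)\<close> 1 2 3 4
        using X by (simp add: field_simps)
      finally show ?thesis .
    qed
    finally have "((\<lambda>t. of_real (sin t ^ (2 * n + 1)) * jac n N (of_real (cos t)) * jac n M (of_real (cos t)))
       has_integral (if N = M then of_real (jac_norm n M) else 0)) {0..pi}"
      unfolding \<delta>[of "of_real (cos _)"] sum_distrib_left by (simp add: mult_ac)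
    then show ?thesis by (simp split: if_splits)
  qed
  show ?thesis
  proof (cases "M \<le> N")
    case True then show ?thesis by (rule *)
  next
    case False
    then have "N \<le> M" by simp
    from *[OF this] show ?thesis using False by (auto simp: mult_ac)
  qed
qed

definition jac_coeff :: "nat \<Rightarrow> nat \<Rightarrow> nat \<Rightarrow> complex" where
  "jac_coeff n N k = jac_moment n N k / of_real (jac_norm n N)"

lemma norm_jac_coeff_le: "N \<le> k \<Longrightarrow> norm (jac_coeff n N k) \<le> 4 ^ (n + k)"
proof -
  assume Nk: "N \<le> k"
  have *: "fact (2 * n + N) * fact k * (2 * (n + N) + 1) \<le> (fact (2 * n + N + k + 1) :: real)"
  proof -
    have "fact (2 * n + N) * fact k * ((2 * n + N + k) choose k) = (fact (2 * n + N + k) :: nat)"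
      using binomial_fact_lemma[of k "2 * n + N + k"] by (simp add: mult_ac)
    moreover have "(2 * n + N + k) choose k > 0" by (rule zero_less_binomial) simp
    ultimately have "fact (2 * n + N) * fact k \<le> (fact (2 * n + N + k) :: nat)"
      by (metis One_nat_def Suc_leI mult.right_neutral mult_le_mono2)
    then have "fact (2 * n + N) * fact k * (2 * (n + N) + 1) \<le> (fact (2 * n + N + k) * (2 * n + N + k + 1) :: nat)"
      by (rule mult_le_mono) (use Nk in auto)
    then have "fact (2 * n + N) * fact k * (2 * (n + N) + 1) \<le> (fact (2 * n + N + k + 1) :: nat)"
      by (simp add: mult.commute)
    then have "real (fact (2 * n + N) * fact k * (2 * (n + N) + 1)) \<le> real (fact (2 * n + N + k + 1))"
      by (simp only: of_nat_le_iff)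
    then show ?thesis by (simp add: algebra_simps)
  qed
  have "norm (jac_coeff n N k) = 2 ^ (n + k) * ((fact (2 * n + N) * fact k * (2 * (n + N) + 1)) / fact (2 * n + N + k + 1))
      * real ((n + k) choose (k - N))"
  proof -
    define F :: real where "F = fact (2 * n + N + k + 1)"
    define X where "X = 2 * (real n + real N) + 1"
    have FX: "F \<noteq> 0" "X > 0" unfolding F_def X_def by (auto simp: add_pos_nonneg simp del: fact_Suc)
    have 1: "norm (jac_moment n N k) = 2 ^ (n + k + 1) * fact (n + N) ^ 2 * fact k / (fact N * F) * real ((n + k) choose (k - N))"
      using Nk unfolding jac_moment_def F_def
      by (simp add: norm_mult norm_divide norm_power del: fact_Suc)
    have 2: "jac_norm n N = 2 * fact (n + N) ^ 2 / (fact N * fact (2 * n + N) * X)"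
      unfolding jac_norm_def X_def ..
    have 3: "norm (jac_coeff n N k) = norm (jac_moment n N k) / jac_norm n N"
      using jac_norm_pos[of n N] by (simp add: jac_coeff_def norm_divide)
    have 4: "real (2 * (n + N) + 1) = X" by (simp add: X_def)
    show ?thesis unfolding 3 unfolding 1 2 F_def[symmetric] 4
      using FX by (simp add: field_simps) (simp add: X_def algebra_simps)
  qed
  also have "\<dots> \<le> 2 ^ (n + k) * 1 * 2 ^ (n + k)"
  proof (intro mult_mono)
    show "(fact (2 * n + N) * fact k * (2 * (n + N) + 1)) / fact (2 * n + N + k + 1) \<le> (1::real)"
      using * by (simp add: divide_le_eq algebra_simps del: fact_Suc)
    have "(n + k) choose (k - N) \<le> 2 ^ (n + k)" by (rule binomial_le_pow2)
    then have "real ((n + k) choose (k - N)) \<le> real (2 ^ (n + k))" by (simp only: of_nat_le_iff)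
    then show "real ((n + k) choose (k - N)) \<le> 2 ^ (n + k)" by simp
  qed auto
  also have "\<dots> = 4 ^ (n + k)" by (simp flip: power_mult_distrib)
  finally show ?thesis .
qed

text \<open>
  Triangularity shows that some expansion exists, and integration against \<open>jac n M\<close> then identifies its
  coefficients. Knowing them in closed form is what permits the estimate \<open>norm_jac_coeff_le\<close>.
\<close>

lemma power_jac_expansion: "(1 + c) ^ k = (\<Sum>N\<le>k. jac_coeff n N k * jac n N c)"
proof -
  have ex: "\<exists>\<gamma>. \<forall>c. (1 + c) ^ k = (\<Sum>N\<le>k. \<gamma> N * jac n N c)" for k
  proof (induction k rule: less_induct)
    case (less k)
    then obtain \<gamma> where \<gamma>: "\<And>j c. j < k \<Longrightarrow> (1 + c) ^ j = (\<Sum>N\<le>j. \<gamma> j N * jac n N c)" by metis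
    obtain \<delta> where \<delta>: "\<And>c. jac n k c = (\<Sum>j\<le>k. \<delta> j * (1 + c) ^ j)"
      and \<delta>k: "\<delta> k = (-1) ^ k * of_nat ((2 * (n + k)) choose k) / 2 ^ (n + k)"
      using jac_power_expansion[of n k] by blast
    have nz: "\<delta> k \<noteq> 0" unfolding \<delta>k by simp
    define S where "S N = (\<Sum>j<k. (if N \<le> j then \<delta> j * \<gamma> j N else 0))" for N
    \<comment> \<open>Solve the power expansion of the degree k polynomial for its top power, the lower ones being known.\<close>
    have "(1 + c) ^ k = (\<Sum>N\<le>k. (if N = k then 1 / \<delta> k else - S N / \<delta> k) * jac n N c)" for c
    proof -
      have "jac n k c = \<delta> k * (1 + c) ^ k + (\<Sum>j<k. \<delta> j * (1 + c) ^ j)"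
        unfolding \<delta> by (simp add: lessThan_Suc_atMost[symmetric])
      also have "(\<Sum>j<k. \<delta> j * (1 + c) ^ j) = (\<Sum>j<k. \<Sum>N<k. (if N \<le> j then \<delta> j * \<gamma> j N else 0) * jac n N c)"
      proof (intro sum.cong refl)
        fix j assume j: "j \<in> {..<k}"
        have "(\<Sum>N\<le>j. \<gamma> j N * jac n N c) = (\<Sum>N<k. (if N \<le> j then \<gamma> j N else 0) * jac n N c)"
          by (rule sum.mono_neutral_cong_left) (use j in auto)
        then show "\<delta> j * (1 + c) ^ j = (\<Sum>N<k. (if N \<le> j then \<delta> j * \<gamma> j N else 0) * jac n N c)"
          using j by (auto simp: \<gamma> sum_distrib_left intro!: sum.cong)
      qed
      also have "\<dots> = (\<Sum>N<k. S N * jac n N c)"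
        unfolding S_def by (subst sum.swap) (simp add: sum_distrib_right)
      finally have "(1 + c) ^ k = (jac n k c - (\<Sum>N<k. S N * jac n N c)) / \<delta> k"
        using nz by (simp add: field_simps)
      also have "\<dots> = (\<Sum>N\<le>k. (if N = k then 1 / \<delta> k else - S N / \<delta> k) * jac n N c)"
        by (simp add: lessThan_Suc_atMost[symmetric] diff_divide_distrib sum_divide_distrib sum_negf)
      finally show ?thesis .
    qed
    then show ?case by (intro exI[of _ "\<lambda>N. if N = k then 1 / \<delta> k else - S N / \<delta> k"] allI)
  qed
  then obtain \<gamma> where \<gamma>: "\<And>c. (1 + c) ^ k = (\<Sum>N\<le>k. \<gamma> N * jac n N c)" by blast
  have "\<gamma> M = jac_coeff n M k" if M: "M \<le> k" for M
  proof -
    have "((\<lambda>t. \<Sum>N\<le>k. \<gamma> N * (of_real (sin t ^ (2 * n + 1)) * jac n M (of_real (cos t)) * jac n N (of_real (cos t))))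
       has_integral (\<Sum>N\<le>k. \<gamma> N * (if M = N then of_real (jac_norm n M) else 0))) {0..pi}"
      by (intro has_integral_sum has_integral_mult_right jac_orthogonal) simp
    moreover have "(\<Sum>N\<le>k. \<gamma> N * (of_real (sin t ^ (2 * n + 1)) * jac n M (of_real (cos t)) * jac n N (of_real (cos t))))
       = of_real (sin t ^ (2 * n + 1)) * jac n M (of_real (cos t)) * (1 + of_real (cos t)) ^ k" for t
      unfolding \<gamma> sum_distrib_left by (simp add: mult_ac)
    moreover have "(\<Sum>N\<le>k. \<gamma> N * (if M = N then of_real (jac_norm n M) else 0)) = \<gamma> M * of_real (jac_norm n M)"
      using M by (simp add: if_distrib cong: if_cong)
    ultimately have "((\<lambda>t. of_real (sin t ^ (2 * n + 1)) * jac n M (of_real (cos t)) * (1 + of_real (cos t)) ^ k)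
       has_integral \<gamma> M * of_real (jac_norm n M)) {0..pi}" by simp
    from has_integral_unique[OF this jac_moment_integral]
    show ?thesis using jac_norm_pos[of n M] unfolding jac_coeff_def by (simp add: field_simps)
  qed
  then show ?thesis using \<gamma> by simp
qed

section \<open>Laurent expansions in the punctured plane\<close>

text \<open>
  For \<open>f\<close> holomorphic away from 0 the radius 1 may be replaced by any other.
\<close>

definition laurent_coeff :: "(complex \<Rightarrow> complex) \<Rightarrow> int \<Rightarrow> complex" where
  "laurent_coeff f n = contour_integral (circlepath 0 1) (\<lambda>s. f s * s powi (- n - 1)) / (2 * pi * \<i>)"

lemma contour_integral_circlepath_radius_indep:
  assumes "f holomorphic_on - {0}" "0 < r" "0 < R"
  shows "contour_integral (circlepath 0 R) f = contour_integral (circlepath 0 r) f"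
    and "f contour_integrable_on circlepath 0 r"
proof -
  have hol: "f holomorphic_on UNIV - {0}" using assms(1) by (simp add: Compl_eq_Diff_UNIV)
  note * = contour_integral_circlepath_eq[OF open_UNIV hol]
  show "contour_integral (circlepath 0 R) f = contour_integral (circlepath 0 r) f"
    using *(3)[of r R] *(3)[of R r] assms(2,3) by (cases "r \<le> R") auto
  show "f contour_integrable_on circlepath 0 r"
    using *(1)[of r r] assms(2) by auto
qed

lemma laurent_coeff_integral:
  assumes f: "f holomorphic_on - {0}" and r: "0 < r"
  shows "((\<lambda>s. f s * s powi (- n - 1)) has_contour_integral (2 * pi * \<i> * laurent_coeff f n)) (circlepath 0 r)"
proof -
  have h: "(\<lambda>s. f s * s powi (- n - 1)) holomorphic_on - {0}"
    by (intro holomorphic_intros f) auto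
  from contour_integral_circlepath_radius_indep[OF this zero_less_one r]
       contour_integral_circlepath_radius_indep(2)[OF h r r]
  show ?thesis unfolding laurent_coeff_def
    by (simp add: has_contour_integral_integral contour_integrable_on_def) (metis contour_integral_unique)
qed

lemma norm_laurent_coeff_le:
  assumes f: "f holomorphic_on - {0}" and r: "0 < r"
    and M: "\<And>s. norm s = r \<Longrightarrow> norm (f s) \<le> M"
  shows "norm (laurent_coeff f n) \<le> M * r powi (- n)"
proof -
  have "norm (f (of_real r)) \<le> M" by (rule M) (use r in simp)
  then have M0: "0 \<le> M" using norm_ge_zero order_trans by blast
  have "norm (2 * pi * \<i> * laurent_coeff f n) \<le> M * r powi (- n - 1) * (2 * pi * r)"
  proof (rule has_contour_integral_bound_circlepath[OF laurent_coeff_integral[OF f r]])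
    show "0 \<le> M * r powi (- n - 1)" using M0 r by simp
    fix x :: complex assume x: "norm (x - 0) = r"
    then show "norm (f x * x powi (- n - 1)) \<le> M * r powi (- n - 1)"
      using M[of x] r by (auto simp: norm_mult norm_power_int intro!: mult_right_mono)
  qed (use r in auto)
  then have "norm (laurent_coeff f n) \<le> M * (r powi (- n - 1) * r)"
    by (simp add: norm_mult field_simps)
  also have "r powi (- n - 1) * r = r powi (- n)"
    using r power_int_add_1[of r "- n - 1"] by simp
  finally show ?thesis .
qed

text \<open>
  On the circle of radius \<open>R > |s|\<close> the kernel \<open>1 / (u - s)\<close> is a geometric series in \<open>s / u\<close>.
\<close>

lemma cauchy_outer_series:
  assumes f: "f holomorphic_on - {0}" and s: "norm s < R"
  shows "(\<lambda>n. laurent_coeff f (int n) * s ^ n) sums (contour_integral (circlepath 0 R) (\<lambda>u. f u / (u - s)) / (2 * pi * \<i>))"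
proof -
  have R: "0 < R" using s norm_ge_zero le_less_trans by blast
  have "continuous_on (sphere 0 R) f"
    by (intro holomorphic_on_imp_continuous_on holomorphic_on_subset[OF f]) (use R in auto)
  then have "compact (f ` sphere 0 R)" by (intro compact_continuous_image) auto
  then obtain M where M: "\<And>u. norm u = R \<Longrightarrow> norm (f u) \<le> M"
    unfolding compact_eq_bounded_closed bounded_iff by (metis imageI mem_sphere_0)
  let ?F = "\<lambda>n u. s ^ n * (f u * u powi (- int n - 1))"
  have "uniform_limit (sphere 0 R) (\<lambda>N u. \<Sum>n<N. ?F n u) (\<lambda>u. suminf (\<lambda>n. ?F n u)) sequentially"
  proof (rule Weierstrass_m_test)
    fix n u assume u: "u \<in> sphere (0::complex) R"
    have "norm (?F n u) = norm s ^ n * (norm (f u) * R powi (- int n - 1))"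
      using u by (simp add: norm_mult norm_power norm_power_int)
    also have "\<dots> \<le> norm s ^ n * (M * R powi (- int n - 1))"
      using M[of u] u R by (intro mult_left_mono mult_right_mono) auto
    also have "\<dots> = M / R * (norm s / R) ^ n"
      using R by (simp add: power_int_diff power_int_minus field_simps power_divide)
    finally show "norm (?F n u) \<le> M / R * (norm s / R) ^ n" .
  next
    show "summable (\<lambda>n. M / R * (norm s / R) ^ n)"
      by (intro summable_mult summable_geometric) (use s R in auto)
  qed
  also have "?this \<longleftrightarrow> uniform_limit (sphere 0 R) (\<lambda>N u. \<Sum>n<N. ?F n u) (\<lambda>u. f u / (u - s)) sequentially"
  proof (rule uniform_limit_cong')
    fix u assume u: "u \<in> sphere (0::complex) R"
    then have u0: "u \<noteq> 0" and "norm (s / u) < 1" "u \<noteq> s" using R s by (auto simp: norm_divide)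
    from sums_mult[OF geometric_sums[OF this(2)], of "f u / u"]
    have "(\<lambda>n. f u / u * (s / u) ^ n) sums (f u / u * (1 / (1 - s / u)))" .
    also have "(\<lambda>n. f u / u * (s / u) ^ n) = (\<lambda>n. ?F n u)"
      using u0 by (simp add: power_int_diff power_int_minus field_simps fun_eq_iff power_divide)
    also have "f u / u * (1 / (1 - s / u)) = f u / (u - s)"
      using u0 \<open>u \<noteq> s\<close> by (simp add: field_simps)
    finally show "suminf (\<lambda>n. ?F n u) = f u / (u - s)" by (rule sums_unique[symmetric])
  qed auto
  finally have ul: "uniform_limit (sphere 0 R) (\<lambda>N u. \<Sum>n<N. ?F n u) (\<lambda>u. f u / (u - s)) sequentially" .
  have ci: "((\<lambda>u. \<Sum>n<N. ?F n u) has_contour_integral (\<Sum>n<N. s ^ n * (2 * pi * \<i> * laurent_coeff f (int n)))) (circlepath 0 R)" for N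
    by (intro has_contour_integral_sum has_contour_integral_lmul laurent_coeff_integral f R) auto
  have "(\<lambda>N. contour_integral (circlepath 0 R) (\<lambda>u. \<Sum>n<N. ?F n u)) \<longlonglongrightarrow> contour_integral (circlepath 0 R) (\<lambda>u. f u / (u - s))"
    by (rule contour_integral_uniform_limit_circlepath[OF _ ul])
       (intro always_eventually allI has_contour_integral_integrable[OF ci] trivial_limit_sequentially R)+
  then have "(\<lambda>n. s ^ n * (2 * pi * \<i> * laurent_coeff f (int n))) sums contour_integral (circlepath 0 R) (\<lambda>u. f u / (u - s))"
    unfolding sums_def contour_integral_unique[OF ci] .
  from sums_divide[OF this, of "2 * pi * \<i>"] show ?thesis by (simp add: mult_ac)
qed

text \<open>
  On the circle of radius \<open>r < |s|\<close> the kernel \<open>1 / (u - s)\<close> is a geometric series in \<open>u / s\<close>, which produces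
  the negative powers of \<open>s\<close>.
\<close>

lemma cauchy_inner_series:
  assumes f: "f holomorphic_on - {0}" and s: "r < norm s" and r: "0 < r"
  shows "(\<lambda>n. laurent_coeff f (- int (Suc n)) / s ^ Suc n) sums
           (- contour_integral (circlepath 0 r) (\<lambda>u. f u / (u - s)) / (2 * pi * \<i>))"
proof -
  have s0: "s \<noteq> 0" using s r by auto
  have "continuous_on (sphere 0 r) f"
    by (intro holomorphic_on_imp_continuous_on holomorphic_on_subset[OF f]) (use r in auto)
  then have "compact (f ` sphere 0 r)" by (intro compact_continuous_image) auto
  then obtain M where M: "\<And>u. norm u = r \<Longrightarrow> norm (f u) \<le> M"
    unfolding compact_eq_bounded_closed bounded_iff by (metis imageI mem_sphere_0)
  let ?F = "\<lambda>n u. - inverse (s ^ Suc n) * (f u * u powi (- (- int (Suc n)) - 1))"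
  have F: "?F n u = - inverse (s ^ Suc n) * (f u * u ^ n)" for n u by simp
  have "uniform_limit (sphere 0 r) (\<lambda>N u. \<Sum>n<N. ?F n u) (\<lambda>u. suminf (\<lambda>n. ?F n u)) sequentially"
  proof (rule Weierstrass_m_test)
    fix n u assume u: "u \<in> sphere (0::complex) r"
    have "norm (?F n u) = inverse (norm s ^ Suc n) * (norm (f u) * r ^ n)"
      using u unfolding F by (simp add: norm_mult norm_power norm_inverse)
    also have "\<dots> \<le> inverse (norm s ^ Suc n) * (M * r ^ n)"
      using M[of u] u r by (intro mult_left_mono mult_right_mono) auto
    also have "\<dots> = M / norm s * (r / norm s) ^ n"
      using s0 by (simp add: field_simps power_divide)
    finally show "norm (?F n u) \<le> M / norm s * (r / norm s) ^ n" .
  next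
    show "summable (\<lambda>n. M / norm s * (r / norm s) ^ n)"
      by (intro summable_mult summable_geometric) (use s s0 r in \<open>auto simp: divide_less_eq_1\<close>)
  qed
  also have "?this \<longleftrightarrow> uniform_limit (sphere 0 r) (\<lambda>N u. \<Sum>n<N. ?F n u) (\<lambda>u. f u / (u - s)) sequentially"
  proof (rule uniform_limit_cong')
    fix u assume u: "u \<in> sphere (0::complex) r"
    then have "norm (u / s) < 1" "u \<noteq> s" using r s s0 by (auto simp: norm_divide divide_less_eq_1)
    from sums_mult[OF geometric_sums[OF this(1)], of "- f u / s"]
    have "(\<lambda>n. - f u / s * (u / s) ^ n) sums (- f u / s * (1 / (1 - u / s)))" .
    also have "(\<lambda>n. - f u / s * (u / s) ^ n) = (\<lambda>n. ?F n u)"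
      unfolding F using s0 by (simp add: field_simps fun_eq_iff power_divide)
    also have "- f u / s * (1 / (1 - u / s)) = f u / (u - s)"
      using s0 \<open>u \<noteq> s\<close> by (simp add: field_simps)
    finally show "suminf (\<lambda>n. ?F n u) = f u / (u - s)" by (rule sums_unique[symmetric])
  qed auto
  finally have ul: "uniform_limit (sphere 0 r) (\<lambda>N u. \<Sum>n<N. ?F n u) (\<lambda>u. f u / (u - s)) sequentially" .
  have ci: "((\<lambda>u. \<Sum>n<N. ?F n u) has_contour_integral
      (\<Sum>n<N. - inverse (s ^ Suc n) * (2 * pi * \<i> * laurent_coeff f (- int (Suc n))))) (circlepath 0 r)" for N
    by (intro has_contour_integral_sum has_contour_integral_lmul laurent_coeff_integral f r) auto
  have "(\<lambda>N. contour_integral (circlepath 0 r) (\<lambda>u. \<Sum>n<N. ?F n u)) \<longlonglongrightarrow> contour_integral (circlepath 0 r) (\<lambda>u. f u / (u - s))"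
    by (rule contour_integral_uniform_limit_circlepath[OF _ ul])
       (intro always_eventually allI has_contour_integral_integrable[OF ci] trivial_limit_sequentially r)+
  then have "(\<lambda>n. - inverse (s ^ Suc n) * (2 * pi * \<i> * laurent_coeff f (- int (Suc n)))) sums contour_integral (circlepath 0 r) (\<lambda>u. f u / (u - s))"
    unfolding sums_def contour_integral_unique[OF ci] .
  from sums_divide[OF sums_minus[OF this], of "2 * pi * \<i>"]
  have *: "(\<lambda>n. - (- inverse (s ^ Suc n) * (2 * pi * \<i> * laurent_coeff f (- int (Suc n)))) / (2 * pi * \<i>)) sums
     (- contour_integral (circlepath 0 r) (\<lambda>u. f u / (u - s)) / (2 * pi * \<i>))" .
  have "- (- inverse p * (x * y)) / x = y / p" if "x \<noteq> 0" for x y p :: complex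
    using that by (simp add: field_simps)
  note ** = this
  have "- (- inverse p * (2 * pi * \<i> * y)) / (2 * pi * \<i>) = y / p" for y p :: complex
    by (rule **) simp
  with * show ?thesis by (simp only:)
qed

text \<open>
  Cauchy's formula for an annulus: the difference quotient of \<open>f\<close> at \<open>s\<close> has a removable singularity, so its
  integrals over an outer and an inner circle agree, and the difference of the two integrals of
  \<open>f u / (u - s)\<close> is \<open>2 \<pi> \<i> f s\<close>.
\<close>

theorem laurent_expansion_punctured_plane:
  assumes f: "f holomorphic_on - {0}" and s: "s \<noteq> 0"
  obtains S1 S2 where "(\<lambda>n. laurent_coeff f (int n) * s ^ n) sums S1"
    and "(\<lambda>n. laurent_coeff f (- int (Suc n)) / s ^ Suc n) sums S2"
    and "f s = S1 + S2"
proof -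
  define r where "r = norm s / 2"
  define R where "R = norm s * 2"
  have r: "0 < r" "r < norm s" "norm s < R" "0 < R" using s by (auto simp: r_def R_def)
  define \<phi> where "\<phi> = (\<lambda>u. if u = s then deriv f s else (f u - f s) / (u - s))"
  have "\<phi> holomorphic_on - {0}"
    unfolding \<phi>_def by (rule pole_lemma[OF f]) (use s in \<open>simp add: interior_open open_Compl\<close>)
  then have eq: "contour_integral (circlepath 0 R) \<phi> = contour_integral (circlepath 0 r) \<phi>"
    by (rule contour_integral_circlepath_radius_indep) (use r in auto)
  have int1: "(\<lambda>u. f u / (u - s)) contour_integrable_on circlepath 0 \<rho>" if "0 < \<rho>" "\<rho> \<noteq> norm s" for \<rho>
    by (intro contour_integrable_continuous_circlepath continuous_intros
          holomorphic_on_imp_continuous_on holomorphic_on_subset[OF f]) (use that in auto)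
  have ci: "contour_integral (circlepath 0 \<rho>) \<phi> = contour_integral (circlepath 0 \<rho>) (\<lambda>u. f u / (u - s)) - f s * i"
    if "0 < \<rho>" "\<rho> \<noteq> norm s" "((\<lambda>u. 1 / (u - s)) has_contour_integral i) (circlepath 0 \<rho>)" for \<rho> i
  proof -
    have "((\<lambda>u. f u / (u - s) - f s * (1 / (u - s))) has_contour_integral
        contour_integral (circlepath 0 \<rho>) (\<lambda>u. f u / (u - s)) - f s * i) (circlepath 0 \<rho>)"
      by (intro has_contour_integral_diff has_contour_integral_lmul that has_contour_integral_integral int1)
    then have "(\<phi> has_contour_integral
        contour_integral (circlepath 0 \<rho>) (\<lambda>u. f u / (u - s)) - f s * i) (circlepath 0 \<rho>)"
      by (rule has_contour_integral_eq) (use that in \<open>auto simp: \<phi>_def diff_divide_distrib\<close>)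
    then show ?thesis by (rule contour_integral_unique)
  qed
  have "((\<lambda>u. 1 / (u - s)) has_contour_integral (2 * of_real pi * \<i> * 1)) (circlepath 0 R)"
    by (rule Cauchy_integral_circlepath_simple[where f = "\<lambda>_. 1"]) (use r in auto)
  then have R': "((\<lambda>u. 1 / (u - s)) has_contour_integral (2 * pi * \<i>)) (circlepath 0 R)" by simp
  have r': "((\<lambda>u. 1 / (u - s)) has_contour_integral 0) (circlepath 0 r)"
  proof (rule Cauchy_theorem_convex_simple[of _ "cball 0 r"])
    show "(\<lambda>u. 1 / (u - s)) holomorphic_on cball 0 r"
      by (intro holomorphic_intros) (use r in auto)
  qed (use r in auto)
  have main: "contour_integral (circlepath 0 R) (\<lambda>u. f u / (u - s)) - contour_integral (circlepath 0 r) (\<lambda>u. f u / (u - s))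
      = 2 * pi * \<i> * f s"
    using eq ci[OF _ _ R'] ci[OF _ _ r'] r by (simp add: algebra_simps)
  have main': "(contour_integral (circlepath 0 R) (\<lambda>u. f u / (u - s)) - contour_integral (circlepath 0 r) (\<lambda>u. f u / (u - s)))
      / (2 * pi * \<i>) = f s"
    unfolding main by simp
  show ?thesis
  proof (rule that[OF cauchy_outer_series[OF f r(3)] cauchy_inner_series[OF f r(2) r(1)]])
    show "f s = contour_integral (circlepath 0 R) (\<lambda>u. f u / (u - s)) / (2 * pi * \<i>) +
         - contour_integral (circlepath 0 r) (\<lambda>u. f u / (u - s)) / (2 * pi * \<i>)"
      unfolding main'[symmetric] by (simp add: diff_divide_distrib)
  qed
qed

lemma entire_taylor:
  assumes "u holomorphic_on UNIV"
  shows "(\<lambda>k. (deriv ^^ k) u a / fact k * (c - a) ^ k) sums u c"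
proof -
  have "u holomorphic_on ball a (dist a c + 1)" using assms by (rule holomorphic_on_subset) simp
  then show ?thesis by (rule holomorphic_power_series) simp
qed

lemma entire_taylor_coeff_le:
  assumes "u holomorphic_on UNIV" "0 < R" "\<And>c. norm (c - a) = R \<Longrightarrow> norm (u c) \<le> M"
  shows "norm ((deriv ^^ k) u a / fact k) \<le> M / R ^ k"
proof -
  have "norm ((deriv ^^ k) u a) \<le> fact k * M / R ^ k"
    by (rule Cauchy_inequality)
       (use assms in \<open>auto simp: norm_minus_commute intro: holomorphic_on_subset
         intro!: holomorphic_on_imp_continuous_on\<close>)
  then show ?thesis by (simp add: norm_divide field_simps)
qed

section \<open>Holomorphic dependence of the Laurent coefficients on a parameter\<close>

text \<open>
  Integrating the Taylor series in \<open>c\<close> term by term exhibits the coefficient as an everywhere convergent power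
  series. The Taylor coefficients of \<open>h s\<close> are continuous in \<open>s\<close> by the Cauchy estimate for the differences
  \<open>h s' - h s\<close>, hence integrable over the circle.
\<close>

lemma laurent_coeff_entire:
  fixes h :: "complex \<Rightarrow> complex \<Rightarrow> complex"
  assumes cont: "continuous_on ((- {0}) \<times> UNIV) (\<lambda>(s, c). h s c)"
    and hol: "\<And>s. s \<noteq> 0 \<Longrightarrow> h s holomorphic_on UNIV"
  shows "(\<lambda>c. laurent_coeff (\<lambda>s. h s c) n) holomorphic_on UNIV"
proof -
  let ?t = "\<lambda>k s. (deriv ^^ k) (h s) 0 / fact k"
  have bnd: "\<exists>M. \<forall>s c. norm s = 1 \<longrightarrow> norm c \<le> R \<longrightarrow> norm (h s c) \<le> M" for R
  proof -
    have "compact ((\<lambda>(s, c). h s c) ` (sphere 0 1 \<times> cball 0 R))"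
      by (intro compact_continuous_image continuous_on_subset[OF cont] compact_Times) auto
    then obtain a where "\<forall>x\<in>(\<lambda>(s, c). h s c) ` (sphere 0 1 \<times> cball 0 R). norm x \<le> a"
      unfolding compact_eq_bounded_closed bounded_iff by blast
    then have "\<forall>s c. norm s = 1 \<longrightarrow> norm c \<le> R \<longrightarrow> norm (h s c) \<le> a" by auto
    then show ?thesis ..
  qed
  have tcont: "continuous_on (sphere 0 1) (?t k)" for k
    unfolding continuous_on_iff
  proof (intro ballI allI impI)
    fix s e :: "_" assume s: "s \<in> sphere (0::complex) 1" and e: "(e::real) > 0"
    have "uniformly_continuous_on (sphere 0 1 \<times> cball 0 1) (\<lambda>(s, c). h s c)"
      by (intro compact_uniformly_continuous continuous_on_subset[OF cont] compact_Times) auto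
    then obtain d where d: "d > 0" and D: "\<And>x y. x \<in> sphere 0 1 \<times> cball 0 1 \<Longrightarrow> y \<in> sphere 0 1 \<times> cball 0 1 \<Longrightarrow>
        dist y x < d \<Longrightarrow> dist ((\<lambda>(s, c). h s c) y) ((\<lambda>(s, c). h s c) x) < e / 2"
      unfolding uniformly_continuous_on_def using e by (metis half_gt_zero)
    have "dist (?t k s') (?t k s) < e" if s': "s' \<in> sphere 0 1" "dist s' s < d" for s'
    proof -
      have ss: "s \<noteq> 0" "s' \<noteq> 0" using s s' by auto
      have "norm ((deriv ^^ k) (\<lambda>c. h s' c - h s c) 0 / fact k) \<le> (e / 2) / 1 ^ k"
      proof (rule entire_taylor_coeff_le)
        show "(\<lambda>c. h s' c - h s c) holomorphic_on UNIV"
          using hol ss by (intro holomorphic_intros) auto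
        fix c :: complex assume "norm (c - 0) = 1"
        then show "norm (h s' c - h s c) \<le> e / 2"
          using D[of "(s, c)" "(s', c)"] s s' by (simp add: dist_prod_def dist_norm)
      qed simp
      also have "(deriv ^^ k) (\<lambda>c. h s' c - h s c) 0 = (deriv ^^ k) (h s') 0 - (deriv ^^ k) (h s) 0"
        by (rule higher_deriv_diff[OF hol hol]) (use ss in auto)
      finally show ?thesis using e by (simp add: dist_norm diff_divide_distrib)
    qed
    then show "\<exists>d>0. \<forall>x'\<in>sphere 0 1. dist x' s < d \<longrightarrow> dist (?t k x') (?t k s) < e" using d by blast
  qed
  have sums: "(\<lambda>k. contour_integral (circlepath 0 1) (\<lambda>s. ?t k s * s powi (- n - 1)) / (2 * pi * \<i>) * (c - 0) ^ k)
     sums laurent_coeff (\<lambda>s. h s c) n" for c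
  proof -
    define R where "R = norm c + 1"
    have R: "0 < R" "norm c < R" unfolding R_def by (simp_all add: add_nonneg_pos)
    obtain M where M: "\<And>s c. norm s = 1 \<Longrightarrow> norm c \<le> R \<Longrightarrow> norm (h s c) \<le> M" using bnd[of R] by blast
    let ?F = "\<lambda>k s. c ^ k * (?t k s * s powi (- n - 1))"
    have "uniform_limit (sphere 0 1) (\<lambda>N s. \<Sum>k<N. ?F k s) (\<lambda>s. suminf (\<lambda>k. ?F k s)) sequentially"
    proof (rule Weierstrass_m_test)
      fix k s assume s: "s \<in> sphere (0::complex) 1"
      have "s \<noteq> 0" using s by auto
      then have "norm (?t k s) \<le> M / R ^ k"
        by (intro entire_taylor_coeff_le hol) (use M s R in auto)
      then have "norm c ^ k * norm (?t k s) \<le> norm c ^ k * (M / R ^ k)"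
        by (intro mult_left_mono) auto
      then show "norm (?F k s) \<le> M * (norm c / R) ^ k"
        using s by (simp add: norm_mult norm_divide norm_power norm_power_int power_divide mult_ac)
    next
      show "summable (\<lambda>k. M * (norm c / R) ^ k)"
        by (intro summable_mult summable_geometric) (use R in auto)
    qed
    also have "?this \<longleftrightarrow> uniform_limit (sphere 0 1) (\<lambda>N s. \<Sum>k<N. ?F k s) (\<lambda>s. h s c * s powi (- n - 1)) sequentially"
    proof (rule uniform_limit_cong')
      fix s assume s: "s \<in> sphere (0::complex) 1"
      then have "s \<noteq> 0" by auto
      from sums_mult[OF entire_taylor[OF hol[OF this], of 0 c], of "s powi (- n - 1)"]
      have "(\<lambda>k. ?F k s) sums (h s c * s powi (- n - 1))" by (simp add: mult_ac)
      then show "suminf (\<lambda>k. ?F k s) = h s c * s powi (- n - 1)" by (rule sums_unique[symmetric])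
    qed auto
    finally have ul: "uniform_limit (sphere 0 1) (\<lambda>N s. \<Sum>k<N. ?F k s) (\<lambda>s. h s c * s powi (- n - 1)) sequentially" .
    have int: "(\<lambda>s. ?t k s * s powi (- n - 1)) contour_integrable_on circlepath 0 1" for k
      by (intro contour_integrable_continuous_circlepath continuous_intros continuous_on_subset[OF tcont]) auto
    have ci: "((\<lambda>s. \<Sum>k<N. ?F k s) has_contour_integral
        (\<Sum>k<N. c ^ k * contour_integral (circlepath 0 1) (\<lambda>s. ?t k s * s powi (- n - 1)))) (circlepath 0 1)" for N
      by (intro has_contour_integral_sum has_contour_integral_lmul has_contour_integral_integral int) auto
    have "(\<lambda>N. contour_integral (circlepath 0 1) (\<lambda>s. \<Sum>k<N. ?F k s)) \<longlonglongrightarrow>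
       contour_integral (circlepath 0 1) (\<lambda>s. h s c * s powi (- n - 1))"
      by (rule contour_integral_uniform_limit_circlepath[OF _ ul])
         (intro always_eventually allI has_contour_integral_integrable[OF ci] trivial_limit_sequentially zero_less_one)+
    then have "(\<lambda>k. c ^ k * contour_integral (circlepath 0 1) (\<lambda>s. ?t k s * s powi (- n - 1))) sums
       contour_integral (circlepath 0 1) (\<lambda>s. h s c * s powi (- n - 1))"
      unfolding sums_def contour_integral_unique[OF ci] .
    from sums_divide[OF this, of "2 * pi * \<i>"] show ?thesis
      unfolding laurent_coeff_def by (simp add: mult_ac)
  qed
  have "(\<lambda>c. laurent_coeff (\<lambda>s. h s c) n) holomorphic_on ball 0 R" for R
    by (rule power_series_holomorphic) (rule sums)
  then have "(\<lambda>c. laurent_coeff (\<lambda>s. h s c) n) field_differentiable at c" for c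
    by (rule holomorphic_on_imp_differentiable_at[of _ "ball 0 (norm c + 1)"]) auto
  then show ?thesis by (simp add: holomorphic_on_def field_differentiable_at_within)
qed

section \<open>Light-cone coordinates on the complex sphere\<close>

text \<open>
  The linear forms whose product is \<open>z\<^sub>1\<^sup>2 + z\<^sub>2\<^sup>2\<close>, and the point with given values of these forms and of
  \<open>z\<^sub>3\<close>.
\<close>

definition cA :: "complex^3 \<Rightarrow> complex" where "cA z = z $ 1 + \<i> * z $ 2"
definition cB :: "complex^3 \<Rightarrow> complex" where "cB z = z $ 1 - \<i> * z $ 2"
definition pt :: "complex \<Rightarrow> complex \<Rightarrow> complex \<Rightarrow> complex^3" where
  "pt a b c = (\<chi> i. if i = 1 then (a + b) / 2 else if i = 2 then (a - b) / (2 * \<i>) else c)"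

lemma pt_nth [simp]: "pt a b c $ 1 = (a + b) / 2" "pt a b c $ 2 = (a - b) / (2 * \<i>)" "pt a b c $ 3 = c"
  by (simp_all add: pt_def)

lemma cA_pt [simp]: "cA (pt a b c) = a" and cB_pt [simp]: "cB (pt a b c) = b"
  by (simp_all add: cA_def cB_def field_simps)

lemma pt_coords [simp]: "pt (cA z) (cB z) (z $ 3) = z"
  by (simp add: vec_eq_iff forall_3 cA_def cB_def field_simps)

lemma csphere_iff: "z \<in> csphere \<longleftrightarrow> cA z * cB z = 1 - (z $ 3)\<^sup>2"
proof -
  have "cA z * cB z = (z $ 1)\<^sup>2 + (z $ 2)\<^sup>2"
    by (simp add: cA_def cB_def power2_eq_square algebra_simps)
  then show ?thesis unfolding csphere_def by (auto simp: algebra_simps)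
qed

lemma pt_in_csphere [simp]: "pt a b c \<in> csphere \<longleftrightarrow> a * b = 1 - c\<^sup>2"
  by (simp add: csphere_iff)

lemma norm_pt_le: "norm (pt a b c) \<le> norm a + norm b + norm c"
proof -
  have "norm (pt a b c) \<le> (\<Sum>i\<in>UNIV. norm (pt a b c $ i))"
    unfolding norm_vec_def by (rule L2_set_le_sum) simp
  also have "\<dots> = norm (a + b) / 2 + norm (a - b) / 2 + norm c"
    by (simp add: sum_3 norm_divide norm_mult)
  also have "\<dots> \<le> (norm a + norm b) / 2 + (norm a + norm b) / 2 + norm c"
    by (intro add_mono divide_right_mono norm_triangle_ineq norm_triangle_ineq4) auto
  finally show ?thesis by simp
qed

lemma norm_cA_le: "norm (cA z) \<le> 2 * norm z" and norm_cB_le: "norm (cB z) \<le> 2 * norm z"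
proof -
  have *: "norm (z $ 1) \<le> norm z" "norm (z $ 2) \<le> norm z" by (rule Finite_Cartesian_Product.norm_nth_le)+
  show "norm (cA z) \<le> 2 * norm z" using norm_triangle_ineq[of "z $ 1" "\<i> * z $ 2"] *
    by (simp add: cA_def norm_mult)
  show "norm (cB z) \<le> 2 * norm z" using norm_triangle_ineq4[of "z $ 1" "\<i> * z $ 2"] *
    by (simp add: cB_def norm_mult)
qed

lemma continuous_on_pt [continuous_intros]:
  "continuous_on S a \<Longrightarrow> continuous_on S b \<Longrightarrow> continuous_on S c \<Longrightarrow> continuous_on S (\<lambda>x. pt (a x) (b x) (c x))"
  unfolding pt_def
proof (intro continuous_on_vec_lambda)
  fix i :: 3
  assume "continuous_on S a" "continuous_on S b" "continuous_on S c"
  then show "continuous_on S (\<lambda>x. if i = 1 then (a x + b x) / 2 else if i = 2 then (a x - b x) / (2 * \<i>) else c x)"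
    by (cases "i = 1"; cases "i = 2") (auto intro!: continuous_intros)
qed

lemma continuous_on_cA [continuous_intros]: "continuous_on S cA"
  and continuous_on_cB [continuous_intros]: "continuous_on S cB"
  unfolding cA_def[abs_def] cB_def[abs_def] by (intro continuous_intros)+

lemma closed_csphere: "closed csphere"
proof -
  have "csphere = {z. cA z * cB z = 1 - (z $ 3)\<^sup>2}" using csphere_iff by blast
  moreover have "closed {z. cA z * cB z = 1 - (z $ 3)\<^sup>2}"
    by (intro closed_Collect_eq continuous_intros)
  ultimately show ?thesis by simp
qed

text \<open>
  In the coordinates of \<open>\<Omega>\<close>, \<open>cB\<close> is \<open>-2 w / (1 - z w)\<close> and \<open>cA\<close> is \<open>2 z / (1 - z w)\<close>. With \<open>-cA\<close> in place
  of \<open>cA\<close> the factor \<open>(-1)\<^sup>n\<close> of the Poisson modes is included for both signs of \<open>n\<close>.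
\<close>

definition circ :: "int \<Rightarrow> complex^3 \<Rightarrow> complex" where
  "circ n z = (if n \<ge> 0 then cB z ^ nat n else (- cA z) ^ nat (- n))"

lemma continuous_on_circ [continuous_intros]: "continuous_on S (circ n)"
  unfolding circ_def[abs_def] by (cases "n \<ge> 0") (auto intro!: continuous_intros)

lemma norm_circ_le:
  assumes "norm z \<le> \<rho>"
  shows "norm (circ n z) \<le> (2 * \<rho>) ^ nat \<bar>n\<bar>"
proof -
  define K where "K = 2 * \<rho>"
  have "norm (cA z) \<le> K" "norm (cB z) \<le> K"
    using norm_cA_le[of z] norm_cB_le[of z] assms unfolding K_def by linarith+
  then have "norm (circ n z) \<le> K ^ nat \<bar>n\<bar>" by (auto simp: circ_def norm_power intro!: power_mono)
  then show ?thesis unfolding K_def .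
qed

text \<open>
  Powers of \<open>1 + z\<^sub>3\<close> are preferred to powers of \<open>z\<^sub>3\<close> since the moments of the Jacobi polynomials against
  them have a closed form.
\<close>

definition lmon :: "int \<Rightarrow> nat \<Rightarrow> complex^3 \<Rightarrow> complex" where
  "lmon n k z = circ n z * (1 + z $ 3) ^ k"

lemma norm_lmon_le:
  assumes "norm z \<le> \<rho>"
  shows "norm (lmon n k z) \<le> (1 + 2 * \<rho>) ^ (nat \<bar>n\<bar> + k)"
proof -
  have \<rho>: "0 \<le> \<rho>" using assms norm_ge_zero order_trans by blast
  have "norm (1 + z $ 3) \<le> 1 + norm (z $ 3)" using norm_triangle_ineq[of 1 "z $ 3"] by simp
  also have "norm (z $ 3) \<le> norm z" by (rule Finite_Cartesian_Product.norm_nth_le)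
  finally have "norm (1 + z $ 3) \<le> 1 + 2 * \<rho>" using assms \<rho> by linarith
  then have "norm ((1 + z $ 3) ^ k) \<le> (1 + 2 * \<rho>) ^ k" by (simp add: norm_power power_mono)
  moreover have "norm (circ n z) \<le> (1 + 2 * \<rho>) ^ nat \<bar>n\<bar>"
    using norm_circ_le[OF assms, of n] \<rho> power_mono[of "2 * \<rho>" "1 + 2 * \<rho>" "nat \<bar>n\<bar>"] by simp
  ultimately show ?thesis unfolding lmon_def norm_mult power_add by (intro mult_mono) (use \<rho> in auto)
qed

section \<open>Rapidly decreasing arrays\<close>

text \<open>
  Decay faster than every geometric sequence in the total degree. Any loss that is geometric in the degree, be it
  the size of the basis functions on a ball, the entries of a change of basis or an eigenvalue, is
  absorbed by choosing \<open>r\<close> smaller.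
\<close>

definition rapid :: "(int \<Rightarrow> nat \<Rightarrow> complex) \<Rightarrow> bool" where
  "rapid g \<longleftrightarrow> (\<forall>r>0. \<exists>C. \<forall>n k. norm (g n k) \<le> C * r ^ (nat \<bar>n\<bar> + k))"

lemma range_int_union: "range int \<union> range (\<lambda>n. - int (Suc n)) = UNIV"
proof -
  have "x \<in> range int \<union> range (\<lambda>n. - int (Suc n))" for x
    by (cases x) auto
  then show ?thesis by blast
qed

lemma has_sum_int_split:
  fixes f :: "int \<Rightarrow> 'a :: real_normed_vector"
  assumes "((\<lambda>n. f (int n)) has_sum a) UNIV" "((\<lambda>n. f (- int (Suc n))) has_sum b) UNIV"
  shows "(f has_sum (a + b)) UNIV"
proof -
  have "(f has_sum a) (range int)" using assms(1) by (subst has_sum_reindex) (auto simp: o_def inj_on_def)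
  moreover have "(f has_sum b) (range (\<lambda>n. - int (Suc n)))"
    using assms(2) by (subst has_sum_reindex) (auto simp: o_def inj_on_def)
  ultimately have "(f has_sum (a + b)) (range int \<union> range (\<lambda>n. - int (Suc n)))"
    by (rule has_sum_Un_disjoint) auto
  then show ?thesis unfolding range_int_union .
qed

lemma summable_on_geometric_int_nat:
  fixes r :: real
  assumes r: "0 \<le> r" "r < 1"
  shows "(\<lambda>(n :: int, k :: nat). r ^ (nat \<bar>n\<bar> + k)) summable_on UNIV"
proof -
  have geo: "((\<lambda>k. r ^ k) has_sum (1 / (1 - r))) (UNIV :: nat set)"
    by (rule norm_summable_imp_has_sum) (use r in \<open>auto simp: norm_power intro: geometric_sums summable_geometric\<close>)
  have "((\<lambda>n :: int. r ^ nat \<bar>n\<bar>) has_sum (1 / (1 - r) + r * (1 / (1 - r)))) UNIV"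
  proof (rule has_sum_int_split)
    show "((\<lambda>n. r ^ nat \<bar>int n\<bar>) has_sum 1 / (1 - r)) UNIV" using geo by simp
    have "(\<lambda>n. r ^ nat \<bar>- int (Suc n)\<bar>) = (\<lambda>n. r * r ^ n)"
      by (simp add: fun_eq_iff nat_add_distrib)
    then show "((\<lambda>n. r ^ nat \<bar>- int (Suc n)\<bar>) has_sum r * (1 / (1 - r))) UNIV"
      using has_sum_cmult_right[OF geo, of r] by simp
  qed
  then have "(\<lambda>n :: int. r ^ nat \<bar>n\<bar> * (1 / (1 - r))) summable_on UNIV"
    using summable_on_cmult_left has_sum_imp_summable by blast
  then have "(\<lambda>(n :: int, k :: nat). r ^ (nat \<bar>n\<bar> + k)) summable_on (SIGMA n:UNIV. UNIV)"
    by (intro summable_on_SigmaI[where g = "\<lambda>n. r ^ nat \<bar>n\<bar> * (1 / (1 - r))"])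
       (use r has_sum_cmult_right[OF geo] in \<open>auto simp: power_add\<close>)
  then show ?thesis by simp
qed

lemma rapid_geometric_bound:
  assumes "rapid g" "0 < K"
  obtains C where "0 \<le> C" "\<And>n k. norm (g n k) * K ^ (nat \<bar>n\<bar> + k) \<le> C * (1 / 2) ^ (nat \<bar>n\<bar> + k)"
proof -
  have "1 / (2 * K) > 0" using assms by simp
  then obtain C where C: "\<And>n k. norm (g n k) \<le> C * (1 / (2 * K)) ^ (nat \<bar>n\<bar> + k)"
    using assms(1) unfolding rapid_def by blast
  have "norm (g 0 0) \<le> C" using C[of 0 0] by simp
  then have "0 \<le> C" using norm_ge_zero order_trans by blast
  moreover have "norm (g n k) * K ^ (nat \<bar>n\<bar> + k) \<le> C * (1 / 2) ^ (nat \<bar>n\<bar> + k)" for n k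
  proof -
    have "norm (g n k) * K ^ (nat \<bar>n\<bar> + k) \<le> C * (1 / (2 * K)) ^ (nat \<bar>n\<bar> + k) * K ^ (nat \<bar>n\<bar> + k)"
      using C assms(2) by (intro mult_right_mono) auto
    also have "\<dots> = C * (1 / (2 * K) * K) ^ (nat \<bar>n\<bar> + k)" by (simp only: power_mult_distrib mult.assoc)
    also have "1 / (2 * K) * K = 1 / 2" using assms(2) by simp
    finally show ?thesis .
  qed
  ultimately show ?thesis using that by blast
qed

text \<open>
  The Weierstrass majorant shared by all series with rapidly decreasing coefficients and basis functions of
  geometric growth.
\<close>

lemma rapid_series:
  fixes b :: "int \<Rightarrow> nat \<Rightarrow> 'a \<Rightarrow> complex"
  assumes g: "rapid g" and K: "0 < K" and b: "\<And>n k z. z \<in> X \<Longrightarrow> norm (b n k z) \<le> D * K ^ (nat \<bar>n\<bar> + k)"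
  shows "\<exists>M :: int \<times> nat \<Rightarrow> real. M summable_on UNIV \<and> (\<forall>n k. \<forall>z\<in>X. norm (g n k * b n k z) \<le> M (n, k))"
proof -
  obtain C where C: "0 \<le> C" "\<And>n k. norm (g n k) * K ^ (nat \<bar>n\<bar> + k) \<le> C * (1 / 2) ^ (nat \<bar>n\<bar> + k)"
    using rapid_geometric_bound[OF g K] by blast
  have "(\<lambda>x. \<bar>D\<bar> * C * (\<lambda>(n, k). (1 / 2) ^ (nat \<bar>n\<bar> + k)) x) summable_on (UNIV :: (int \<times> nat) set)"
    by (intro summable_on_cmult_right summable_on_geometric_int_nat) auto
  moreover have "norm (g n k * b n k z) \<le> \<bar>D\<bar> * C * (\<lambda>(n, k). (1 / 2) ^ (nat \<bar>n\<bar> + k)) (n, k)" if "z \<in> X" for n k z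
  proof -
    have "norm (g n k * b n k z) \<le> norm (g n k) * (\<bar>D\<bar> * K ^ (nat \<bar>n\<bar> + k))"
      unfolding norm_mult using b[OF that, of n k] K
      by (intro mult_left_mono) (auto intro: order_trans mult_right_mono)
    also have "\<dots> = \<bar>D\<bar> * (norm (g n k) * K ^ (nat \<bar>n\<bar> + k))" by (simp add: mult_ac)
    also have "\<dots> \<le> \<bar>D\<bar> * (C * (1 / 2) ^ (nat \<bar>n\<bar> + k))" by (intro mult_left_mono C) auto
    finally show ?thesis by (simp add: mult_ac)
  qed
  ultimately show ?thesis by (intro exI conjI allI ballI)
qed

lemma rapid_abs_summable:
  assumes g: "rapid g" and K: "0 < K" and b: "\<And>n k. norm (b n k) \<le> D * K ^ (nat \<bar>n\<bar> + k)"
  shows "(\<lambda>(n, k). norm (g n k * b n k)) summable_on UNIV"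
proof -
  obtain M :: "int \<times> nat \<Rightarrow> real" where M: "M summable_on UNIV" "\<forall>n k. \<forall>z\<in>{()}. norm (g n k * b n k) \<le> M (n, k)"
    using rapid_series[OF g K, of "{()}" "\<lambda>n k _. b n k" D] b by blast
  have "(\<lambda>x. norm ((\<lambda>(n, k). g n k * b n k) x)) summable_on UNIV"
    by (rule Infinite_Sum.abs_summable_on_comparison_test'[OF M(1)]) (use M(2) in force)
  then show ?thesis by (simp add: case_prod_unfold)
qed

lemma rapid_uniform_limit:
  fixes b :: "int \<Rightarrow> nat \<Rightarrow> 'a \<Rightarrow> complex"
  assumes g: "rapid g" and K: "0 < K" and b: "\<And>n k z. z \<in> X \<Longrightarrow> norm (b n k z) \<le> D * K ^ (nat \<bar>n\<bar> + k)"
  shows "uniform_limit X (\<lambda>F z. \<Sum>(n, k)\<in>F. g n k * b n k z) (\<lambda>z. \<Sum>\<^sub>\<infinity>(n, k). g n k * b n k z) (finite_subsets_at_top UNIV)"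
proof -
  obtain M :: "int \<times> nat \<Rightarrow> real" where M: "M summable_on UNIV" "\<forall>n k. \<forall>z\<in>X. norm (g n k * b n k z) \<le> M (n, k)"
    using rapid_series[OF g K, of X b D] b by blast
  have "uniform_limit X (\<lambda>F z. \<Sum>x\<in>F. (\<lambda>(n, k) z. g n k * b n k z) x z) (\<lambda>z. \<Sum>\<^sub>\<infinity>x. (\<lambda>(n, k) z. g n k * b n k z) x z)
     (finite_subsets_at_top UNIV)"
    by (rule Weierstrass_m_test_general[OF _ M(1)]) (use M(2) in force)
  then show ?thesis by (simp add: case_prod_unfold)
qed

definition lmon_series :: "(int \<Rightarrow> nat \<Rightarrow> complex) \<Rightarrow> complex^3 \<Rightarrow> complex" where
  "lmon_series g z = (\<Sum>\<^sub>\<infinity>(n, k). g n k * lmon n k z)"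

lemma lmon_abs_summable:
  assumes "rapid g" shows "(\<lambda>(n, k). norm (g n k * lmon n k z)) summable_on UNIV"
proof (rule rapid_abs_summable[OF assms])
  show "norm (lmon n k z) \<le> 1 * (1 + 2 * norm z) ^ (nat \<bar>n\<bar> + k)" for n k
    using norm_lmon_le[of z "norm z" n k] by simp
qed (simp add: add_pos_nonneg)

lemma lmon_has_sum:
  assumes "rapid g" shows "((\<lambda>(n, k). g n k * lmon n k z) has_sum lmon_series g z) UNIV"
  unfolding lmon_series_def using abs_summable_summable[of "\<lambda>(n, k). g n k * lmon n k z" UNIV] lmon_abs_summable[OF assms, of z]
  by (simp add: case_prod_unfold)

lemma lmon_uniform_limit:
  assumes "rapid g"
  shows "uniform_limit (cball 0 \<rho>) (\<lambda>F z. \<Sum>(n, k)\<in>F. g n k * lmon n k z) (lmon_series g) (finite_subsets_at_top UNIV)"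
proof (cases "\<rho> \<ge> 0")
  case True
  then have "0 < 1 + 2 * \<rho>" by simp
  then show ?thesis unfolding lmon_series_def[abs_def]
  proof (rule rapid_uniform_limit[OF assms])
    fix n k and z :: "complex^3" assume "z \<in> cball 0 \<rho>"
    then show "norm (lmon n k z) \<le> 1 * (1 + 2 * \<rho>) ^ (nat \<bar>n\<bar> + k)"
      using norm_lmon_le[of z \<rho> n k] by simp
  qed
next
  case False
  then have "cball (0 :: complex^3) \<rho> = {}" by simp
  then show ?thesis by (simp add: uniform_limit_iff)
qed

lemma continuous_on_lmon [continuous_intros]: "continuous_on S (lmon n k)"
  unfolding lmon_def[abs_def] by (intro continuous_intros)

lemma continuous_on_lmon_series:
  assumes "rapid g" shows "continuous_on S (lmon_series g)"
proof -
  have "continuous_on (cball 0 \<rho>) (lmon_series g)" for \<rho>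
  proof (rule uniform_limit_theorem[OF _ lmon_uniform_limit[OF assms]])
    show "\<forall>\<^sub>F F in finite_subsets_at_top UNIV. continuous_on (cball 0 \<rho>) (\<lambda>z. \<Sum>(n, k)\<in>F. g n k * lmon n k z)"
      unfolding case_prod_unfold by (intro always_eventually allI continuous_intros)
  qed simp
  then have "continuous_on (ball 0 \<rho>) (lmon_series g)" for \<rho>
    by (rule continuous_on_subset[of "cball 0 \<rho>"]) auto
  then have "isCont (lmon_series g) z" for z
    using continuous_on_interior[of "ball 0 (norm z + 1)" "lmon_series g" z] by simp
  then show ?thesis by (simp add: continuous_at_imp_continuous_on)
qed

section \<open>Expansion of holomorphic functions in monomials\<close>

text \<open>
  The points with \<open>cA z \<noteq> 0\<close> are parametrized by \<open>s = cA z\<close> and \<open>c = z\<^sub>3\<close>. Continuity on the whole sphere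
  and holomorphy in each of these two parameters suffice for the expansion, and they are stable under locally uniform
  limits by one-variable arguments. In the end they characterize the holomorphic functions
  (\<open>hol_csphere_iff\<close>).
\<close>

definition sep_holomorphic :: "(complex^3 \<Rightarrow> complex) \<Rightarrow> bool" where
  "sep_holomorphic f \<longleftrightarrow> continuous_on csphere f
     \<and> (\<forall>c. (\<lambda>s. f (pt s ((1 - c\<^sup>2) / s) c)) holomorphic_on - {0})
     \<and> (\<forall>s. s \<noteq> 0 \<longrightarrow> (\<lambda>c. f (pt s ((1 - c\<^sup>2) / s) c)) holomorphic_on UNIV)"

lemma continuous_csphere_bounded:
  assumes "continuous_on csphere f"
  obtains M where "0 \<le> M" "\<And>a b c. a * b = 1 - c\<^sup>2 \<Longrightarrow> norm a \<le> K \<Longrightarrow> norm b \<le> K \<Longrightarrow> norm c \<le> K \<Longrightarrow> norm (f (pt a b c)) \<le> (M :: real)"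
proof -
  have "compact (csphere \<inter> cball 0 (3 * K))"
    by (intro closed_Int_compact closed_csphere) auto
  then have "bounded (f ` (csphere \<inter> cball 0 (3 * K)))"
    by (intro compact_imp_bounded compact_continuous_image continuous_on_subset[OF assms]) auto
  then obtain M where M: "\<And>z. z \<in> csphere \<inter> cball 0 (3 * K) \<Longrightarrow> norm (f z) \<le> M"
    unfolding bounded_iff by (metis imageI)
  show ?thesis
  proof (rule that[of "max M 0"])
    fix a b c :: complex assume *: "a * b = 1 - c\<^sup>2" "norm a \<le> K" "norm b \<le> K" "norm c \<le> K"
    then have "norm (pt a b c) \<le> 3 * K" using norm_pt_le[of a b c] by linarith
    then show "norm (f (pt a b c)) \<le> max M 0" using M[of "pt a b c"] * by (simp add: max.coboundedI1)
  qed simp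
qed

text \<open>
  Since \<open>a b = 1 - c\<^sup>2\<close>, it suffices to make \<open>c\<^sup>2 \<noteq> 1\<close>. Where \<open>a\<close> or \<open>b\<close> is nonzero one moves \<open>c\<close>, keeps that
  coordinate and solves for the other. The two remaining points \<open>(0, 0, \<plusminus>1)\<close> are approached along a great
  circle of the real sphere.
\<close>

lemma csphere_generic_sequence:
  assumes z: "z \<in> csphere"
  obtains x :: "nat \<Rightarrow> complex^3" where "\<And>j. x j \<in> csphere" "\<And>j. cA (x j) \<noteq> 0 \<and> x j $ 3 \<noteq> 1 \<and> x j $ 3 \<noteq> -1" "x \<longlonglongrightarrow> z"
proof -
  define a b c where "a = cA z" and "b = cB z" and "c = z $ 3"
  have ab: "a * b = 1 - c\<^sup>2" using z by (simp add: csphere_iff a_def b_def c_def)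
  have zpt: "z = pt a b c" by (simp add: a_def b_def c_def)
  define t :: "nat \<Rightarrow> real" where "t = (\<lambda>j. 1 / real (Suc j))"
  have t: "0 < t j" "t j \<le> 1" for j by (simp_all add: t_def)
  have t_lim: "t \<longlonglongrightarrow> 0" unfolding t_def by (rule LIMSEQ_Suc[OF lim_1_over_n])
  have lim: "(\<lambda>j. pt (p (t j)) (q (t j)) (r (t j))) \<longlonglongrightarrow> z"
    if "continuous_on UNIV p" "continuous_on UNIV q" "continuous_on UNIV r" "p 0 = a" "q 0 = b" "r 0 = c"
    for p q r :: "real \<Rightarrow> complex"
  proof -
    have "isCont (\<lambda>t. pt (p t) (q t) (r t)) 0"
      using continuous_on_pt[OF that(1-3)] by (simp add: continuous_on_eq_continuous_at)
    from isCont_tendsto_compose[OF this t_lim] show ?thesis using that by (simp add: zpt)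
  qed
  have gen: "cA x \<noteq> 0 \<and> x $ 3 \<noteq> 1 \<and> x $ 3 \<noteq> -1" if "x \<in> csphere" "(x $ 3)\<^sup>2 \<noteq> 1" for x :: "complex^3"
    using that by (auto simp: csphere_iff)
  have cs: "(c + of_real s * c)\<^sup>2 \<noteq> 1" if "c\<^sup>2 = 1" "0 < s" for s :: real
  proof
    assume "(c + of_real s * c)\<^sup>2 = 1"
    then have "c\<^sup>2 * (1 + of_real s)\<^sup>2 = 1" by (simp add: power2_eq_square algebra_simps)
    then have "(complex_of_real ((1 + s)\<^sup>2)) = of_real 1" using that by simp
    then have "(1 + s)\<^sup>2 = 1" by (simp only: of_real_eq_iff)
    then show False using that by (simp add: power2_eq_1_iff)
  qed
  consider "c\<^sup>2 \<noteq> 1" | "c\<^sup>2 = 1" "a \<noteq> 0" | "c\<^sup>2 = 1" "b \<noteq> 0" | "c\<^sup>2 = 1" "a = 0" "b = 0" by blast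
  then show ?thesis
  proof cases
    case 1
    then show ?thesis using that[of "\<lambda>_. z"] z gen[OF z] by (simp add: c_def)
  next
    case 2
    let ?x = "\<lambda>j. pt a ((1 - (c + of_real (t j) * c)\<^sup>2) / a) (c + of_real (t j) * c)"
    have mem: "?x j \<in> csphere" for j using 2 by simp
    show ?thesis
    proof (rule that[of ?x, OF mem])
      show "cA (?x j) \<noteq> 0 \<and> ?x j $ 3 \<noteq> 1 \<and> ?x j $ 3 \<noteq> - 1" for j
        by (rule gen[OF mem]) (use cs[OF 2(1) t(1)] in simp)
      show "?x \<longlonglongrightarrow> z"
        by (rule lim[of "\<lambda>_. a" "\<lambda>s. (1 - (c + of_real s * c)\<^sup>2) / a" "\<lambda>s. c + of_real s * c"])
           (use 2 ab in \<open>auto intro!: continuous_intros\<close>)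
    qed
  next
    case 3
    let ?x = "\<lambda>j. pt ((1 - (c + of_real (t j) * c)\<^sup>2) / b) b (c + of_real (t j) * c)"
    have mem: "?x j \<in> csphere" for j using 3 by simp
    show ?thesis
    proof (rule that[of ?x, OF mem])
      show "cA (?x j) \<noteq> 0 \<and> ?x j $ 3 \<noteq> 1 \<and> ?x j $ 3 \<noteq> - 1" for j
        by (rule gen[OF mem]) (use cs[OF 3(1) t(1)] in simp)
      show "?x \<longlonglongrightarrow> z"
        by (rule lim[of "\<lambda>s. (1 - (c + of_real s * c)\<^sup>2) / b" "\<lambda>_. b" "\<lambda>s. c + of_real s * c"])
           (use 3 ab in \<open>auto intro!: continuous_intros\<close>)
    qed
  next
    case 4
    let ?x = "\<lambda>j. pt (of_real (sin (t j))) (of_real (sin (t j))) (c * of_real (cos (t j)))"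
    have sq: "(c * of_real (cos s))\<^sup>2 = 1 - of_real (sin s) * of_real (sin s)" for s
    proof -
      have "(c * of_real (cos s))\<^sup>2 = of_real ((cos s)\<^sup>2)" using 4 by (simp add: power_mult_distrib)
      also have "(cos s)\<^sup>2 = 1 - sin s * sin s" using cos_squared_eq[of s] by (simp add: power2_eq_square)
      also have "complex_of_real \<dots> = 1 - of_real (sin s) * of_real (sin s)" by simp
      finally show ?thesis .
    qed
    have mem: "?x j \<in> csphere" for j by (simp only: pt_in_csphere sq) simp
    show ?thesis
    proof (rule that[of ?x, OF mem])
      show "cA (?x j) \<noteq> 0 \<and> ?x j $ 3 \<noteq> 1 \<and> ?x j $ 3 \<noteq> - 1" for j
      proof (rule gen[OF mem])
        have "sin (t j) > 0" using t[of j] pi_gt3 by (intro sin_gt_zero) linarith+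
        then show "(?x j $ 3)\<^sup>2 \<noteq> 1" by (simp only: pt_nth sq) simp
      qed
      show "?x \<longlonglongrightarrow> z"
        by (rule lim[of "\<lambda>s. of_real (sin s)" "\<lambda>s. of_real (sin s)" "\<lambda>s. c * of_real (cos s)"])
           (use 4 in \<open>auto intro!: continuous_intros\<close>)
    qed
  qed
qed

lemma continuous_eq_on_csphere:
  fixes f g :: "complex^3 \<Rightarrow> complex"
  assumes f: "continuous_on csphere f" and g: "continuous_on csphere g"
    and eq: "\<And>z. z \<in> csphere \<Longrightarrow> cA z \<noteq> 0 \<Longrightarrow> z $ 3 \<noteq> 1 \<Longrightarrow> z $ 3 \<noteq> -1 \<Longrightarrow> f z = g z"
    and z: "z \<in> csphere"
  shows "f z = g z"
proof -
  obtain x :: "nat \<Rightarrow> complex^3" where x: "\<And>j. x j \<in> csphere" "\<And>j. cA (x j) \<noteq> 0 \<and> x j $ 3 \<noteq> 1 \<and> x j $ 3 \<noteq> -1" "x \<longlonglongrightarrow> z"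
    using csphere_generic_sequence[OF z] by blast
  have "(\<lambda>j. f (x j)) \<longlonglongrightarrow> f z" "(\<lambda>j. g (x j)) \<longlonglongrightarrow> g z"
    using continuous_on_tendsto_compose[OF f x(3) z] continuous_on_tendsto_compose[OF g x(3) z] x(1) by auto
  moreover have "f (x j) = g (x j)" for j using eq x by blast
  ultimately show ?thesis using LIMSEQ_unique by auto
qed

lemma norm_one_minus_square_le:
  fixes c :: complex assumes "norm (c + 1) \<le> R" "1 \<le> R"
  shows "norm (1 - c\<^sup>2) \<le> R * (R + 2)" "norm c \<le> R * (R + 2)"
proof -
  have 1: "norm (1 - c) \<le> R + 2"
    using norm_triangle_ineq4[of 2 "c + 1"] assms by (simp add: algebra_simps)
  have "1 - c\<^sup>2 = (c + 1) * (1 - c)" by (simp add: power2_eq_square algebra_simps)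
  then have "norm (1 - c\<^sup>2) = norm (c + 1) * norm (1 - c)" by (simp add: norm_mult)
  also have "\<dots> \<le> R * (R + 2)" using assms 1 by (intro mult_mono) auto
  finally show "norm (1 - c\<^sup>2) \<le> R * (R + 2)" .
  have "norm c \<le> R + 1" using norm_triangle_ineq4[of "c + 1" 1] assms by simp
  also have "R + 1 \<le> 1 * (R + 2)" by simp
  also have "\<dots> \<le> R * (R + 2)" using assms by (intro mult_right_mono) auto
  finally show "norm c \<le> R * (R + 2)" .
qed

text \<open>
  Expand in a Laurent series in \<open>a\<close> and then in a Taylor series in \<open>c\<close> about \<open>-1\<close>. In the half with negative
  powers, \<open>a\<^sup>-\<^sup>n = b\<^sup>n / (1 - c\<^sup>2)\<^sup>n\<close>, so the coefficient has to be divided by \<open>(1 - c\<^sup>2)\<^sup>n\<close>. The quotient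
  is bounded near \<open>c = \<plusminus>1\<close>, hence entire, because its Laurent integral may be taken over the circle on
  which \<open>|b| = R\<close> instead of \<open>|a| = R\<close>.
\<close>

theorem sep_holomorphic_expansion:
  assumes f: "sep_holomorphic f"
  obtains g where "rapid g" "\<And>z. z \<in> csphere \<Longrightarrow> f z = lmon_series g z"
proof -
  define h where "h = (\<lambda>s c. f (pt s ((1 - c\<^sup>2) / s) c))"
  have fcont: "continuous_on csphere f" and hs: "\<And>c. (\<lambda>s. h s c) holomorphic_on - {0}"
    and hc: "\<And>s. s \<noteq> 0 \<Longrightarrow> h s holomorphic_on UNIV"
    using f unfolding sep_holomorphic_def h_def by auto
  have hcont: "continuous_on ((- {0}) \<times> UNIV) (\<lambda>(s, c). h s c)"
    unfolding h_def case_prod_unfold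
    by (rule continuous_on_compose2[OF fcont]) (auto intro!: continuous_intros split: if_split_asm)
  define \<alpha> where "\<alpha> = (\<lambda>n c. laurent_coeff (\<lambda>s. h s c) n)"
  have \<alpha>_hol: "\<alpha> n holomorphic_on UNIV" for n
    unfolding \<alpha>_def by (rule laurent_coeff_entire[OF hcont hc])
  have bounds: "\<exists>M\<ge>0. (\<forall>n c. norm (c + 1) \<le> R \<longrightarrow> norm (\<alpha> (int n) c) \<le> M / R ^ n)
      \<and> (\<forall>n c. norm (c + 1) \<le> R \<longrightarrow> c \<noteq> 1 \<longrightarrow> c \<noteq> -1 \<longrightarrow> norm (\<alpha> (- int n) c / (1 - c\<^sup>2) ^ n) \<le> M / R ^ n)"
    if R: "1 \<le> R" for R :: real
  proof -
    \<comment> \<open>A common bound of the three coordinates on the circles used below.\<close>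
    define K where "K = R * (R + 2)"
    have "1 * (R + 2) \<le> K" unfolding K_def using R by (intro mult_right_mono) auto
    then have K: "R \<le> K" by simp
    have div: "x / R \<le> K" if "x \<le> K" "0 \<le> x" for x
    proof -
      have "x / R \<le> x / 1" using that R by (intro divide_left_mono) auto
      then show ?thesis using that by simp
    qed
    obtain M where M: "0 \<le> M" "\<And>a b c. a * b = 1 - c\<^sup>2 \<Longrightarrow> norm a \<le> K \<Longrightarrow> norm b \<le> K \<Longrightarrow> norm c \<le> K \<Longrightarrow> norm (f (pt a b c)) \<le> M"
      using continuous_csphere_bounded[OF fcont, of K] by blast
    have "norm (\<alpha> (int n) c) \<le> M / R ^ n" if c: "norm (c + 1) \<le> R" for n c
    proof -
      have "norm (\<alpha> (int n) c) \<le> M * R powi (- int n)"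
        unfolding \<alpha>_def
      proof (rule norm_laurent_coeff_le[OF hs])
        fix s :: complex assume s: "norm s = R"
        show "norm (h s c) \<le> M" unfolding h_def
        proof (rule M(2))
          show "s * ((1 - c\<^sup>2) / s) = 1 - c\<^sup>2" using s R by auto
          show "norm ((1 - c\<^sup>2) / s) \<le> K"
            unfolding norm_divide s by (rule div) (use norm_one_minus_square_le[OF c R] K_def in auto)
        qed (use s K norm_one_minus_square_le[OF c R] in \<open>auto simp: K_def\<close>)
      qed (use R in auto)
      then show ?thesis by (simp add: power_int_minus divide_inverse)
    qed
    moreover have "norm (\<alpha> (- int n) c / (1 - c\<^sup>2) ^ n) \<le> M / R ^ n"
      if c: "norm (c + 1) \<le> R" "c \<noteq> 1" "c \<noteq> -1" for n c
    proof -
      have nz: "1 - c\<^sup>2 \<noteq> 0" using c by (auto simp: power2_eq_1_iff)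
      \<comment> \<open>On the circle of radius r about 0 the coordinate b has modulus R.\<close>
      define r where "r = norm (1 - c\<^sup>2) / R"
      have r: "0 < r" unfolding r_def using nz R by simp
      have "norm (\<alpha> (- int n) c) \<le> M * r powi (- (- int n))"
        unfolding \<alpha>_def
      proof (rule norm_laurent_coeff_le[OF hs r])
        fix s :: complex assume s: "norm s = r"
        show "norm (h s c) \<le> M" unfolding h_def
        proof (rule M(2))
          show "s * ((1 - c\<^sup>2) / s) = 1 - c\<^sup>2" using s r by auto
          show "norm s \<le> K" unfolding s r_def
            by (rule div) (use norm_one_minus_square_le[OF c(1) R] K_def in auto)
          show "norm ((1 - c\<^sup>2) / s) \<le> K"
            unfolding norm_divide s r_def using nz R K by simp
        qed (use norm_one_minus_square_le[OF c(1) R] in \<open>auto simp: K_def\<close>)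
      qed
      then have "norm (\<alpha> (- int n) c) \<le> M / R ^ n * norm (1 - c\<^sup>2) ^ n"
        by (simp add: r_def power_divide)
      then show ?thesis using nz by (simp add: norm_divide norm_power divide_le_eq)
    qed
    ultimately show ?thesis using M(1) by blast
  qed
  have "\<forall>n. \<exists>\<beta>. \<beta> holomorphic_on UNIV \<and> (\<forall>c\<in>UNIV - {1, -1}. \<beta> c = \<alpha> (- int n) c / (1 - c\<^sup>2) ^ n)"
  proof (rule allI)
    fix n show "\<exists>\<beta>. \<beta> holomorphic_on UNIV \<and> (\<forall>c\<in>UNIV - {1, -1}. \<beta> c = \<alpha> (- int n) c / (1 - c\<^sup>2) ^ n)"
  proof (rule removable_singularities)
    show "(\<lambda>c. \<alpha> (- int n) c / (1 - c\<^sup>2) ^ n) holomorphic_on UNIV - {1, - 1}"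
      by (intro holomorphic_intros holomorphic_on_subset[OF \<alpha>_hol]) (auto simp: power2_eq_1_iff)
    fix z :: complex assume z: "z \<in> {1, -1}"
    obtain M where M: "\<forall>n c. norm (c + 1) \<le> 3 \<longrightarrow> c \<noteq> 1 \<longrightarrow> c \<noteq> -1 \<longrightarrow> norm (\<alpha> (- int n) c / (1 - c\<^sup>2) ^ n) \<le> M / 3 ^ n"
      using bounds[of 3] by auto
    have "\<forall>\<^sub>F c in at z. norm (c + 1) < 3"
    proof -
      have "((\<lambda>c. norm (c + 1)) \<longlongrightarrow> norm (z + 1)) (at z)" by (intro tendsto_intros)
      moreover have "norm (z + 1) < 3" using z by auto
      ultimately show ?thesis by (rule order_tendstoD)
    qed
    moreover have "\<forall>\<^sub>F c in at z. c \<notin> {1, -1}"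
    proof -
      have "\<forall>\<^sub>F c in at z. c \<noteq> - z" using z by (intro eventually_neq_at_within)
      moreover have "\<forall>\<^sub>F c in at z. c \<noteq> z" by (rule eventually_neq_at_within)
      ultimately show ?thesis by eventually_elim (use z in auto)
    qed
    ultimately have "\<forall>\<^sub>F c in at z. norm (\<alpha> (- int n) c / (1 - c\<^sup>2) ^ n) \<le> (M / 3 ^ n) * norm (1 :: complex)"
      by eventually_elim (use M in auto)
    then show "(\<lambda>c. \<alpha> (- int n) c / (1 - c\<^sup>2) ^ n) \<in> O[at z](\<lambda>_. 1)" by (rule bigoI)
  qed auto
  qed
  from choice[OF this] obtain \<beta> where \<beta>_hol: "\<And>n. \<beta> n holomorphic_on UNIV"
    and \<beta>: "\<And>n c. c \<noteq> 1 \<Longrightarrow> c \<noteq> -1 \<Longrightarrow> \<beta> n c = \<alpha> (- int n) c / (1 - c\<^sup>2) ^ n"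
    by auto
  define \<tau> where "\<tau> = (\<lambda>u k. (deriv ^^ k) u (-1) / fact k :: complex)"
  \<comment> \<open>Positive indices belong to powers of b, that is to negative Laurent indices.\<close>
  define g where "g = (\<lambda>n k. if n > 0 then \<tau> (\<beta> (nat n)) k else (-1) ^ nat (- n) * \<tau> (\<alpha> (- n)) k)"
  have "rapid g"
    unfolding rapid_def
  proof (intro allI impI)
    fix r :: real assume r: "0 < r"
    \<comment> \<open>The circle of radius R about -1 then avoids the excluded points 1 and -1.\<close>
    define R where "R = max 3 (1 / r)"
    have R: "3 \<le> R" "1 / R \<le> r" using r by (auto simp: R_def field_simps max_def)
    obtain M where M: "0 \<le> M" "\<And>n c. norm (c + 1) \<le> R \<Longrightarrow> norm (\<alpha> (int n) c) \<le> M / R ^ n"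
      "\<And>n c. norm (c + 1) \<le> R \<Longrightarrow> c \<noteq> 1 \<Longrightarrow> c \<noteq> -1 \<Longrightarrow> norm (\<alpha> (- int n) c / (1 - c\<^sup>2) ^ n) \<le> M / R ^ n"
      using bounds[of R] R by auto
    have "norm (g n k) \<le> M * r ^ (nat \<bar>n\<bar> + k)" for n k
    proof -
      have "norm (g n k) \<le> M / R ^ nat \<bar>n\<bar> / R ^ k"
      proof (cases "n > 0")
        case True
        have "norm (\<tau> (\<beta> (nat n)) k) \<le> M / R ^ nat n / R ^ k"
          unfolding \<tau>_def
        proof (rule entire_taylor_coeff_le[OF \<beta>_hol])
          fix c :: complex assume "norm (c - - 1) = R"
          then have c: "norm (c + 1) = R" by simp
          then have "c \<noteq> 1" "c \<noteq> -1" using R by auto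
          then show "norm (\<beta> (nat n) c) \<le> M / R ^ nat n" using M(3)[of c "nat n"] c by (simp add: \<beta>)
        qed (use R in auto)
        then show ?thesis using True by (simp add: g_def)
      next
        case False
        then have n: "- n = int (nat \<bar>n\<bar>)" by simp
        have "norm (\<tau> (\<alpha> (- n)) k) \<le> M / R ^ nat \<bar>n\<bar> / R ^ k"
          unfolding \<tau>_def
        proof (rule entire_taylor_coeff_le[OF \<alpha>_hol])
          fix c :: complex assume "norm (c - - 1) = R"
          then have c: "norm (c + 1) \<le> R" by simp
          show "norm (\<alpha> (- n) c) \<le> M / R ^ nat \<bar>n\<bar>" using M(2)[OF c, of "nat \<bar>n\<bar>"] by (simp only: n[symmetric])
        qed (use R in auto)
        then show ?thesis using False by (simp add: g_def norm_mult norm_power)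
      qed
      also have "\<dots> = M * (1 / R) ^ (nat \<bar>n\<bar> + k)" by (simp add: power_add power_divide)
      also have "\<dots> \<le> M * r ^ (nat \<bar>n\<bar> + k)" using M(1) R by (intro mult_left_mono power_mono) auto
      finally show ?thesis .
    qed
    then show "\<exists>C. \<forall>n k. norm (g n k) \<le> C * r ^ (nat \<bar>n\<bar> + k)" by blast
  qed
  moreover have "f z = lmon_series g z" if "z \<in> csphere" for z
  proof (rule continuous_eq_on_csphere[OF fcont _ _ that])
    show "continuous_on csphere (lmon_series g)" by (rule continuous_on_lmon_series) fact
    fix z :: "complex^3"
    assume z: "z \<in> csphere" "cA z \<noteq> 0" "z $ 3 \<noteq> 1" "z $ 3 \<noteq> -1"
    define a b c where "a = cA z" and "b = cB z" and "c = z $ 3"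
    have ab: "b = (1 - c\<^sup>2) / a" "a \<noteq> 0" "1 - c\<^sup>2 \<noteq> 0" "c \<noteq> 1" "c \<noteq> -1"
      using z by (auto simp: csphere_iff a_def b_def c_def field_simps power2_eq_1_iff)
    have fz: "f z = h a c"
      unfolding h_def ab(1)[symmetric] by (simp add: a_def b_def c_def)
    obtain S1 S2 where S: "(\<lambda>n. \<alpha> (int n) c * a ^ n) sums S1" "(\<lambda>n. \<alpha> (- int (Suc n)) c / a ^ Suc n) sums S2" "h a c = S1 + S2"
      using laurent_expansion_punctured_plane[OF hs ab(2), of c] unfolding \<alpha>_def by blast
    \<comment> \<open>The inner sums over k; summed over n with the sign reversed they are the Laurent series of f.\<close>
    define T where "T = (\<lambda>n. if n > 0 then \<beta> (nat n) c * b ^ nat n else \<alpha> (- n) c * a ^ nat (- n))"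
    note summ = lmon_has_sum[OF \<open>rapid g\<close>, of z]
    have "(\<lambda>k. g n k * lmon n k z) sums T n" for n
    proof (cases "n > 0")
      case True
      from sums_mult[OF entire_taylor[OF \<beta>_hol[of "nat n"], of "-1" c], of "b ^ nat n"]
      show ?thesis using True by (simp add: g_def \<tau>_def lmon_def circ_def T_def b_def c_def mult_ac add.commute)
    next
      case False
      from sums_mult[OF entire_taylor[OF \<alpha>_hol[of "- n"], of "-1" c], of "a ^ nat (- n)"]
      have *: "(\<lambda>k. a ^ nat (- n) * (\<tau> (\<alpha> (- n)) k * (1 + c) ^ k)) sums T n"
        using False by (simp add: \<tau>_def T_def mult_ac add.commute)
      have "(-1) ^ nat (- n) * ((-1) ^ nat (- n) * x) = (x :: complex)" for x
        by (simp add: power_mult_distrib[symmetric] mult.assoc[symmetric])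
      moreover have "lmon n k z = (-1) ^ nat (- n) * a ^ nat (- n) * (1 + c) ^ k" for k
        using False by (cases "n = 0") (auto simp: lmon_def circ_def a_def c_def power_minus[of "cA z"])
      ultimately have "g n k * lmon n k z = a ^ nat (- n) * (\<tau> (\<alpha> (- n)) k * (1 + c) ^ k)" for k
        using False by (simp add: g_def mult_ac)
      then show ?thesis using * by simp
    qed
    moreover have "(\<lambda>k. g n k * lmon n k z) summable_on UNIV" for n
      using summable_on_SigmaD1[where f = "\<lambda>n k. g n k * lmon n k z" and A = UNIV and B = "\<lambda>_. UNIV" and x = n]
        has_sum_imp_summable[OF summ] by simp
    ultimately have inner: "((\<lambda>k. g n k * lmon n k z) has_sum T n) UNIV" for n
      by (metis has_sum_imp_sums has_sum_infsum sums_unique2)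
    have T: "(T has_sum lmon_series g z) UNIV"
      by (rule has_sum_SigmaD[where f = "\<lambda>(n, k). g n k * lmon n k z" and B = "\<lambda>_. UNIV"]) (use summ inner in auto)
    then have T': "((\<lambda>n. T (- n)) has_sum lmon_series g z) UNIV"
      by (subst has_sum_reindex_bij_witness[of UNIV uminus uminus UNIV T]) auto
    have sub: "(\<lambda>n. T (- i n)) summable_on UNIV" if "inj i" for i :: "nat \<Rightarrow> int"
      using summable_on_subset[OF has_sum_imp_summable[OF T'], of "range i"] that
      by (simp add: summable_on_reindex o_def)
    have "(\<lambda>n. T (- int n)) sums S1" using S(1) by (simp add: T_def)
    then have P1: "((\<lambda>n. T (- int n)) has_sum S1) UNIV"
      using sub[of int] by (metis has_sum_imp_sums has_sum_infsum sums_unique2 inj_of_nat)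
    have "T (int (Suc n)) = \<alpha> (- int (Suc n)) c / a ^ Suc n" for n
    proof -
      have "nat (int (Suc n)) = Suc n" by simp
      then have "T (int (Suc n)) = \<beta> (Suc n) c * b ^ Suc n" unfolding T_def by simp
      also have "\<dots> = \<alpha> (- int (Suc n)) c / (1 - c\<^sup>2) ^ Suc n * ((1 - c\<^sup>2) ^ Suc n / a ^ Suc n)"
        unfolding \<beta>[OF ab(4,5)] ab(1) power_divide ..
      also have "\<dots> = \<alpha> (- int (Suc n)) c / a ^ Suc n" using ab(3) by (simp del: power_Suc of_nat_Suc)
      finally show ?thesis .
    qed
    then have "(\<lambda>n. T (- (- int (Suc n)))) sums S2" using S(2) by (simp only: minus_minus)
    then have P2: "((\<lambda>n. T (- (- int (Suc n)))) has_sum S2) UNIV"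
      using sub[of "\<lambda>n. - int (Suc n)"] by (metis (no_types, lifting) has_sum_imp_sums has_sum_infsum sums_unique2 injI nat_int neg_equal_iff_equal of_nat_eq_iff old.nat.inject)
    have "((\<lambda>n. T (- n)) has_sum (S1 + S2)) UNIV"
      by (rule has_sum_int_split[OF P1 P2])
    then have "lmon_series g z = S1 + S2" using T' has_sum_unique by blast
    then show "f z = lmon_series g z" using S(3) fz by simp
  qed
  ultimately show ?thesis using that by blast
qed

section \<open>Expansion in the modes\<close>

text \<open>
  On the sphere this is the Poisson mode with indices \<open>n\<close> and \<open>m = |n| + N\<close>. The pairs \<open>(n, N)\<close> run freely,
  which suits unordered summation better than the condition \<open>|n| \<le> m\<close>.
\<close>

definition md :: "int \<Rightarrow> nat \<Rightarrow> complex^3 \<Rightarrow> complex" where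
  "md n N z = circ n z * jac (nat \<bar>n\<bar>) N (z $ 3)"

lemma norm_md_le:
  assumes "norm z \<le> \<rho>"
  shows "norm (md n N z) \<le> (4 * (1 + \<rho>)\<^sup>2) ^ (nat \<bar>n\<bar> + N)"
proof -
  have \<rho>: "0 \<le> \<rho>" using assms norm_ge_zero order_trans by blast
  have "norm (z $ 3) \<le> \<rho>" using Finite_Cartesian_Product.norm_nth_le[of z 3] assms by linarith
  then have "(2 * (1 + norm (z $ 3))) ^ (nat \<bar>n\<bar> + N) \<le> (2 * (1 + \<rho>)) ^ (nat \<bar>n\<bar> + N)"
    by (intro power_mono) auto
  then have 1: "norm (jac (nat \<bar>n\<bar>) N (z $ 3)) \<le> (2 * (1 + \<rho>)) ^ (nat \<bar>n\<bar> + N)"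
    using norm_jac_le[of "nat \<bar>n\<bar>" N "z $ 3"] by linarith
  have "(2 * \<rho>) ^ nat \<bar>n\<bar> \<le> (2 * (1 + \<rho>)) ^ nat \<bar>n\<bar>" using \<rho> by (intro power_mono) auto
  also have "\<dots> \<le> (2 * (1 + \<rho>)) ^ (nat \<bar>n\<bar> + N)" using \<rho> by (intro power_increasing) auto
  finally have 2: "norm (circ n z) \<le> (2 * (1 + \<rho>)) ^ (nat \<bar>n\<bar> + N)"
    using norm_circ_le[OF assms, of n] by linarith
  have "norm (md n N z) \<le> (2 * (1 + \<rho>)) ^ (nat \<bar>n\<bar> + N) * (2 * (1 + \<rho>)) ^ (nat \<bar>n\<bar> + N)"
    unfolding md_def norm_mult using 1 2 \<rho> by (intro mult_mono) auto
  also have "\<dots> = ((2 * (1 + \<rho>)) * (2 * (1 + \<rho>))) ^ (nat \<bar>n\<bar> + N)" by (simp only: power_mult_distrib)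
  also have "(2 * (1 + \<rho>)) * (2 * (1 + \<rho>)) = 4 * (1 + \<rho>)\<^sup>2" by (simp add: power2_eq_square algebra_simps)
  finally show ?thesis .
qed

lemma mode_radius_ge_1: "0 \<le> \<rho> \<Longrightarrow> 1 \<le> 4 * (1 + \<rho>)\<^sup>2" for \<rho> :: real
  using one_le_power[of "1 + \<rho>" 2] by linarith

lemma continuous_on_jac [continuous_intros]: "continuous_on S f \<Longrightarrow> continuous_on S (\<lambda>x. jac n N (f x))"
  unfolding jac_def by (intro continuous_intros) auto

lemma continuous_on_md [continuous_intros]: "continuous_on S (md n N)"
  unfolding md_def[abs_def] by (intro continuous_intros)

definition mode_series :: "(int \<Rightarrow> nat \<Rightarrow> complex) \<Rightarrow> complex^3 \<Rightarrow> complex" where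
  "mode_series g z = (\<Sum>\<^sub>\<infinity>(n, k). g n k * md n k z)"

lemma mode_abs_summable:
  assumes "rapid g" shows "(\<lambda>(n, k). norm (g n k * md n k z)) summable_on UNIV"
proof (rule rapid_abs_summable[OF assms])
  show "norm (md n k z) \<le> 1 * (4 * (1 + norm z)\<^sup>2) ^ (nat \<bar>n\<bar> + k)" for n k
    using norm_md_le[of z "norm z" n k] by simp
qed (rule less_le_trans[OF zero_less_one mode_radius_ge_1], simp)

lemma mode_has_sum:
  assumes "rapid g" shows "((\<lambda>(n, k). g n k * md n k z) has_sum mode_series g z) UNIV"
  unfolding mode_series_def using abs_summable_summable[of "\<lambda>(n, k). g n k * md n k z" UNIV] mode_abs_summable[OF assms, of z]
  by (simp add: case_prod_unfold)

lemma mode_uniform_limit: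
  assumes "rapid g"
  shows "uniform_limit (cball 0 \<rho>) (\<lambda>F z. \<Sum>(n, k)\<in>F. g n k * md n k z) (mode_series g) (finite_subsets_at_top UNIV)"
proof (cases "\<rho> \<ge> 0")
  case True
  then have "0 < 4 * (1 + \<rho>)\<^sup>2" using mode_radius_ge_1[of \<rho>] by simp
  then show ?thesis unfolding mode_series_def[abs_def]
  proof (rule rapid_uniform_limit[OF assms])
    fix n k and z :: "complex^3" assume "z \<in> cball 0 \<rho>"
    then show "norm (md n k z) \<le> 1 * (4 * (1 + \<rho>)\<^sup>2) ^ (nat \<bar>n\<bar> + k)"
      using norm_md_le[of z \<rho> n k] by simp
  qed
next
  case False
  then have "cball (0 :: complex^3) \<rho> = {}" by simp
  then show ?thesis by (simp add: uniform_limit_iff)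
qed

lemma lmon_eq_sum_md: "lmon n k z = (\<Sum>N\<le>k. jac_coeff (nat \<bar>n\<bar>) N k * md n N z)"
  unfolding lmon_def md_def power_jac_expansion[where n = "nat \<bar>n\<bar>"] by (simp add: sum_distrib_left mult_ac)

lemma lmon_to_mode_coeff_bound:
  assumes g: "rapid g" and r: "0 < r" "r \<le> 1"
  shows "\<exists>C\<ge>0. \<forall>n N k. norm (if N \<le> k then g n k * jac_coeff (nat \<bar>n\<bar>) N k else 0)
      \<le> C * r ^ (nat \<bar>n\<bar> + N) * (1 / 2) ^ k"
proof -
  \<comment> \<open>Of the base 8 / r, a factor 4 pays for jac_coeff, a factor 2 for the sum over k, and 1 / r remains.\<close>
  have K: "0 < 8 / r" using r by simp
  obtain C where C: "0 \<le> C" "\<And>n k. norm (g n k) * (8 / r) ^ (nat \<bar>n\<bar> + k) \<le> C * (1 / 2) ^ (nat \<bar>n\<bar> + k)"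
    using rapid_geometric_bound[OF g K] by blast
  show ?thesis
  proof (intro exI[of _ C] conjI allI C(1))
    fix n :: int and N k :: nat
    define p where "p = nat \<bar>n\<bar> + k"
    show "norm (if N \<le> k then g n k * jac_coeff (nat \<bar>n\<bar>) N k else 0) \<le> C * r ^ (nat \<bar>n\<bar> + N) * (1 / 2) ^ k"
    proof (cases "N \<le> k")
      case True
      have "norm (g n k * jac_coeff (nat \<bar>n\<bar>) N k) \<le> norm (g n k) * 4 ^ p"
        unfolding norm_mult p_def by (intro mult_left_mono norm_jac_coeff_le True) auto
      also have "\<dots> = (norm (g n k) * (8 / r) ^ p) * (r / 2) ^ p"
      proof -
        have "(4::real) ^ p = (8 / r * (r / 2)) ^ p" using r by simp
        then show ?thesis unfolding power_mult_distrib[of "8 / r"] by (simp only: mult.assoc)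
      qed
      also have "\<dots> \<le> (C * (1 / 2) ^ p) * (r / 2) ^ p"
        using C(2)[of n k] r unfolding p_def by (intro mult_right_mono) auto
      also have "\<dots> \<le> (C * 1) * (r ^ (nat \<bar>n\<bar> + N) * (1 / 2) ^ k)"
      proof (intro mult_mono)
        show "(1 / 2) ^ p \<le> (1 :: real)" by (rule power_le_one) auto
        have "(r / 2) ^ p = r ^ p * (1 / 2) ^ p" by (simp add: power_divide)
        also have "\<dots> \<le> r ^ (nat \<bar>n\<bar> + N) * (1 / 2) ^ k"
          unfolding p_def using r True by (intro mult_mono power_decreasing) auto
        finally show "(r / 2) ^ p \<le> r ^ (nat \<bar>n\<bar> + N) * (1 / 2) ^ k" .
      qed (use C r in auto)
      finally show ?thesis using True by (simp add: mult.assoc)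
    qed (use C r in auto)
  qed
qed

text \<open>
  Insert the expansion of each monomial and exchange the order of summation. The triple array is absolutely
  summable, since the change of basis costs only a geometric factor.
\<close>

theorem lmon_series_eq_mode_series:
  assumes g: "rapid g"
  obtains c where "rapid c" "\<And>z. lmon_series g z = mode_series c z"
proof -
  define u where "u = (\<lambda>n N k. if N \<le> k then g n k * jac_coeff (nat \<bar>n\<bar>) N k else 0)"
  define c where "c = (\<lambda>n N. suminf (u n N))"
  have half: "summable (\<lambda>k. (1 / 2 :: real) ^ k)" by (rule summable_geometric) simp
  have u_bound: "\<exists>C\<ge>0. \<forall>n N k. norm (u n N k) \<le> C * r ^ (nat \<bar>n\<bar> + N) * (1 / 2) ^ k" if "0 < r" "r \<le> 1" for r
    using lmon_to_mode_coeff_bound[OF g that] unfolding u_def .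
  have u_sum: "(u n N has_sum c n N) UNIV" for n N
  proof -
    obtain C where C: "\<And>n N k. norm (u n N k) \<le> C * 1 ^ (nat \<bar>n\<bar> + N) * (1 / 2) ^ k"
      using u_bound[of 1] by auto
    have s: "summable (\<lambda>k. norm (u n N k))"
      by (rule summable_comparison_test'[OF summable_mult[OF half, of "C * 1 ^ (nat \<bar>n\<bar> + N)"]]) (use C in auto)
    show ?thesis unfolding c_def
      by (rule norm_summable_imp_has_sum[OF s summable_sums[OF summable_norm_cancel[OF s]]])
  qed
  have "rapid c" unfolding rapid_def
  proof (intro allI impI)
    fix r :: real assume "0 < r"
    define r' where "r' = min r 1"
    have r': "0 < r'" "r' \<le> 1" "r' \<le> r" using \<open>0 < r\<close> by (auto simp: r'_def)
    obtain C where C: "0 \<le> C" "\<And>n N k. norm (u n N k) \<le> C * r' ^ (nat \<bar>n\<bar> + N) * (1 / 2) ^ k"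
      using u_bound[OF r'(1,2)] by auto
    have "norm (c n N) \<le> (C * 2) * r ^ (nat \<bar>n\<bar> + N)" for n N
    proof -
      have "norm (c n N) \<le> (\<Sum>k. C * r' ^ (nat \<bar>n\<bar> + N) * (1 / 2) ^ k)"
        unfolding c_def by (intro norm_suminf_le C summable_mult half)
      also have "\<dots> = C * r' ^ (nat \<bar>n\<bar> + N) * 2"
        by (subst suminf_mult[OF half]) (simp add: suminf_geometric)
      also have "\<dots> \<le> C * r ^ (nat \<bar>n\<bar> + N) * 2"
        using C(1) r' by (intro mult_right_mono mult_left_mono power_mono) auto
      finally show ?thesis by simp
    qed
    then show "\<exists>C. \<forall>n k. norm (c n k) \<le> C * r ^ (nat \<bar>n\<bar> + k)" by blast
  qed
  moreover have "lmon_series g z = mode_series c z" for z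
  proof -
    define K where "K = 4 * (1 + norm z)\<^sup>2"
    have K: "1 \<le> K" unfolding K_def by (rule mode_radius_ge_1) simp
    \<comment> \<open>Summing over k first gives the mode series, summing over N first the monomial series.\<close>
    define f where "f = (\<lambda>((n, N), k). u n N k * md n N z)"
    have r: "0 < 1 / (2 * K)" "1 / (2 * K) \<le> 1" using K by (auto simp: field_simps)
    obtain C where C: "0 \<le> C" "\<And>n N k. norm (u n N k) \<le> C * (1 / (2 * K)) ^ (nat \<bar>n\<bar> + N) * (1 / 2) ^ k"
      using u_bound[OF r] by auto
    have f_bound: "norm (f ((n, N), k)) \<le> C * (1 / 2) ^ (nat \<bar>n\<bar> + N) * (1 / 2) ^ k" for n N k
    proof -
      have "norm (f ((n, N), k)) \<le> (C * (1 / (2 * K)) ^ (nat \<bar>n\<bar> + N) * (1 / 2) ^ k) * K ^ (nat \<bar>n\<bar> + N)"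
        unfolding f_def case_prod_conv norm_mult
        using C K norm_md_le[of z "norm z" n N] by (intro mult_mono) (auto simp: K_def)
      also have "\<dots> = C * ((1 / (2 * K)) * K) ^ (nat \<bar>n\<bar> + N) * (1 / 2) ^ k"
        by (simp only: power_mult_distrib mult_ac)
      also have "(1 / (2 * K)) * K = 1 / 2" using K by simp
      finally show ?thesis .
    qed
    have halfsum: "((\<lambda>k. (1 / 2 :: real) ^ k) has_sum 2) UNIV"
      using norm_summable_imp_has_sum[of "\<lambda>k. (1 / 2 :: real) ^ k" 2] half geometric_sums[of "1 / 2 :: real"]
      by (simp add: norm_power power_divide)
    have "(\<lambda>x. C * (\<lambda>(n, k). (1 / 2) ^ (nat \<bar>n\<bar> + k)) x * 2) summable_on (UNIV :: (int \<times> nat) set)"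
      by (intro summable_on_cmult_right summable_on_cmult_left summable_on_geometric_int_nat) auto
    then have "(\<lambda>(x, k). C * (\<lambda>(n, k). (1 / 2) ^ (nat \<bar>n\<bar> + k)) x * (1 / 2) ^ k) summable_on (SIGMA x:(UNIV :: (int \<times> nat) set). (UNIV :: nat set))"
      by (intro summable_on_SigmaI[where g = "\<lambda>x. C * (\<lambda>(n, k). (1 / 2) ^ (nat \<bar>n\<bar> + k)) x * 2"])
         (use C has_sum_cmult_right[OF halfsum] in auto)
    then have M: "(\<lambda>(x, k). C * (\<lambda>(n, k). (1 / 2) ^ (nat \<bar>n\<bar> + k)) x * (1 / 2) ^ k) summable_on (UNIV :: ((int \<times> nat) \<times> nat) set)"
      by simp
    have "(\<lambda>x. norm (f x)) summable_on UNIV"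
      by (rule Infinite_Sum.abs_summable_on_comparison_test'[OF M]) (use f_bound in auto)
    then have "f summable_on UNIV" by (rule abs_summable_summable)
    then obtain S where S: "(f has_sum S) UNIV" by (auto simp: summable_on_def)
    have "((\<lambda>(n, N). c n N * md n N z) has_sum S) UNIV"
    proof (rule has_sum_SigmaD[where f = f and B = "\<lambda>_. UNIV"])
      show "((\<lambda>y. f (x, y)) has_sum (\<lambda>(n, N). c n N * md n N z) x) UNIV" for x
        using has_sum_cmult_left[OF u_sum[of "fst x" "snd x"], where c = "md (fst x) (snd x) z"]
        by (simp add: f_def case_prod_unfold)
    qed (use S in simp)
    then have S1: "S = mode_series c z" using mode_has_sum[OF \<open>rapid c\<close>, of z] has_sum_unique by blast
    have S': "((\<lambda>((n, k), N). f ((n, N), k)) has_sum S) UNIV"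
      by (subst has_sum_reindex_bij_witness[where S = UNIV and T = UNIV and i = "\<lambda>((n, k), N). ((n, N), k)"
            and j = "\<lambda>((n, k), N). ((n, N), k)" and h = f]) (use S in auto)
    have "((\<lambda>(n, k). g n k * lmon n k z) has_sum S) UNIV"
    proof (rule has_sum_SigmaD[where f = "\<lambda>((n, k), N). f ((n, N), k)" and B = "\<lambda>_. UNIV"])
      fix x :: "int \<times> nat"
      obtain n k where x: "x = (n, k)" by fastforce
      have "((\<lambda>N. f ((n, N), k)) has_sum (\<Sum>N\<le>k. f ((n, N), k))) UNIV"
        by (rule has_sum_finite_neutralI[where B = "{..k}"]) (auto simp: f_def u_def)
      also have "(\<Sum>N\<le>k. f ((n, N), k)) = g n k * lmon n k z"
        unfolding lmon_eq_sum_md sum_distrib_left by (intro sum.cong) (auto simp: f_def u_def)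
      finally show "((\<lambda>y. (\<lambda>((n, k), N). f ((n, N), k)) (x, y)) has_sum (\<lambda>(n, k). g n k * lmon n k z) x) UNIV"
        by (simp add: x)
    qed (use S' in simp)
    then have "S = lmon_series g z" using lmon_has_sum[OF g, of z] has_sum_unique by blast
    with S1 show ?thesis by simp
  qed
  ultimately show ?thesis using that by blast
qed

corollary sep_holomorphic_mode_expansion:
  assumes "sep_holomorphic f"
  obtains c where "rapid c" "\<And>z. z \<in> csphere \<Longrightarrow> f z = mode_series c z"
  using sep_holomorphic_expansion[OF assms] lmon_series_eq_mode_series by metis

section \<open>Integration over the real sphere\<close>

abbreviation sbox :: "(real \<times> real) set" where "sbox \<equiv> cbox (0, 0) (2 * pi, pi)"

lemma cA_sphere_coords: "cA (sphere_coords (\<phi>, \<theta>)) = of_real (sin \<theta>) * cis \<phi>"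
  and cB_sphere_coords: "cB (sphere_coords (\<phi>, \<theta>)) = of_real (sin \<theta>) * cis (- \<phi>)"
  and sphere_coords_3: "sphere_coords (\<phi>, \<theta>) $ 3 = of_real (cos \<theta>)"
  by (simp_all add: sphere_coords_def cA_def cB_def complex_eq_iff)

lemma sphere_coords_in_rsphere: "sphere_coords p \<in> rsphere"
proof -
  obtain \<phi> \<theta> where p: "p = (\<phi>, \<theta>)" by fastforce
  have "cA (sphere_coords p) * cB (sphere_coords p) = of_real ((sin \<theta>)\<^sup>2) * (cis \<phi> * cis (- \<phi>))"
    unfolding p cA_sphere_coords cB_sphere_coords by (simp add: power2_eq_square)
  also have "\<dots> = 1 - (sphere_coords p $ 3)\<^sup>2"
    unfolding p sphere_coords_3 cis_mult sin_squared_eq by simp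
  finally have "sphere_coords p \<in> csphere" by (simp add: csphere_iff)
  moreover have "\<forall>i. sphere_coords p $ i \<in> \<real>"
    unfolding p forall_3 by (simp add: sphere_coords_def)
  ultimately show ?thesis by (simp add: rsphere_def)
qed

lemma continuous_on_sphere_coords [continuous_intros]: "continuous_on S sphere_coords"
proof -
  have "sphere_coords = (\<lambda>p. pt (of_real (sin (snd p)) * cis (fst p)) (of_real (sin (snd p)) * cis (- fst p)) (of_real (cos (snd p))))"
    using pt_coords[of "sphere_coords (_, _)"] unfolding cA_sphere_coords cB_sphere_coords sphere_coords_3
    by (auto simp: fun_eq_iff)
  moreover have "continuous_on S (\<lambda>p. pt (of_real (sin (snd p)) * cis (fst p)) (of_real (sin (snd p)) * cis (- fst p)) (of_real (cos (snd p))))"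
    by (intro continuous_intros)
  ultimately show ?thesis by (rule ssubst[where P = "continuous_on S"])
qed

lemma rsphere_subset_csphere: "rsphere \<subseteq> csphere" by (auto simp: rsphere_def)

lemma norm_rsphere_le_1:
  assumes "z \<in> rsphere" shows "norm z \<le> 1"
proof -
  have r: "z $ i \<in> \<real>" for i using assms by (simp add: rsphere_def)
  have "(norm (z $ i))\<^sup>2 = Re ((z $ i)\<^sup>2)" for i
    using r[of i] cmod_power2[of "z $ i"] by (simp add: complex_is_Real_iff power2_eq_square)
  then have "(\<Sum>i\<in>UNIV. (norm (z $ i))\<^sup>2) = Re ((z $ 1)\<^sup>2 + (z $ 2)\<^sup>2 + (z $ 3)\<^sup>2)"
    by (simp add: sum_3)
  also have "\<dots> = 1" using assms by (simp add: rsphere_def csphere_def)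
  finally show ?thesis by (simp add: norm_vec_def L2_set_def)
qed

lemma compact_rsphere: "compact rsphere"
proof -
  have "rsphere = csphere \<inter> (\<Inter>i. {z. Im (z $ i) = 0})"
    by (auto simp: rsphere_def complex_is_Real_iff)
  moreover have "closed (csphere \<inter> (\<Inter>i. {z :: complex^3. Im (z $ i) = 0}))"
    by (intro closed_Int closed_csphere closed_INT ballI closed_Collect_eq continuous_intros)
  ultimately have "closed rsphere" by simp
  moreover have "bounded rsphere" unfolding bounded_iff using norm_rsphere_le_1 by blast
  ultimately show ?thesis by (simp add: compact_eq_bounded_closed)
qed

lemma sphere_coords_measurable: "sphere_coords \<in> measurable (density lborel w) (restrict_space borel rsphere)"
  by (rule measurable_restrict_space2)
     (auto simp: sphere_coords_in_rsphere intro!: borel_measurable_continuous_onI continuous_intros)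

lemma space_sphere_area [simp]: "space sphere_area = rsphere"
  by (simp add: sphere_area_def space_restrict_space)

lemma borel_measurable_sphere_area:
  fixes f :: "complex^3 \<Rightarrow> 'a :: topological_space"
  assumes "continuous_on rsphere f" shows "f \<in> borel_measurable sphere_area"
proof -
  have "f \<in> borel_measurable (restrict_space borel rsphere)"
    by (rule borel_measurable_continuous_on_restrict[OF assms])
  then show ?thesis unfolding sphere_area_def by simp
qed

text \<open>
  For continuous integrands the area integral is an ordinary integral over a rectangle, to which Fubini's
  theorem applies.
\<close>

lemma sphere_area_integral:
  fixes f :: "complex^3 \<Rightarrow> 'a :: euclidean_space"
  assumes f: "continuous_on rsphere f"
  shows "integrable sphere_area f"
    and "(LINT x|sphere_area. f x) = integral sbox (\<lambda>p. (sin (snd p) / (4 * pi)) *\<^sub>R f (sphere_coords p))"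
proof -
  define w where "w = (\<lambda>p :: real \<times> real. indicator sbox p * (sin (snd p) / (4 * pi)) :: real)"
  have box: "{0..2 * pi} \<times> {0..pi} = sbox" by (simp add: cbox_Pair_eq)
  have area: "sphere_area = distr (density lborel (\<lambda>p. ennreal (w p))) (restrict_space borel rsphere) sphere_coords"
    unfolding sphere_area_def w_def box case_prod_unfold by simp
  have w_meas [measurable]: "w \<in> borel_measurable lborel"
  proof -
    have "(\<lambda>p. indicator sbox p *\<^sub>R (sin (snd p) / (4 * pi)) :: real) \<in> borel_measurable borel"
      by (intro borel_measurable_continuous_on_indicator continuous_intros) auto
    then show ?thesis by (simp add: w_def)
  qed
  have w_nonneg: "0 \<le> w p" for p
    unfolding w_def by (cases p) (auto simp: indicator_def cbox_Pair_eq intro!: sin_ge_zero divide_nonneg_pos)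
  have fsc: "continuous_on UNIV (\<lambda>p. f (sphere_coords p))"
    by (rule continuous_on_compose2[OF f]) (auto simp: sphere_coords_in_rsphere intro!: continuous_intros)
  then have f_meas: "(\<lambda>p. f (sphere_coords p)) \<in> borel_measurable lborel"
    by (simp add: borel_measurable_continuous_onI)
  have f_meas': "f \<in> borel_measurable (restrict_space borel rsphere)"
    by (rule borel_measurable_continuous_on_restrict[OF f])
  have cont: "continuous_on sbox (\<lambda>p. (sin (snd p) / (4 * pi)) *\<^sub>R f (sphere_coords p))"
    by (intro continuous_intros continuous_on_subset[OF fsc]) auto
  have int: "integrable lborel (\<lambda>p. indicator sbox p *\<^sub>R ((sin (snd p) / (4 * pi)) *\<^sub>R f (sphere_coords p)))"
    by (rule borel_integrable_compact[OF compact_cbox cont])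
  then have int': "integrable lborel (\<lambda>p. w p *\<^sub>R f (sphere_coords p))" by (simp add: w_def)
  have dens: "integrable (density lborel (\<lambda>p. ennreal (w p))) (\<lambda>p. f (sphere_coords p))"
    using int' w_nonneg by (subst integrable_density[OF f_meas w_meas]) auto
  show "integrable sphere_area f"
    unfolding area by (subst integrable_distr_eq[OF sphere_coords_measurable f_meas']) (rule dens)
  have "(LINT x|sphere_area. f x) = (LINT p|density lborel (\<lambda>p. ennreal (w p)). f (sphere_coords p))"
    unfolding area by (rule integral_distr[OF sphere_coords_measurable f_meas'])
  also have "\<dots> = (LINT p|lborel. w p *\<^sub>R f (sphere_coords p))"
    by (rule integral_density[OF f_meas w_meas]) (simp add: w_nonneg)
  also have "\<dots> = (LINT p:sbox|lborel. (sin (snd p) / (4 * pi)) *\<^sub>R f (sphere_coords p))"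
    by (simp add: set_lebesgue_integral_def w_def)
  also have "\<dots> = integral sbox (\<lambda>p. (sin (snd p) / (4 * pi)) *\<^sub>R f (sphere_coords p))"
    by (rule set_borel_integral_eq_integral) (use int in \<open>simp add: set_integrable_def\<close>)
  finally show "(LINT x|sphere_area. f x) = integral sbox (\<lambda>p. (sin (snd p) / (4 * pi)) *\<^sub>R f (sphere_coords p))" .
qed

lemma sphere_area_integral_norm_le:
  fixes f :: "complex^3 \<Rightarrow> complex"
  assumes f: "continuous_on rsphere f" and M: "\<And>x. x \<in> rsphere \<Longrightarrow> norm (f x) \<le> M"
  shows "norm (LINT x|sphere_area. f x) \<le> M * (LINT x|sphere_area. 1)"
proof -
  have "norm (LINT x|sphere_area. f x) \<le> (LINT x|sphere_area. M * 1)"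
    by (rule Bochner_Integration.integral_norm_bound_integral)
       (use M in \<open>auto intro!: sphere_area_integral f continuous_intros\<close>)
  then show ?thesis by (simp add: mult.commute)
qed

lemma circ_sphere_coords:
  "circ n (sphere_coords (\<phi>, \<theta>)) = (if n \<ge> 0 then 1 else (-1) ^ nat \<bar>n\<bar>) * of_real (sin \<theta> ^ nat \<bar>n\<bar>) * cis (- of_int n * \<phi>)"
proof (cases "n \<ge> 0")
  case True
  have "cis (- \<phi>) ^ nat n = cis (real (nat n) * (- \<phi>))" by (rule Complex.DeMoivre)
  also have "real (nat n) * (- \<phi>) = - of_int n * \<phi>" using True by simp
  finally have "cis (- \<phi>) ^ nat n = cis (- of_int n * \<phi>)" .
  then show ?thesis using True by (simp add: circ_def cB_sphere_coords power_mult_distrib)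
next
  case False
  have "cis \<phi> ^ nat (- n) = cis (real (nat (- n)) * \<phi>)" by (rule Complex.DeMoivre)
  also have "real (nat (- n)) * \<phi> = - of_int n * \<phi>" using False by simp
  finally have "cis \<phi> ^ nat (- n) = cis (- of_int n * \<phi>)" .
  moreover have "(- (of_real (sin \<theta>) * cis \<phi>)) ^ nat (- n) = (-1) ^ nat (- n) * (of_real (sin \<theta>) ^ nat (- n) * cis \<phi> ^ nat (- n))"
    by (simp only: power_minus[of "of_real (sin \<theta>) * cis \<phi>"] power_mult_distrib)
  ultimately show ?thesis using False by (simp add: circ_def cA_sphere_coords)
qed

lemma cnj_jac_of_real: "cnj (jac n N (of_real x)) = jac n N (of_real x)"
  unfolding jac_def by simp

text \<open>
  Of the factor \<open>1 / (4 \<pi>)\<close> in the area measure, the integral over \<open>\<phi>\<close> leaves \<open>1 / 2\<close>.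
\<close>

definition md_norm :: "int \<Rightarrow> nat \<Rightarrow> real" where "md_norm n N = jac_norm (nat \<bar>n\<bar>) N / 2"

lemma md_norm_pos: "md_norm n N > 0" by (simp add: md_norm_def jac_norm_pos)

lemma integral_cis_period: "k \<noteq> 0 \<Longrightarrow> ((\<lambda>\<phi>. cis (of_int k * \<phi>)) has_integral 0) {0..2 * pi}"
proof -
  assume k: "k \<noteq> 0"
  have "((\<lambda>\<phi>. cis (of_int k * \<phi>)) has_integral
     (- \<i> / of_int k * cis (of_int k * (2 * pi)) - (- \<i> / of_int k * cis (of_int k * 0)))) {0..2 * pi}"
  proof (rule fundamental_theorem_of_calculus)
    fix x
    have "((\<lambda>z. exp (\<i> * (of_int k * z))) has_field_derivative (of_int k * (\<i> * exp (\<i> * (of_int k * of_real x))))) (at (of_real x))"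
      by (auto intro!: derivative_eq_intros)
    from has_vector_derivative_real_field[OF this, of "{0..2 * pi}"]
    have "((\<lambda>\<phi>. cis (of_int k * \<phi>)) has_vector_derivative (of_int k *\<^sub>R (\<i> * cis (of_int k * x)))) (at x within {0..2 * pi})"
      by (simp add: cis_conv_exp scaleR_conv_of_real)
    from has_vector_derivative_mult_right[OF this, of "- \<i> / of_int k"]
    show "((\<lambda>x. - \<i> / of_int k * cis (of_int k * x)) has_vector_derivative cis (of_int k * x)) (at x within {0..2 * pi})"
      using k by (simp add: scaleR_conv_of_real)
  qed simp
  moreover have "cis (of_int k * (2 * pi)) = 1"
    using cis_multiple_2pi[of "of_int k"] by (simp add: mult_ac)
  ultimately show ?thesis by simp
qed

text \<open>
  In spherical coordinates the integrand is a product of a character in \<open>\<phi>\<close> and a function of \<open>\<theta>\<close>. The first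
  factor forces \<open>n = n'\<close>, and then the second is the orthogonality integral of the Jacobi polynomials with
  weight \<open>sin\<^sup>2\<^sup>|\<^sup>n\<^sup>|\<^sup>+\<^sup>1 \<theta>\<close>.
\<close>

theorem md_orthogonal:
  "sphere_ip (md n N) (md n' N') = (if n = n' \<and> N = N' then of_real (md_norm n N) else 0)"
proof -
  define \<sigma> :: "int \<Rightarrow> complex" where "\<sigma> n = (if n \<ge> 0 then 1 else (-1) ^ nat \<bar>n\<bar>)" for n
  have \<sigma>: "\<sigma> n * cnj (\<sigma> n) = 1" for n
    unfolding \<sigma>_def by (simp add: power_mult_distrib[symmetric])
  define A where "A \<phi> = cis (of_int (n' - n) * \<phi>)" for \<phi>
  define B where "B \<theta> = of_real (sin \<theta> ^ (nat \<bar>n\<bar> + nat \<bar>n'\<bar> + 1)) * jac (nat \<bar>n\<bar>) N (of_real (cos \<theta>))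
      * jac (nat \<bar>n'\<bar>) N' (of_real (cos \<theta>))" for \<theta>
  define K where "K = \<sigma> n * cnj (\<sigma> n') / (4 * pi)"
  have cont: "continuous_on rsphere (\<lambda>x. md n N x * cnj (md n' N' x))"
    by (intro continuous_intros)
  have prod: "(sin (snd p) / (4 * pi)) *\<^sub>R (md n N (sphere_coords p) * cnj (md n' N' (sphere_coords p)))
      = K * (A (fst p) * B (snd p))" for p
  proof -
    obtain \<phi> \<theta> where p: "p = (\<phi>, \<theta>)" by fastforce
    have c: "cis (- (of_int n * \<phi>)) * cis (of_int n' * \<phi>) = A \<phi>"
      unfolding A_def cis_mult by (simp add: algebra_simps)
    have "md n N (sphere_coords p) * cnj (md n' N' (sphere_coords p)) =
       \<sigma> n * cnj (\<sigma> n') * (cis (- (of_int n * \<phi>)) * cis (of_int n' * \<phi>))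
        * (of_real (sin \<theta> ^ (nat \<bar>n\<bar> + nat \<bar>n'\<bar>)) * jac (nat \<bar>n\<bar>) N (of_real (cos \<theta>)) * jac (nat \<bar>n'\<bar>) N' (of_real (cos \<theta>)))"
      unfolding p md_def circ_sphere_coords sphere_coords_3 \<sigma>_def[symmetric]
      by (simp add: cnj_jac_of_real cis_cnj power_add mult_ac)
    then show ?thesis unfolding c K_def B_def p by (simp add: scaleR_conv_of_real mult_ac)
  qed
  have Acont: "continuous_on S A" and Bcont: "continuous_on S B" for S
    unfolding A_def B_def by (intro continuous_intros)+
  have "sphere_ip (md n N) (md n' N') = integral sbox (\<lambda>p. K * (A (fst p) * B (snd p)))"
    unfolding sphere_ip_def sphere_area_integral(2)[OF cont] prod ..
  also have "\<dots> = integral (cbox 0 (2 * pi)) (\<lambda>\<phi>. integral (cbox 0 pi) (\<lambda>\<theta>. K * (A \<phi> * B \<theta>)))"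
    by (subst integral_prod_continuous)
       (auto intro!: continuous_intros continuous_on_compose2[OF Acont[of UNIV]] continuous_on_compose2[OF Bcont[of UNIV]])
  also have "\<dots> = K * (integral {0..2 * pi} A * integral {0..pi} B)"
    by simp
  also have "\<dots> = (if n = n' \<and> N = N' then of_real (md_norm n N) else 0)"
  proof (cases "n = n'")
    case False
    then have "integral {0..2 * pi} A = 0" unfolding A_def by (intro integral_unique integral_cis_period) simp
    then show ?thesis using False by simp
  next
    case True
    have "integral {0..2 * pi} A = 2 * pi" unfolding A_def using True by (simp add: scaleR_conv_of_real)
    moreover have "integral {0..pi} B = (if N = N' then of_real (jac_norm (nat \<bar>n\<bar>) N) else 0)"
      using integral_unique[OF jac_orthogonal[of "nat \<bar>n\<bar>" N N']] True unfolding B_def by (simp add: mult_2)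
    moreover have "K = 1 / (4 * pi)" unfolding K_def using True \<sigma>[of n'] by simp
    ultimately show ?thesis using True by (simp add: md_norm_def)
  qed
  finally show ?thesis .
qed

lemma loc_uniform_limit_compact:
  assumes "loc_uniform_limit S f l" "compact K" "K \<subseteq> S"
  shows "uniform_limit K f l sequentially"
proof -
  have "\<forall>x\<in>K. \<exists>U. open U \<and> x \<in> U \<and> uniform_limit (U \<inter> S) f l sequentially"
    using assms unfolding loc_uniform_limit_def by blast
  then obtain U where U: "\<And>x. x \<in> K \<Longrightarrow> open (U x)" "\<And>x. x \<in> K \<Longrightarrow> x \<in> U x"
    "\<And>x. x \<in> K \<Longrightarrow> uniform_limit (U x \<inter> S) f l sequentially" by metis
  have "K \<subseteq> (\<Union>x\<in>K. U x)" using U by blast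
  then obtain D where D: "D \<subseteq> K" "finite D" "K \<subseteq> (\<Union>x\<in>D. U x)"
    using compactE_image[OF assms(2), of K U] U(1) by metis
  have "uniform_limit (\<Union>x\<in>D. U x \<inter> S) f l sequentially"
    using D(2,1) U(3) by (induction D rule: finite_induct) (auto intro!: uniform_limit_on_Un)
  then show ?thesis by (rule uniform_limit_on_subset) (use D assms in blast)
qed

lemma sphere_ip_uniform_limit:
  assumes F: "\<And>N :: nat. continuous_on rsphere (F N)" and P: "continuous_on rsphere P"
    and lim: "uniform_limit rsphere F f sequentially"
  shows "(\<lambda>N. sphere_ip (F N) P) \<longlonglongrightarrow> sphere_ip f P"
proof -
  have f: "continuous_on rsphere f" by (rule uniform_limit_theorem[OF _ lim]) (use F in auto)
  have "bounded (P ` rsphere)"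
    by (intro compact_imp_bounded compact_continuous_image P compact_rsphere)
  then obtain M where M: "\<And>x. x \<in> rsphere \<Longrightarrow> norm (P x) \<le> M" "0 < M"
    unfolding bounded_pos by auto
  define V where "V = (LINT x|sphere_area. 1 :: real)"
  have V: "0 \<le> V" unfolding V_def by simp
  show ?thesis
  proof (rule LIMSEQ_I)
    fix e :: real assume e: "0 < e"
    define d where "d = e / (2 * M * (V + 1))"
    have d: "0 < d" unfolding d_def using e M V by simp
    have "d * M * V < e"
    proof -
      have "d * M * V \<le> d * M * (V + 1)" using d M V by (intro mult_left_mono) auto
      also have "d * M * (V + 1) = e / 2"
      proof -
        have "V + 1 \<noteq> 0" using V by linarith
        then show ?thesis unfolding d_def using M(2) by (simp add: divide_simps)
      qed
      finally show ?thesis using e by linarith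
    qed
    obtain N0 where N0: "\<And>N x. N \<ge> N0 \<Longrightarrow> x \<in> rsphere \<Longrightarrow> dist (F N x) (f x) < d"
      using lim d unfolding uniform_limit_sequentially_iff by blast
    have "norm (sphere_ip (F N) P - sphere_ip f P) < e" if N: "N \<ge> N0" for N
    proof -
      have "sphere_ip (F N) P - sphere_ip f P = (LINT x|sphere_area. F N x * cnj (P x) - f x * cnj (P x))"
        unfolding sphere_ip_def
        by (rule Bochner_Integration.integral_diff[symmetric]; intro sphere_area_integral continuous_intros F P f)
      also have "norm \<dots> \<le> (d * M) * V" unfolding V_def
      proof (rule sphere_area_integral_norm_le)
        show "continuous_on rsphere (\<lambda>x. F N x * cnj (P x) - f x * cnj (P x))"
          by (intro continuous_intros F P f)
        fix x assume x: "x \<in> rsphere"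
        have "norm (F N x * cnj (P x) - f x * cnj (P x)) = norm (F N x - f x) * norm (P x)"
          by (simp flip: left_diff_distrib add: norm_mult)
        also have "\<dots> \<le> d * M" using N0[OF N x] M(1)[OF x] d by (intro mult_mono) (auto simp: dist_norm)
        finally show "norm (F N x * cnj (P x) - f x * cnj (P x)) \<le> d * M" .
      qed
      finally show ?thesis using \<open>d * M * V < e\<close> by linarith
    qed
    then show "\<exists>N0. \<forall>N\<ge>N0. norm (sphere_ip (F N) P - sphere_ip f P) < e" by blast
  qed
qed

section \<open>Uniqueness of mode expansions\<close>

lemma filterlim_uniform_limit_compose:
  assumes "uniform_limit X f l G" "filterlim E G F"
  shows "uniform_limit X (\<lambda>N. f (E N)) l F"
  using filterlim_compose[OF assms] .

lemma loc_uniform_limit_cballI: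
  fixes f :: "nat \<Rightarrow> 'a :: real_normed_vector \<Rightarrow> complex"
  assumes "\<And>\<rho>. uniform_limit (S \<inter> cball 0 \<rho>) f l sequentially"
  shows "loc_uniform_limit S f l"
  unfolding loc_uniform_limit_def
proof
  fix x assume "x \<in> S"
  have "uniform_limit (ball 0 (norm x + 1) \<inter> S) f l sequentially"
    by (rule uniform_limit_on_subset[OF assms[of "norm x + 1"]]) auto
  then show "\<exists>U. open U \<and> x \<in> U \<and> uniform_limit (U \<inter> S) f l sequentially"
    by (intro exI[of _ "ball 0 (norm x + 1)"]) auto
qed

lemma sphere_ip_cong:
  assumes "\<And>x. x \<in> rsphere \<Longrightarrow> f x = f' x" "\<And>x. x \<in> rsphere \<Longrightarrow> g x = g' x"
  shows "sphere_ip f g = sphere_ip f' g'"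
  unfolding sphere_ip_def by (rule Bochner_Integration.integral_cong) (use assms in auto)

lemma sphere_ip_sum_left:
  assumes "\<And>i. i \<in> I \<Longrightarrow> continuous_on rsphere (f i)" "continuous_on rsphere g"
  shows "sphere_ip (\<lambda>x. \<Sum>i\<in>I. c i * f i x) g = (\<Sum>i\<in>I. c i * sphere_ip (f i) g)"
proof -
  have "sphere_ip (\<lambda>x. \<Sum>i\<in>I. c i * f i x) g = (LINT x|sphere_area. (\<Sum>i\<in>I. c i * (f i x * cnj (g x))))"
    unfolding sphere_ip_def by (simp add: sum_distrib_right mult.assoc)
  also have "\<dots> = (\<Sum>i\<in>I. LINT x|sphere_area. c i * (f i x * cnj (g x)))"
    by (rule Bochner_Integration.integral_sum, rule sphere_area_integral(1)) (intro continuous_intros assms)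
  also have "\<dots> = (\<Sum>i\<in>I. c i * sphere_ip (f i) g)"
    unfolding sphere_ip_def by simp
  finally show ?thesis .
qed

lemma sphere_ip_commute: "sphere_ip g f = cnj (sphere_ip f g)"
  unfolding sphere_ip_def by (subst Bochner_Integration.integral_cnj[symmetric]) (simp add: mult.commute)

lemma sphere_ip_sum_md:
  assumes "finite E"
  shows "sphere_ip (\<lambda>z. \<Sum>(n, k)\<in>E. c n k * md n k z) (md n0 k0) = (if (n0, k0) \<in> E then c n0 k0 * of_real (md_norm n0 k0) else 0)"
proof -
  have "sphere_ip (\<lambda>z. \<Sum>(n, k)\<in>E. c n k * md n k z) (md n0 k0)
      = (\<Sum>x\<in>E. (\<lambda>(n, k). c n k) x * sphere_ip ((\<lambda>(n, k). md n k) x) (md n0 k0))"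
    by (subst sphere_ip_sum_left[symmetric]) (auto simp: case_prod_unfold intro!: continuous_intros)
  also have "\<dots> = (\<Sum>x\<in>E. if x = (n0, k0) then c n0 k0 * of_real (md_norm n0 k0) else 0)"
    by (intro sum.cong refl) (auto simp: md_orthogonal split: if_split_asm)
  also have "\<dots> = (if (n0, k0) \<in> E then c n0 k0 * of_real (md_norm n0 k0) else 0)"
    using assms by simp
  finally show ?thesis .
qed

text \<open>
  Integration against a mode commutes with the limit, and a partial sum that contains the index already has the
  right coefficient. Any exhaustion \<open>E\<close> by finite sets is admitted, so that one statement covers summation by
  degrees as well as along an arbitrary enumeration of the modes.
\<close>

lemma mode_coeff_unique:
  assumes E: "filterlim E (finite_subsets_at_top UNIV) sequentially"
    and lim: "loc_uniform_limit csphere (\<lambda>N z. \<Sum>(n, k)\<in>E N. c n k * md n k z) f"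
  shows "c n0 k0 = sphere_ip f (md n0 k0) / of_real (md_norm n0 k0)"
proof -
  have "(\<lambda>N. sphere_ip (\<lambda>z. \<Sum>(n, k)\<in>E N. c n k * md n k z) (md n0 k0)) \<longlonglongrightarrow> sphere_ip f (md n0 k0)"
    by (rule sphere_ip_uniform_limit[OF _ _ loc_uniform_limit_compact[OF lim compact_rsphere rsphere_subset_csphere]])
       (auto intro!: continuous_intros simp: case_prod_unfold)
  moreover have "\<forall>\<^sub>F N in sequentially. sphere_ip (\<lambda>z. \<Sum>(n, k)\<in>E N. c n k * md n k z) (md n0 k0)
      = c n0 k0 * of_real (md_norm n0 k0)"
  proof -
    have "\<forall>\<^sub>F N in sequentially. finite (E N) \<and> {(n0, k0)} \<subseteq> E N \<and> E N \<subseteq> UNIV"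
      using E unfolding filterlim_finite_subsets_at_top by blast
    then show ?thesis by eventually_elim (simp add: sphere_ip_sum_md)
  qed
  ultimately have "(\<lambda>N. c n0 k0 * complex_of_real (md_norm n0 k0)) \<longlonglongrightarrow> sphere_ip f (md n0 k0)"
    by (rule Lim_transform_eventually)
  then have "c n0 k0 * of_real (md_norm n0 k0) = sphere_ip f (md n0 k0)" by (simp add: LIMSEQ_const_iff)
  then show ?thesis using md_norm_pos[of n0 k0] by (simp add: field_simps)
qed

lemma mode_series_loc_uniform_limit:
  assumes "rapid c" "filterlim E (finite_subsets_at_top UNIV) sequentially"
  shows "loc_uniform_limit S (\<lambda>N z. \<Sum>(n, k)\<in>E N. c n k * md n k z) (mode_series c)"
proof (rule loc_uniform_limit_cballI)
  fix \<rho>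
  show "uniform_limit (S \<inter> cball 0 \<rho>) (\<lambda>N z. \<Sum>(n, k)\<in>E N. c n k * md n k z) (mode_series c) sequentially"
    by (rule uniform_limit_on_subset[OF filterlim_uniform_limit_compose[OF mode_uniform_limit[OF assms(1), of \<rho>] assms(2)]]) auto
qed

definition upto_degree :: "nat \<Rightarrow> (int \<times> nat) set" where
  "upto_degree M = {(n, k). nat \<bar>n\<bar> + k < M}"

lemma finite_upto_degree: "finite (upto_degree M)"
  by (rule finite_subset[of _ "{- int M..int M} \<times> {..M}"]) (auto simp: upto_degree_def)

lemma filterlim_upto_degree: "filterlim upto_degree (finite_subsets_at_top UNIV) sequentially"
  unfolding filterlim_finite_subsets_at_top
proof (intro allI impI)
  fix X :: "(int \<times> nat) set" assume X: "finite X \<and> X \<subseteq> UNIV"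
  then have "finite ((\<lambda>(n, k). nat \<bar>n\<bar> + k) ` X)" by simp
  then obtain M where M: "\<forall>x\<in>(\<lambda>(n, k). nat \<bar>n\<bar> + k) ` X. x < M"
    unfolding finite_nat_set_iff_bounded by (rule exE)
  have "X \<subseteq> upto_degree N" if "N \<ge> M" for N
  proof
    fix x assume "x \<in> X"
    with M have "(\<lambda>(n, k). nat \<bar>n\<bar> + k) x < M" by (rule bspec[OF _ imageI])
    then show "x \<in> upto_degree N" using that by (auto simp: upto_degree_def)
  qed
  then show "\<forall>\<^sub>F N in sequentially. finite (upto_degree N) \<and> X \<subseteq> upto_degree N \<and> upto_degree N \<subseteq> UNIV"
    unfolding eventually_sequentially using finite_upto_degree by blast
qed

lemma mode_series_coeff:
  assumes "rapid c" "\<And>z. z \<in> csphere \<Longrightarrow> f z = mode_series c z"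
  shows "c n k = sphere_ip f (md n k) / of_real (md_norm n k)"
proof -
  have "c n k = sphere_ip (mode_series c) (md n k) / of_real (md_norm n k)"
    by (rule mode_coeff_unique[OF filterlim_upto_degree mode_series_loc_uniform_limit[OF assms(1) filterlim_upto_degree]])
  also have "sphere_ip (mode_series c) (md n k) = sphere_ip f (md n k)"
    by (rule sphere_ip_cong) (use assms(2) rsphere_subset_csphere in auto)
  finally show ?thesis .
qed

lemma mode_series_inj:
  assumes "rapid c" "rapid d" "\<And>z. z \<in> csphere \<Longrightarrow> mode_series c z = mode_series d z"
  shows "c = d"
proof (intro ext)
  fix n k
  have "c n k = sphere_ip (mode_series c) (md n k) / of_real (md_norm n k)"
    by (rule mode_series_coeff[OF assms(1)]) (rule refl)
  also have "\<dots> = d n k"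
    by (rule mode_series_coeff[OF assms(2), symmetric]) (rule assms(3))
  finally show "c n k = d n k" .
qed

section \<open>Holomorphic functions of several variables\<close>

definition holv :: "(complex^'n \<Rightarrow> complex) \<Rightarrow> complex^'n \<Rightarrow> bool" where
  "holv f x \<longleftrightarrow> (\<exists>a :: complex^'n. (f has_derivative (\<lambda>h. \<Sum>i\<in>UNIV. a $ i * h $ i)) (at x))"

lemma holomorphic_vec_on_iff: "holomorphic_vec_on f U \<longleftrightarrow> (\<forall>x\<in>U. holv f x)"
  by (simp add: holomorphic_vec_on_def holv_def)

lemma holvI:
  fixes f :: "complex^'n \<Rightarrow> complex"
  assumes D: "(f has_derivative D) (at x)" and lin: "\<And>t h. D (t *s h) = t * D h"
  shows "holv f x"
proof -
  have "D h = (\<Sum>i\<in>UNIV. (\<chi> i. D (axis i 1)) $ i * h $ i)" for h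
  proof -
    have "D h = D (\<Sum>i\<in>UNIV. h $ i *s axis i 1)" by (simp add: basis_expansion)
    also have "\<dots> = (\<Sum>i\<in>UNIV. D (h $ i *s axis i 1))"
      by (rule linear_sum[OF has_derivative_linear[OF D]])
    finally show ?thesis by (simp add: lin mult.commute)
  qed
  then have "D = (\<lambda>h. \<Sum>i\<in>UNIV. (\<chi> i. D (axis i 1)) $ i * h $ i)" by blast
  then show ?thesis using D unfolding holv_def by metis
qed

lemma holvE:
  fixes f :: "complex^'n \<Rightarrow> complex"
  assumes "holv f x"
  obtains D where "(f has_derivative D) (at x)" "\<And>t h. D (t *s h) = t * D h"
proof -
  obtain a :: "complex^'n" where a: "(f has_derivative (\<lambda>h. \<Sum>i\<in>UNIV. a $ i * h $ i)) (at x)"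
    using assms unfolding holv_def by blast
  show ?thesis by (rule that[OF a]) (simp add: sum_distrib_left mult_ac)
qed

lemma holv_const: "holv (\<lambda>_. c) x"
  by (rule holvI[OF has_derivative_const]) simp

lemma holv_nth: "holv (\<lambda>x. x $ i) x"
  by (rule holvI[OF bounded_linear_imp_has_derivative[OF bounded_linear_vec_nth]]) simp

lemma holv_add: "holv f x \<Longrightarrow> holv g x \<Longrightarrow> holv (\<lambda>x. f x + g x) x"
  by (elim holvE, rule holvI[OF has_derivative_add]) (auto simp: algebra_simps)

lemma holv_minus: "holv f x \<Longrightarrow> holv (\<lambda>x. - f x) x"
  by (elim holvE, rule holvI[OF has_derivative_minus]) auto

lemma holv_diff: "holv f x \<Longrightarrow> holv g x \<Longrightarrow> holv (\<lambda>x. f x - g x) x"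
  using holv_add[of f x "\<lambda>x. - g x"] holv_minus[of g x] by simp

lemma holv_mult:
  assumes "holv f x" "holv g x" shows "holv (\<lambda>x. f x * g x) x"
proof -
  obtain D where D: "(f has_derivative D) (at x)" "\<And>t h. D (t *s h) = t * D h" using holvE[OF assms(1)] by blast
  obtain E where E: "(g has_derivative E) (at x)" "\<And>t h. E (t *s h) = t * E h" using holvE[OF assms(2)] by blast
  show ?thesis
    by (rule holvI[OF has_derivative_mult[OF D(1) E(1)]]) (simp add: D(2) E(2) algebra_simps)
qed

lemma holv_inverse: "holv f x \<Longrightarrow> f x \<noteq> 0 \<Longrightarrow> holv (\<lambda>x. inverse (f x)) x"
  by (elim holvE, rule holvI, erule (1) Deriv.has_derivative_inverse) auto

lemma holv_divide: "holv f x \<Longrightarrow> holv g x \<Longrightarrow> g x \<noteq> 0 \<Longrightarrow> holv (\<lambda>x. f x / g x) x"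
  unfolding divide_inverse by (intro holv_mult holv_inverse)

lemma holv_power: "holv f x \<Longrightarrow> holv (\<lambda>x. f x ^ n) x"
  by (induction n) (auto intro: holv_const holv_mult)

lemma holv_sum: "(\<And>i. i \<in> I \<Longrightarrow> holv (f i) x) \<Longrightarrow> holv (\<lambda>x. \<Sum>i\<in>I. f i x) x"
  by (induction I rule: infinite_finite_induct) (auto intro: holv_const holv_add)

lemmas holv_intros = holv_const holv_nth holv_add holv_minus holv_diff holv_mult holv_divide holv_power holv_sum

lemma holv_cong_open:
  assumes "holv f x" "open U" "x \<in> U" "\<And>y. y \<in> U \<Longrightarrow> f y = g y"
  shows "holv g x"
  using assms has_derivative_transform_within_open[of f _ x UNIV U g] unfolding holv_def by auto

lemma holv_isCont: "holv f x \<Longrightarrow> isCont f x"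
  by (elim holvE) (rule has_derivative_continuous)

lemma has_derivative_vecI:
  fixes G :: "'a::real_normed_vector \<Rightarrow> complex^'n"
  assumes "\<And>i. ((\<lambda>x. G x $ i) has_derivative D i) (at x)"
  shows "(G has_derivative (\<lambda>h. \<chi> i. D i h)) (at x)"
proof -
  have "((\<lambda>x. G x \<bullet> b) has_derivative (\<lambda>h. (\<chi> i. D i h) \<bullet> b)) (at x)" if b_mem: "b \<in> Basis" for b
  proof -
    obtain i u where b: "b = axis i u" using b_mem unfolding Basis_vec_def by auto
    show ?thesis unfolding b inner_axis
      using has_derivative_inner_left[OF assms[of i], of u] by simp
  qed
  then show ?thesis by (subst has_derivative_componentwise_within) blast
qed

lemma holv_compose:
  fixes f :: "complex^'n \<Rightarrow> complex" and G :: "complex^'m \<Rightarrow> complex^'n"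
  assumes f: "holv f (G x)" and G: "\<And>i. holv (\<lambda>x. G x $ i) x"
  shows "holv (\<lambda>x. f (G x)) x"
proof -
  obtain a where a: "(f has_derivative a) (at (G x))" "\<And>t h. a (t *s h) = t * a h" using holvE[OF f] by blast
  have "\<forall>i. \<exists>D. ((\<lambda>x. G x $ i) has_derivative D) (at x) \<and> (\<forall>t h. D (t *s h) = t * D h)"
    using holvE[OF G] by metis
  then obtain D where D: "\<And>i. ((\<lambda>x. G x $ i) has_derivative D i) (at x)" "\<And>i t h. D i (t *s h) = t * D i h"
    by metis
  have "((\<lambda>x. f (G x)) has_derivative (\<lambda>h. a (\<chi> i. D i h))) (at x)"
    by (rule has_derivative_compose[OF has_derivative_vecI[OF D(1)] a(1)])
  then show ?thesis
  proof (rule holvI)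
    fix t h
    have "(\<chi> i. D i (t *s h)) = t *s (\<chi> i. D i h)" by (simp add: vec_eq_iff D(2))
    then show "a (\<chi> i. D i (t *s h)) = t * a (\<chi> i. D i h)" by (simp add: a(2))
  qed
qed

lemma holv_curve:
  fixes f :: "complex^'n \<Rightarrow> complex" and \<gamma> :: "complex \<Rightarrow> complex^'n"
  assumes f: "holv f (\<gamma> t0)" and \<gamma>: "\<And>i. (\<lambda>t. \<gamma> t $ i) field_differentiable (at t0)"
  shows "(\<lambda>t. f (\<gamma> t)) field_differentiable (at t0)"
proof -
  obtain a where a: "(f has_derivative a) (at (\<gamma> t0))" "\<And>t h. a (t *s h) = t * a h" using holvE[OF f] by blast
  obtain v where v: "\<And>i. ((\<lambda>t. \<gamma> t $ i) has_derivative (\<lambda>h. v i * h)) (at t0)"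
    using \<gamma> unfolding field_differentiable_def has_field_derivative_def by metis
  have "((\<lambda>t. f (\<gamma> t)) has_derivative (\<lambda>h. a (\<chi> i. v i * h))) (at t0)"
    by (rule has_derivative_compose[OF has_derivative_vecI[OF v] a(1)])
  also have "(\<lambda>h. a (\<chi> i. v i * h)) = (\<lambda>h. a (\<chi> i. v i) * h)"
  proof
    fix h
    have "(\<chi> i. v i * h) = h *s (\<chi> i. v i)" by (simp add: vec_eq_iff)
    then show "a (\<chi> i. v i * h) = a (\<chi> i. v i) * h" by (simp add: a(2))
  qed
  finally show ?thesis unfolding field_differentiable_def has_field_derivative_def by blast
qed

lemma norm_vector_smult: "norm (t *s (h :: complex^'n)) = norm t * norm h"
  unfolding norm_vec_def by (simp add: norm_mult L2_set_right_distrib)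

text \<open>
  The Cauchy estimate on the complex line through \<open>x\<close> in direction \<open>h\<close>.
\<close>

lemma holv_derivative_le:
  fixes F :: "complex^'n \<Rightarrow> complex"
  assumes hol: "\<And>y. y \<in> ball x r \<Longrightarrow> holv F y" and r: "0 < r"
    and D: "(F has_derivative D) (at x)" "\<And>t h. D (t *s h) = t * D h"
    and B: "\<And>y. y \<in> ball x r \<Longrightarrow> norm (F y) \<le> B"
  shows "norm (D h) \<le> 2 * B / r * norm h"
proof (cases "h = 0")
  case True
  then show ?thesis using has_derivative_linear[OF D(1)] linear_0 by auto
next
  case False
  \<comment> \<open>Half of the radius at which the line leaves the ball, so that the closed disc stays inside.\<close>
  define \<rho> where "\<rho> = r / (2 * norm h)"
  have \<rho>: "0 < \<rho>" "\<rho> * norm h < r" using r False by (auto simp: \<rho>_def)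
  have mem: "x + t *s h \<in> ball x r" if "norm t \<le> \<rho>" for t
  proof -
    have "norm t * norm h \<le> \<rho> * norm h" using that by (intro mult_right_mono) auto
    then show ?thesis using \<rho>(2) by (simp add: dist_norm norm_vector_smult)
  qed
  have fd: "(\<lambda>t. F (x + t *s h)) field_differentiable (at t)" if "norm t \<le> \<rho>" for t
    by (rule holv_curve[where \<gamma> = "\<lambda>t. x + t *s h"])
       (auto intro!: hol mem that derivative_intros field_differentiable_add field_differentiable_mult simp: field_differentiable_const)
  have "norm ((deriv ^^ 1) (\<lambda>t. F (x + t *s h)) 0) \<le> fact 1 * B / \<rho> ^ 1"
  proof (rule Cauchy_inequality)
    show "(\<lambda>t. F (x + t *s h)) holomorphic_on ball 0 \<rho>"
      using fd by (auto simp: holomorphic_on_def intro: field_differentiable_at_within)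
    show "continuous_on (cball 0 \<rho>) (\<lambda>t. F (x + t *s h))"
      using fd by (auto intro!: continuous_at_imp_continuous_on field_differentiable_imp_continuous_at)
  qed (use \<rho> mem B in auto)
  moreover have "deriv (\<lambda>t. F (x + t *s h)) 0 = D h"
  proof (rule DERIV_imp_deriv)
    have "((\<lambda>t. x + t *s h) has_derivative (\<lambda>t. t *s h)) (at 0)"
    proof -
      have "((\<lambda>t. x + t *s h) has_derivative (\<lambda>t. \<chi> i. t * h $ i)) (at 0)"
        by (rule has_derivative_vecI) (auto intro!: derivative_eq_intros)
      moreover have "(\<lambda>t. \<chi> i. t * h $ i) = (\<lambda>t. t *s h)" by (simp add: vec_eq_iff fun_eq_iff)
      ultimately show ?thesis by simp
    qed
    moreover have "(\<lambda>t. D (t *s h)) = (*) (D h)" by (simp add: fun_eq_iff D(2) mult.commute)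
    ultimately show "((\<lambda>t. F (x + t *s h)) has_field_derivative D h) (at 0)"
      using has_derivative_compose[of "\<lambda>t. x + t *s h" "\<lambda>t. t *s h" 0 UNIV F D] D(1)
      by (simp add: has_field_derivative_def)
  qed
  ultimately show ?thesis using False by (simp add: \<rho>_def field_simps)
qed

text \<open>
  Weierstrass' theorem. By the Cauchy estimate the derivatives form a uniformly Cauchy sequence on a smaller ball;
  hence the limit is differentiable, and the limit of complex linear maps is complex linear.
\<close>

theorem holv_uniform_limit:
  fixes F :: "nat \<Rightarrow> complex^'n \<Rightarrow> complex"
  assumes hol: "\<And>N y. y \<in> ball x (2 * r) \<Longrightarrow> holv (F N) y" and r: "0 < r"
    and lim: "uniform_limit (ball x (2 * r)) F f sequentially"
  shows "holv f x"
proof -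
  have "\<forall>N y. \<exists>D. y \<in> ball x (2 * r) \<longrightarrow> (F N has_derivative D) (at y) \<and> (\<forall>t h. D (t *s h) = t * D h)"
    using holvE[OF hol] by metis
  then obtain D where D: "\<And>N y. y \<in> ball x (2 * r) \<Longrightarrow> (F N has_derivative D N y) (at y)"
      "\<And>N y t h. y \<in> ball x (2 * r) \<Longrightarrow> D N y (t *s h) = t * D N y h" by metis
  have sub: "ball y r \<subseteq> ball x (2 * r)" if "y \<in> ball x r" for y
    using that by (metis mem_ball ball_subset_ball_iff dist_commute less_imp_le add.commute add_le_cancel_right mult_2)
  have diff: "norm (D N y h - D M y h) \<le> 2 * B / r * norm h"
    if y: "y \<in> ball x r" and B: "\<And>z. z \<in> ball x (2 * r) \<Longrightarrow> norm (F N z - F M z) \<le> B" for N M y h B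
  proof (rule holv_derivative_le[where F = "\<lambda>z. F N z - F M z" and x = y and r = r])
    have y2: "y \<in> ball x (2 * r)" using y r by auto
    show "((\<lambda>z. F N z - F M z) has_derivative (\<lambda>h. D N y h - D M y h)) (at y)"
      by (intro has_derivative_diff D y2)
    show "D N y (t *s h) - D M y (t *s h) = t * (D N y h - D M y h)" for t h
      using D(2)[OF y2] by (simp add: algebra_simps)
    show "holv (\<lambda>z. F N z - F M z) z" if "z \<in> ball y r" for z
      using sub[OF y] that by (intro holv_diff hol) auto
    show "norm (F N z - F M z) \<le> B" if "z \<in> ball y r" for z
      using sub[OF y] that by (intro B) auto
  qed (rule r)
  have uc: "\<exists>K. \<forall>N\<ge>K. \<forall>M\<ge>K. \<forall>y\<in>ball x r. \<forall>h. norm (D N y h - D M y h) \<le> e * norm h" if e: "0 < e" for e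
  proof -
    have "e * r / 4 > 0" using e r by simp
    then obtain K where K: "\<And>N z. N \<ge> K \<Longrightarrow> z \<in> ball x (2 * r) \<Longrightarrow> dist (F N z) (f z) < e * r / 4"
      using lim unfolding uniform_limit_sequentially_iff by blast
    have "norm (D N y h - D M y h) \<le> e * norm h" if "N \<ge> K" "M \<ge> K" "y \<in> ball x r" for N M y h
    proof -
      have "norm (D N y h - D M y h) \<le> 2 * (e * r / 2) / r * norm h"
      proof (rule diff[OF that(3)])
        fix z assume z: "z \<in> ball x (2 * r)"
        show "norm (F N z - F M z) \<le> e * r / 2"
          using dist_triangle2[of "F N z" "F M z" "f z"] K[OF that(1) z] K[OF that(2) z] by (simp add: dist_norm)
      qed
      then show ?thesis using r by simp
    qed
    then show ?thesis by blast
  qed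
  have conv: "convergent (\<lambda>N. D N y h)" if y: "y \<in> ball x r" for y h
  proof (rule Cauchy_convergent, rule CauchyI)
    fix e :: real assume e: "0 < e"
    define e' where "e' = e / (2 * (norm h + 1))"
    have nh: "0 < norm h + 1" by (simp add: add_nonneg_pos)
    have e': "0 < e'" unfolding e'_def using e nh by simp
    obtain K where K: "\<forall>N\<ge>K. \<forall>M\<ge>K. \<forall>y\<in>ball x r. \<forall>h. norm (D N y h - D M y h) \<le> e' * norm h" using uc[OF e'] by blast
    have "e' * norm h \<le> e' * (norm h + 1)" using e' by (intro mult_left_mono) auto
    also have "e' * (norm h + 1) = e / 2"
    proof -
      have "norm h + 1 \<noteq> 0" using nh by linarith
      then show ?thesis unfolding e'_def by (simp add: divide_simps)
    qed
    finally have "e' * norm h < e" using e by linarith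
    then show "\<exists>K. \<forall>N\<ge>K. \<forall>M\<ge>K. norm (D N y h - D M y h) < e" using K y by (meson le_less_trans)
  qed
  define D' where "D' y h = lim (\<lambda>N. D N y h)" for y h
  have D'_lim: "(\<lambda>N. D N y h) \<longlonglongrightarrow> D' y h" if "y \<in> ball x r" for y h
    using conv[OF that] unfolding D'_def by (simp add: convergent_LIMSEQ_iff)
  have x: "x \<in> ball x r" "x \<in> ball x (2 * r)" using r by auto
  have "\<exists>g. \<forall>y\<in>ball x r. (\<lambda>N. F N y) \<longlonglongrightarrow> g y \<and> (g has_derivative D' y) (at y within ball x r)"
  proof (rule has_derivative_sequence[OF convex_ball _ _ x(1)])
    show "(F N has_derivative D N y) (at y within ball x r)" if "y \<in> ball x r" for N y
      using D(1)[of y N] that r by (auto intro: has_derivative_at_withinI)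
    show "\<forall>\<^sub>F N in sequentially. \<forall>y\<in>ball x r. \<forall>h. norm (D N y h - D' y h) \<le> e * norm h" if e: "0 < e" for e
    proof -
      obtain K where K: "\<forall>N\<ge>K. \<forall>M\<ge>K. \<forall>y\<in>ball x r. \<forall>h. norm (D N y h - D M y h) \<le> e * norm h" using uc[OF e] by blast
      have "norm (D N y h - D' y h) \<le> e * norm h" if "N \<ge> K" "y \<in> ball x r" for N y h
      proof (rule tendsto_upperbound)
        show "(\<lambda>M. norm (D N y h - D M y h)) \<longlonglongrightarrow> norm (D N y h - D' y h)"
          by (intro tendsto_intros D'_lim that)
        show "\<forall>\<^sub>F M in sequentially. norm (D N y h - D M y h) \<le> e * norm h"
          unfolding eventually_sequentially using K that by blast
      qed simp
      then show ?thesis unfolding eventually_sequentially by blast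
    qed
    show "(\<lambda>N. F N x) \<longlonglongrightarrow> f x" by (rule tendsto_uniform_limitI[OF lim x(2)])
  qed
  then obtain g where g: "\<And>y. y \<in> ball x r \<Longrightarrow> (\<lambda>N. F N y) \<longlonglongrightarrow> g y"
      "\<And>y. y \<in> ball x r \<Longrightarrow> (g has_derivative D' y) (at y within ball x r)" by blast
  have "(g has_derivative D' x) (at x)" using g(2)[OF x(1)] x(1) by (simp add: at_within_open[OF x(1) open_ball])
  moreover have "g y = f y" if "y \<in> ball x r" for y
    using LIMSEQ_unique[OF g(1)[OF that] tendsto_uniform_limitI[OF lim, of y]] that r by auto
  ultimately have "(f has_derivative D' x) (at x)"
    using has_derivative_transform_within_open[of g "D' x" x UNIV "ball x r" f] x(1) by auto
  then show ?thesis
  proof (rule holvI)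
    fix t h
    have "(\<lambda>N. t * D N x h) \<longlonglongrightarrow> t * D' x h" by (intro tendsto_intros D'_lim x)
    then have "(\<lambda>N. D N x (t *s h)) \<longlonglongrightarrow> t * D' x h" by (simp add: D(2)[OF x(2)])
    then show "D' x (t *s h) = t * D' x h" using D'_lim[OF x(1)] LIMSEQ_unique by blast
  qed
qed

lemma holv_md: "holv (md n k) x"
proof -
  have "holv (circ n) x"
    unfolding circ_def[abs_def] cA_def cB_def by (cases "n \<ge> 0") (auto intro!: holv_intros)
  moreover have "holv (\<lambda>z. jac m k (z $ 3)) x" for m
    unfolding jac_def by (intro holv_intros) auto
  ultimately show ?thesis unfolding md_def[abs_def] by (intro holv_mult)
qed

text \<open>
  The series converges locally uniformly on \<open>\<complex>\<^sup>3\<close> and not merely on the sphere, so its sum is a global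
  holomorphic extension.
\<close>

theorem holv_mode_series:
  assumes "rapid c" shows "holv (mode_series c) x"
proof (rule holv_uniform_limit[where r = 1])
  show "uniform_limit (ball x (2 * 1)) (\<lambda>N z. \<Sum>(n, k)\<in>upto_degree N. c n k * md n k z) (mode_series c) sequentially"
  proof (rule uniform_limit_on_subset[OF filterlim_uniform_limit_compose[OF mode_uniform_limit[OF assms, of "norm x + 2"] filterlim_upto_degree]])
    show "ball x (2 * 1) \<subseteq> cball 0 (norm x + 2)"
    proof
      fix y assume "y \<in> ball x (2 * 1)"
      then show "y \<in> cball 0 (norm x + 2)"
        using norm_triangle_ineq[of x "y - x"] by (simp add: dist_norm norm_minus_commute)
    qed
  qed
  show "holv (\<lambda>z. \<Sum>(n, k)\<in>upto_degree N. c n k * md n k z) y" for N y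
    unfolding case_prod_unfold by (intro holv_intros holv_md)
qed simp

section \<open>Holomorphic functions on the complex sphere\<close>

text \<open>
  A local extension is holomorphic along every holomorphic curve in the sphere, in particular along the two
  families of parameter curves.
\<close>

lemma hol_csphere_imp_sep_holomorphic:
  assumes f: "f \<in> hol_csphere"
  shows "sep_holomorphic f"
proof -
  have loc: "\<exists>U g. open U \<and> z \<in> U \<and> (\<forall>x\<in>U. holv g x) \<and> (\<forall>x\<in>U \<inter> csphere. f x = g x)" if "z \<in> csphere" for z
    using f that unfolding hol_csphere_def holomorphic_vec_on_iff by blast
  have curve: "(\<lambda>t. f (\<gamma> t)) field_differentiable (at t0)"
    if T: "open T" "t0 \<in> T" and mem: "\<And>t. t \<in> T \<Longrightarrow> \<gamma> t \<in> csphere" and cont: "continuous_on T \<gamma>"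
      and fd: "\<And>i. (\<lambda>t. \<gamma> t $ i) field_differentiable (at t0)" for \<gamma> :: "complex \<Rightarrow> complex^3" and T t0
  proof -
    obtain U g where U: "open U" "\<gamma> t0 \<in> U" "\<And>x. x \<in> U \<Longrightarrow> holv g x" "\<And>x. x \<in> U \<inter> csphere \<Longrightarrow> f x = g x"
      using loc[OF mem[OF T(2)]] by blast
    have op: "open (\<gamma> -` U \<inter> T)" using continuous_open_preimage[OF cont T(1) U(1)] by (simp add: Int_commute)
    have "(\<lambda>t. g (\<gamma> t)) field_differentiable (at t0)"
      by (rule holv_curve[OF U(3)[OF U(2)] fd])
    then obtain g' where "((\<lambda>t. g (\<gamma> t)) has_field_derivative g') (at t0)" unfolding field_differentiable_def by blast
    then have "((\<lambda>t. f (\<gamma> t)) has_field_derivative g') (at t0)"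
      by (rule has_field_derivative_transform_within_open[OF _ op]) (use T U mem in auto)
    then show ?thesis unfolding field_differentiable_def by blast
  qed
  show ?thesis unfolding sep_holomorphic_def
  proof (intro conjI allI impI)
    show "continuous_on csphere f"
      unfolding continuous_on_eq_continuous_within
    proof
      fix z assume z: "z \<in> csphere"
      obtain U g where U: "open U" "z \<in> U" "\<And>x. x \<in> U \<Longrightarrow> holv g x" "\<And>x. x \<in> U \<inter> csphere \<Longrightarrow> f x = g x"
        using loc[OF z] by blast
      have cg: "continuous (at z within csphere) g"
        using holv_isCont[OF U(3)[OF U(2)]] by (rule continuous_at_imp_continuous_at_within)
      obtain d where d: "0 < d" "ball z d \<subseteq> U" using U openE by blast
      show "continuous (at z within csphere) f"
        by (rule continuous_transform_within[OF cg d(1) z]) (use d U in \<open>auto simp: dist_commute subset_eq\<close>)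
    qed
    fix c
    show "(\<lambda>s. f (pt s ((1 - c\<^sup>2) / s) c)) holomorphic_on - {0}"
      unfolding holomorphic_on_def
    proof
      fix s :: complex assume s: "s \<in> - {0}"
      have "(\<lambda>s. f (pt s ((1 - c\<^sup>2) / s) c)) field_differentiable (at s)"
      proof (rule curve[where T = "- {0}"])
        show "(\<lambda>t. pt t ((1 - c\<^sup>2) / t) c $ i) field_differentiable at s" for i
          using exhaust_3[of i] s by (auto intro!: derivative_intros)
      qed (use s in \<open>auto intro!: continuous_intros\<close>)
      then show "(\<lambda>s. f (pt s ((1 - c\<^sup>2) / s) c)) field_differentiable (at s within - {0})"
        by (rule field_differentiable_at_within)
    qed
  next
    fix s :: complex assume s: "s \<noteq> 0"
    show "(\<lambda>c. f (pt s ((1 - c\<^sup>2) / s) c)) holomorphic_on UNIV"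
      unfolding holomorphic_on_def
    proof
      fix c
      show "(\<lambda>c. f (pt s ((1 - c\<^sup>2) / s) c)) field_differentiable (at c within UNIV)"
      proof (rule curve[where T = UNIV])
        show "(\<lambda>c. pt s ((1 - c\<^sup>2) / s) c $ i) field_differentiable at c" for i
          using exhaust_3[of i] s by (auto intro!: derivative_intros)
      qed (use s in \<open>auto intro!: continuous_intros\<close>)
    qed
  qed
qed

lemma mode_series_hol_csphere:
  assumes "rapid c" "\<And>z. z \<in> csphere \<Longrightarrow> f z = mode_series c z" "\<And>z. z \<notin> csphere \<Longrightarrow> f z = 0"
  shows "f \<in> hol_csphere"
  unfolding hol_csphere_def
proof (safe)
  fix z :: "complex^3"
  show "\<exists>U g. open U \<and> z \<in> U \<and> holomorphic_vec_on g U \<and> (\<forall>x\<in>U \<inter> csphere. f x = g x)"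
    using holv_mode_series[OF assms(1)] assms(2)
    by (intro exI[of _ UNIV] exI[of _ "mode_series c"]) (auto simp: holomorphic_vec_on_iff)
qed (use assms(3) in auto)

section \<open>The biholomorphism between \<open>\<Omega>\<close> and the complex sphere\<close>

lemma Omega_Fin_Fin: "(Fin z, Fin w) \<in> Omega \<longleftrightarrow> 1 - z * w \<noteq> 0"
  and Omega_recip_Fin: "(rs_recip z, Fin w) \<in> Omega \<longleftrightarrow> z - w \<noteq> 0"
  and Omega_Fin_recip: "(Fin z, rs_recip w) \<in> Omega \<longleftrightarrow> w - z \<noteq> 0"
  and Omega_recip_recip: "(rs_recip z, rs_recip w) \<in> Omega \<longleftrightarrow> z * w - 1 \<noteq> 0"
  by (auto simp: Omega_def rs_recip_def divide_simps)

text \<open>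
  The inverse of \<open>S\<^sup>-\<^sup>1\<close>. At the points with a coordinate \<open>\<infinity>\<close> the values are the limits of the first formula, which is
  what the three lemmas for the other charts express.
\<close>

fun S_map :: "riemann_sphere \<times> riemann_sphere \<Rightarrow> complex^3" where
  "S_map (Fin z, Fin w) = pt (2 * z / (1 - z * w)) (- (2 * w) / (1 - z * w)) (- (1 + z * w) / (1 - z * w))"
| "S_map (Infty, Fin w) = pt (- 2 / w) 0 1"
| "S_map (Fin z, Infty) = pt 0 (2 / z) 1"
| "S_map (Infty, Infty) = pt 0 0 1"

lemma S_map_recip_Fin:
  assumes "u - w \<noteq> 0"
  shows "S_map (rs_recip u, Fin w) = pt (2 / (u - w)) (- (2 * u * w) / (u - w)) (- (u + w) / (u - w))"
proof (cases "u = 0")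
  case True
  then show ?thesis using assms by (simp add: rs_recip_def)
next
  case False
  have D: "1 - 1 / u * w = (u - w) / u" "1 + 1 / u * w = (u + w) / u" using False by (simp_all add: field_simps)
  have "2 * (1 / u) / (1 - 1 / u * w) = 2 / (u - w)" "- (2 * w) / (1 - 1 / u * w) = - (2 * u * w) / (u - w)"
    "- (1 + 1 / u * w) / (1 - 1 / u * w) = - (u + w) / (u - w)"
    unfolding D using False assms by (simp_all add: divide_simps)
  then show ?thesis using False by (simp only: rs_recip_def if_False S_map.simps)
qed

lemma S_map_Fin_recip:
  assumes "v - z \<noteq> 0"
  shows "S_map (Fin z, rs_recip v) = pt (2 * z * v / (v - z)) (- 2 / (v - z)) (- (v + z) / (v - z))"
proof (cases "v = 0")
  case True
  then show ?thesis using assms by (simp add: rs_recip_def divide_simps)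
next
  case False
  have D: "1 - z * (1 / v) = (v - z) / v" "1 + z * (1 / v) = (v + z) / v" using False by (simp_all add: field_simps)
  have "2 * z / (1 - z * (1 / v)) = 2 * z * v / (v - z)" "- (2 * (1 / v)) / (1 - z * (1 / v)) = - 2 / (v - z)"
    "- (1 + z * (1 / v)) / (1 - z * (1 / v)) = - (v + z) / (v - z)"
    unfolding D using False assms by (simp_all add: divide_simps)
  then show ?thesis using False by (simp only: rs_recip_def if_False S_map.simps)
qed

lemma S_map_recip_recip:
  assumes "u * v - 1 \<noteq> 0"
  shows "S_map (rs_recip u, rs_recip v) = pt (2 * v / (u * v - 1)) (- (2 * u) / (u * v - 1)) (- (u * v + 1) / (u * v - 1))"
proof -
  consider "u = 0" "v = 0" | "u = 0" "v \<noteq> 0" | "u \<noteq> 0" "v = 0" | "u \<noteq> 0" "v \<noteq> 0" by blast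
  then show ?thesis
  proof cases
    case 4
    have D: "1 - 1 / u * (1 / v) = (u * v - 1) / (u * v)" "1 + 1 / u * (1 / v) = (u * v + 1) / (u * v)"
      using 4 by (simp_all add: field_simps)
    have "2 * (1 / u) / (1 - 1 / u * (1 / v)) = 2 * v / (u * v - 1)"
      "- (2 * (1 / v)) / (1 - 1 / u * (1 / v)) = - (2 * u) / (u * v - 1)"
      "- (1 + 1 / u * (1 / v)) / (1 - 1 / u * (1 / v)) = - (u * v + 1) / (u * v - 1)"
      unfolding D using 4 assms by (simp_all add: divide_simps)
    then show ?thesis using 4 by (simp only: rs_recip_def if_False S_map.simps)
  qed (simp_all add: rs_recip_def)
qed

text \<open>
  Valid wherever \<open>a \<noteq> 0\<close>, including the points with \<open>c = \<plusminus>1\<close>, so that one chart of \<open>\<Omega>\<close> serves for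
  all parameter curves of \<open>sep_holomorphic\<close>.
\<close>

lemma S_inv_pt_chart_a:
  assumes "a \<noteq> 0" "a * b = 1 - c\<^sup>2"
  shows "S_inv (pt a b c) = (rs_recip ((1 - c) / a), Fin (- (1 + c) / a))"
proof (cases "c = 1")
  case True
  then have "b = 0" using assms by simp
  moreover have "a / (2 * \<i>) \<noteq> \<i> * (a / 2)" using assms(1) by (simp add: field_simps)
  ultimately show ?thesis using assms True
    by (auto simp: S_inv_def rs_recip_def field_simps)
next
  case False
  have b: "b = (1 - c) * (1 + c) / a" using assms by (simp add: field_simps power2_eq_square)
  have 1: "(a + b) / 2 + \<i> * ((a - b) / (2 * \<i>)) = a" "(a + b) / 2 - \<i> * ((a - b) / (2 * \<i>)) = b"
    by (simp_all add: field_simps)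
  have "1 - c \<noteq> 0" using False by simp
  then show ?thesis using assms(1) False
    unfolding S_inv_def pt_nth 1 by (simp add: rs_recip_def b) (simp add: field_simps)
qed

lemma S_inv_pt_chart_north:
  assumes "c \<noteq> 1"
  shows "S_inv (pt a b c) = (Fin (a / (1 - c)), Fin (- (b / (1 - c))))"
proof -
  have 1: "(a + b) / 2 + \<i> * ((a - b) / (2 * \<i>)) = a" "(a + b) / 2 - \<i> * ((a - b) / (2 * \<i>)) = b"
    by (simp_all add: field_simps)
  show ?thesis unfolding S_inv_def pt_nth 1 using assms by simp
qed

lemma S_inv_pt_chart_south:
  assumes c: "c \<noteq> -1" and ab: "a * b = 1 - c\<^sup>2"
  shows "S_inv (pt a b c) = (rs_recip (b / (1 + c)), rs_recip (- a / (1 + c)))"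
proof (cases "a = 0")
  case False
  have b: "b = (1 - c) * (1 + c) / a" using ab False by (simp add: field_simps power2_eq_square)
  have nz: "1 + c \<noteq> 0" using c by (simp add: add_eq_0_iff)
  have "b / (1 + c) = (1 - c) / a" unfolding b using nz by simp
  moreover have "rs_recip (- a / (1 + c)) = Fin (- (1 + c) / a)"
    using nz False by (simp add: rs_recip_def) (simp add: field_simps)
  ultimately show ?thesis using S_inv_pt_chart_a[OF False ab] by simp
next
  case True
  have "(1 - c) * (1 + c) = 0" using ab True by (simp add: power2_eq_square algebra_simps)
  moreover have "1 + c \<noteq> 0" using c by (simp add: add_eq_0_iff)
  ultimately have "c = 1" by simp
  then show ?thesis using True by (simp add: S_inv_def rs_recip_def)
qed

lemma csphere_cases_chart:
  assumes "z \<in> csphere"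
  obtains a b c where "z = pt a b c" "a * b = 1 - c\<^sup>2"
  using assms that[of "cA z" "cB z" "z $ 3"] by (simp add: csphere_iff)

lemma S_inv_in_Omega:
  assumes "z \<in> csphere" shows "S_inv z \<in> Omega" and "S_map (S_inv z) = z"
proof -
  obtain a b c where z: "z = pt a b c" and ab: "a * b = 1 - c\<^sup>2" by (rule csphere_cases_chart[OF assms])
  have "S_inv z \<in> Omega \<and> S_map (S_inv z) = z"
  proof (cases "c = 1")
    case False
    then have nz: "1 - c \<noteq> 0" by simp
    have "a / (1 - c) * (- (b / (1 - c))) = - (a * b) / ((1 - c) * (1 - c))" by simp
    also have "\<dots> = - (1 + c) / (1 - c)" unfolding ab using nz by (simp add: divide_simps power2_eq_square) (simp add: algebra_simps)
    finally have zw: "a / (1 - c) * (- (b / (1 - c))) = - (1 + c) / (1 - c)" .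
    have D: "1 - a / (1 - c) * (- (b / (1 - c))) = 2 / (1 - c)" unfolding zw using nz by (simp add: divide_simps)
    have e: "1 + a / (1 - c) * (- (b / (1 - c))) = - 2 * c / (1 - c)" unfolding zw using nz by (simp add: divide_simps)
    show ?thesis unfolding z S_inv_pt_chart_north[OF False] Omega_Fin_Fin S_map.simps D e using nz by simp
  next
    case True
    then have c: "c \<noteq> -1" "1 + c \<noteq> 0" by auto
    have ab0: "a * b = 0" using ab True by simp
    have D: "b / (1 + c) * (- a / (1 + c)) = 0" using ab0 by auto
    have nz: "b / (1 + c) * (- a / (1 + c)) - 1 \<noteq> 0" unfolding D by simp
    have "S_map (rs_recip (b / (1 + c)), rs_recip (- a / (1 + c))) = pt a b c"
      unfolding S_map_recip_recip[OF nz] D using True by simp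
    then show ?thesis unfolding z S_inv_pt_chart_south[OF c(1) ab] Omega_recip_recip using nz by blast
  qed
  then show "S_inv z \<in> Omega" "S_map (S_inv z) = z" by auto
qed

lemma S_map_in_csphere:
  assumes "p \<in> Omega" shows "S_map p \<in> csphere" and "S_inv (S_map p) = p"
proof -
  obtain x y where p: "p = (x, y)" by fastforce
  have "S_map p \<in> csphere \<and> S_inv (S_map p) = p"
  proof (cases x; cases y)
    fix z w assume xy: "x = Fin z" "y = Fin w"
    have nz: "1 - z * w \<noteq> 0" using assms unfolding p xy Omega_Fin_Fin .
    define D where "D = 1 - z * w"
    have t: "z * w = 1 - D" and D: "D \<noteq> 0" using nz by (simp_all add: D_def)
    have c: "1 - - (1 + z * w) / (1 - z * w) = 2 / D" unfolding t using D by (simp add: field_simps)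
    have c1: "- (1 + z * w) / (1 - z * w) \<noteq> 1"
    proof
      assume "- (1 + z * w) / (1 - z * w) = 1"
      with c have "2 / D = 0" by simp
      then show False using D by simp
    qed
    have "2 * z / (1 - z * w) * (- (2 * w) / (1 - z * w)) = - 4 * (z * w) / (D * D)" by (simp add: D_def)
    also have "\<dots> = 1 - (- (1 + z * w) / (1 - z * w))\<^sup>2"
      unfolding t using D by (simp add: power2_eq_square divide_simps) (simp add: algebra_simps)
    finally have "S_map p \<in> csphere" unfolding p xy S_map.simps pt_in_csphere .
    moreover have "S_inv (S_map p) = p"
      unfolding p xy S_map.simps S_inv_pt_chart_north[OF c1] c using D by (simp add: D_def)
    ultimately show ?thesis by simp
  next
    fix z assume xy: "x = Fin z" "y = Infty"
    have z: "z \<noteq> 0" using assms by (auto simp: p xy Omega_def)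
    have "S_inv (pt 0 (2 / z) 1) = (rs_recip (2 / z / (1 + 1)), rs_recip (- 0 / (1 + 1)))"
      by (rule S_inv_pt_chart_south) auto
    then show ?thesis using z by (simp add: p xy rs_recip_def)
  next
    fix w assume xy: "x = Infty" "y = Fin w"
    have w: "w \<noteq> 0" using assms by (auto simp: p xy Omega_def)
    have "S_inv (pt (- 2 / w) 0 1) = (rs_recip ((1 - 1) / (- 2 / w)), Fin (- (1 + 1) / (- 2 / w)))"
      by (rule S_inv_pt_chart_a) (use w in auto)
    then show ?thesis using w by (simp add: p xy rs_recip_def)
  next
    assume xy: "x = Infty" "y = Infty"
    have "S_inv (pt 0 0 1) = (rs_recip (0 / (1 + 1)), rs_recip (- 0 / (1 + 1)))"
      by (rule S_inv_pt_chart_south) auto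
    then show ?thesis by (simp add: p xy rs_recip_def)
  qed
  then show "S_map p \<in> csphere" "S_inv (S_map p) = p" by auto
qed

definition lift :: "(complex^3 \<Rightarrow> complex) \<Rightarrow> riemann_sphere \<times> riemann_sphere \<Rightarrow> complex" where
  "lift G p = (if p \<in> Omega then G (S_map p) else 0)"

lemma pullback_S_lift: "z \<in> csphere \<Longrightarrow> pullback_S (lift G) z = G z"
  by (simp add: pullback_S_def lift_def S_inv_in_Omega)

lemma holv_pt:
  assumes "holv a x" "holv b x" "holv c x"
  shows "holv (\<lambda>x. pt (a x) (b x) (c x) $ i) x"
proof -
  have "holv (\<lambda>x. (a x + b x) / 2) x" "holv (\<lambda>x. (a x - b x) / (2 * \<i>)) x"
    using assms by (auto intro!: holv_intros)
  then show ?thesis using exhaust_3[of i] assms(3) by auto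
qed

text \<open>
  All four charts have the same shape: the domain is the nonvanishing set of a polynomial \<open>q\<close>, and \<open>S\<close> is
  given there by rational functions with denominator \<open>q\<close>.
\<close>

lemma lift_chart:
  fixes q :: "complex^2 \<Rightarrow> complex"
  assumes G: "\<And>y. holv G y"
    and dom: "\<And>x :: complex^2. (\<phi> (x $ 1), \<psi> (x $ 2)) \<in> Omega \<longleftrightarrow> q x \<noteq> 0"
    and S: "\<And>x :: complex^2. q x \<noteq> 0 \<Longrightarrow> S_map (\<phi> (x $ 1), \<psi> (x $ 2)) = pt (a x) (b x) (c x)"
    and q: "continuous_on UNIV q"
    and abc: "\<And>x. q x \<noteq> 0 \<Longrightarrow> holv a x" "\<And>x. q x \<noteq> 0 \<Longrightarrow> holv b x" "\<And>x. q x \<noteq> 0 \<Longrightarrow> holv c x"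
  shows "holomorphic_vec_on (\<lambda>x :: complex^2. lift G (\<phi> (x $ 1), \<psi> (x $ 2))) {x. (\<phi> (x $ 1), \<psi> (x $ 2)) \<in> Omega}"
  unfolding holomorphic_vec_on_iff dom
proof
  fix x assume "x \<in> {x. q x \<noteq> 0}"
  then have x: "q x \<noteq> 0" by simp
  have "holv (\<lambda>x. G (pt (a x) (b x) (c x))) x"
    by (rule holv_compose[OF G holv_pt]) (use abc x in auto)
  moreover have "open {x. q x \<noteq> 0}" by (rule open_Collect_neq[OF q continuous_on_const])
  ultimately show "holv (\<lambda>x :: complex^2. lift G (\<phi> (x $ 1), \<psi> (x $ 2))) x"
    by (rule holv_cong_open) (use x dom S in \<open>auto simp: lift_def\<close>)
qed

lemma lift_hol_Omega:
  assumes G: "\<And>y. holv G y" shows "lift G \<in> hol_Omega"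
proof -
  have 1: "holomorphic_vec_on (\<lambda>x::complex^2. lift G (Fin (x $ 1), Fin (x $ 2))) {x. (Fin (x $ 1), Fin (x $ 2)) \<in> Omega}"
    by (rule lift_chart[OF G Omega_Fin_Fin S_map.simps(1)]) (auto intro!: holv_intros continuous_intros)
  have 2: "holomorphic_vec_on (\<lambda>x::complex^2. lift G (rs_recip (x $ 1), Fin (x $ 2))) {x. (rs_recip (x $ 1), Fin (x $ 2)) \<in> Omega}"
    by (rule lift_chart[OF G Omega_recip_Fin S_map_recip_Fin]) (auto intro!: holv_intros continuous_intros)
  have 3: "holomorphic_vec_on (\<lambda>x::complex^2. lift G (Fin (x $ 1), rs_recip (x $ 2))) {x. (Fin (x $ 1), rs_recip (x $ 2)) \<in> Omega}"
    by (rule lift_chart[OF G Omega_Fin_recip S_map_Fin_recip]) (auto intro!: holv_intros continuous_intros)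
  have 4: "holomorphic_vec_on (\<lambda>x::complex^2. lift G (rs_recip (x $ 1), rs_recip (x $ 2))) {x. (rs_recip (x $ 1), rs_recip (x $ 2)) \<in> Omega}"
    by (rule lift_chart[OF G Omega_recip_recip S_map_recip_recip]) (auto intro!: holv_intros continuous_intros)
  show ?thesis unfolding hol_Omega_def using 1 2 3 4 by (simp add: lift_def)
qed

definition v2 :: "complex \<Rightarrow> complex \<Rightarrow> complex^2" where "v2 a b = (\<chi> i. if i = 1 then a else b)"

lemma v2_nth [simp]: "v2 a b $ 1 = a" "v2 a b $ 2 = b" by (simp_all add: v2_def)

lemma tendsto_v2:
  assumes "(f \<longlongrightarrow> a) F" "(g \<longlongrightarrow> b) F"
  shows "((\<lambda>x. v2 (f x) (g x)) \<longlongrightarrow> v2 a b) F"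
  by (rule vec_tendstoI) (use assms in \<open>auto simp: v2_def\<close>)

lemma hol_Omega_chart:
  assumes F: "F \<in> hol_Omega" and "\<phi> \<in> {Fin, rs_recip}" "\<psi> \<in> {Fin, rs_recip}" "(\<phi> u, \<psi> w) \<in> Omega"
  shows "holv (\<lambda>x :: complex^2. F (\<phi> (x $ 1), \<psi> (x $ 2))) (v2 u w)"
  using assms unfolding hol_Omega_def holomorphic_vec_on_iff by auto

text \<open>
  The finite chart covers the part \<open>z\<^sub>3 \<noteq> 1\<close> of the sphere and the chart with both coordinates inverted the part
  \<open>z\<^sub>3 \<noteq> -1\<close>, which settles continuity. Holomorphy in the parameters is seen in the single chart of \<open>S_inv_pt_chart_a\<close>.
\<close>

lemma hol_Omega_imp_sep_holomorphic:
  assumes F: "F \<in> hol_Omega" shows "sep_holomorphic (pullback_S F)"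
proof -
  have eq: "pullback_S F (pt s ((1 - c\<^sup>2) / s) c) = F (rs_recip ((1 - c) / s), Fin (- (1 + c) / s))" if "s \<noteq> 0" for s c
  proof -
    have "s * ((1 - c\<^sup>2) / s) = 1 - c\<^sup>2" using that by simp
    from S_inv_pt_chart_a[OF that this] this show ?thesis
      unfolding pullback_S_def pt_in_csphere by (simp only: if_True simp_thms)
  qed
  have fd: "(\<lambda>t. F (rs_recip (u t), Fin (w t))) field_differentiable (at t0)"
    if "u field_differentiable (at t0)" "w field_differentiable (at t0)" "u t0 - w t0 \<noteq> 0" for u w t0
  proof -
    have "(\<lambda>t. (\<lambda>x. F (rs_recip (x $ 1), Fin (x $ 2))) (v2 (u t) (w t))) field_differentiable (at t0)"
    proof (rule holv_curve[OF hol_Omega_chart[OF F]])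
      show "(\<lambda>t. v2 (u t) (w t) $ i) field_differentiable at t0" for i
        using exhaust_2[of i] that by auto
    qed (use that Omega_recip_Fin in auto)
    then show ?thesis by simp
  qed
  have nz: "(1 - c) / s - (- (1 + c) / s) \<noteq> 0" if "s \<noteq> 0" for s c :: complex
    using that by (simp add: field_simps)
  have lim: "continuous (at z within csphere) (pullback_S F)"
    if z: "z \<in> csphere" and U: "open U" "z \<in> U"
      and eq: "\<And>y. y \<in> csphere \<Longrightarrow> y \<in> U \<Longrightarrow> S_inv y = (\<phi> (f y), \<psi> (g y))"
      and cont: "(f \<longlongrightarrow> f z) (at z within csphere)" "(g \<longlongrightarrow> g z) (at z within csphere)"
      and charts: "\<phi> \<in> {Fin, rs_recip}" "\<psi> \<in> {Fin, rs_recip}" for z U \<phi> \<psi> f g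
  proof -
    have "(\<phi> (f z), \<psi> (g z)) \<in> Omega" using S_inv_in_Omega(1)[OF z] eq[OF z U(2)] by simp
    from holv_isCont[OF hol_Omega_chart[OF F charts this]] tendsto_v2[OF cont]
    have "((\<lambda>y. F (\<phi> (v2 (f y) (g y) $ 1), \<psi> (v2 (f y) (g y) $ 2))) \<longlongrightarrow> F (\<phi> (v2 (f z) (g z) $ 1), \<psi> (v2 (f z) (g z) $ 2))) (at z within csphere)"
      by (rule isCont_tendsto_compose)
    then have "((\<lambda>y. F (\<phi> (f y), \<psi> (g y))) \<longlongrightarrow> pullback_S F z) (at z within csphere)"
      using eq[OF z U(2)] z by (simp add: pullback_S_def)
    moreover have "\<forall>\<^sub>F y in at z within csphere. F (\<phi> (f y), \<psi> (g y)) = pullback_S F y"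
      unfolding eventually_at_topological
      using U eq by (intro exI[of _ U]) (auto simp: pullback_S_def)
    ultimately show ?thesis unfolding continuous_within by (rule Lim_transform_eventually)
  qed
  have tA: "(cA \<longlongrightarrow> cA z) (at z within csphere)" and tB: "(cB \<longlongrightarrow> cB z) (at z within csphere)"
    and t3: "((\<lambda>y. y $ 3) \<longlongrightarrow> z $ 3) (at z within csphere)" for z
    using continuous_on_cA[of UNIV] continuous_on_cB[of UNIV]
    by (auto simp: continuous_on_eq_continuous_at continuous_at_imp_continuous_at_within continuous_within[symmetric]
        intro!: tendsto_intros)
  show ?thesis unfolding sep_holomorphic_def
  proof (intro conjI allI impI)
    show "continuous_on csphere (pullback_S F)"
      unfolding continuous_on_eq_continuous_within
    proof
      fix z assume z: "z \<in> csphere"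
      show "continuous (at z within csphere) (pullback_S F)"
      proof (cases "z $ 3 = 1")
        case False
        show ?thesis
        proof (rule lim[OF z, of "{y :: complex^3. y $ 3 \<noteq> 1}" Fin "\<lambda>y. cA y / (1 - y $ 3)" Fin "\<lambda>y. - (cB y / (1 - y $ 3))"])
          show "open {y :: complex^3. y $ 3 \<noteq> 1}" by (intro open_Collect_neq continuous_intros)
          show "S_inv y = (Fin (cA y / (1 - y $ 3)), Fin (- (cB y / (1 - y $ 3))))" if "y \<in> csphere" "y \<in> {y :: complex^3. y $ 3 \<noteq> 1}" for y :: "complex^3"
            using S_inv_pt_chart_north[of "y $ 3" "cA y" "cB y"] that by simp
        qed (use False in \<open>auto intro!: tendsto_intros tA tB t3\<close>)
      next
        case True
        show ?thesis
        proof (rule lim[OF z, of "{y :: complex^3. y $ 3 \<noteq> -1}" rs_recip "\<lambda>y. cB y / (1 + y $ 3)" rs_recip "\<lambda>y. - cA y / (1 + y $ 3)"])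
          show "open {y :: complex^3. y $ 3 \<noteq> -1}" by (intro open_Collect_neq continuous_intros)
          show "S_inv y = (rs_recip (cB y / (1 + y $ 3)), rs_recip (- cA y / (1 + y $ 3)))" if "y \<in> csphere" "y \<in> {y :: complex^3. y $ 3 \<noteq> -1}" for y :: "complex^3"
            using S_inv_pt_chart_south[of "y $ 3" "cA y" "cB y"] that by (simp add: csphere_iff)
          show "((\<lambda>y. cB y / (1 + y $ 3)) \<longlongrightarrow> cB z / (1 + z $ 3)) (at z within csphere)"
            "((\<lambda>y. - cA y / (1 + y $ 3)) \<longlongrightarrow> - cA z / (1 + z $ 3)) (at z within csphere)"
            by (intro tendsto_intros tA tB t3, simp add: True)+
        qed (use True in auto)
      qed
    qed
    fix c
    show "(\<lambda>s. pullback_S F (pt s ((1 - c\<^sup>2) / s) c)) holomorphic_on - {0}"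
    proof (rule holomorphic_transform[of "\<lambda>s. F (rs_recip ((1 - c) / s), Fin (- (1 + c) / s))"])
      show "(\<lambda>s. F (rs_recip ((1 - c) / s), Fin (- (1 + c) / s))) holomorphic_on - {0}"
        unfolding holomorphic_on_def
      proof
        fix s :: complex assume s: "s \<in> - {0}"
        have quot: "(\<lambda>s. k / s) field_differentiable at s" for k
        proof -
          have "(\<lambda>s. k * inverse s) field_differentiable at s" using s
            by (intro field_differentiable_mult field_differentiable_const field_differentiable_inverse field_differentiable_ident) simp
          moreover have "(\<lambda>s. k * inverse s) = (\<lambda>s. k / s)" by (simp add: fun_eq_iff divide_inverse)
          ultimately show ?thesis by (simp only:)
        qed
        show "(\<lambda>s. F (rs_recip ((1 - c) / s), Fin (- (1 + c) / s))) field_differentiable at s within - {0}"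
          by (rule field_differentiable_at_within, rule fd[OF quot quot nz]) (use s in simp)
      qed
    qed (use eq in auto)
  next
    fix s :: complex assume s: "s \<noteq> 0"
    show "(\<lambda>c. pullback_S F (pt s ((1 - c\<^sup>2) / s) c)) holomorphic_on UNIV"
      unfolding eq[OF s] holomorphic_on_def
    proof
      fix c
      have lin: "(\<lambda>c. (k + l * c) / s) field_differentiable at c" for k l
        unfolding divide_inverse
        by (intro field_differentiable_mult field_differentiable_add field_differentiable_const field_differentiable_ident)
      have "(\<lambda>c. (1 - c) / s) field_differentiable at c" "(\<lambda>c. - (1 + c) / s) field_differentiable at c"
        using lin[of 1 "-1"] lin[of "-1" "-1"] by simp_all
      then show "(\<lambda>c. F (rs_recip ((1 - c) / s), Fin (- (1 + c) / s))) field_differentiable at c within UNIV"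
        by (intro fd nz s)
    qed
  qed
qed

lemma hol_Omega_outside: "F \<in> hol_Omega \<Longrightarrow> p \<notin> Omega \<Longrightarrow> F p = 0"
  by (cases p) (simp add: hol_Omega_def)

text \<open>
  Pulled back to the sphere both functions are continuous, and they agree at all points with \<open>z\<^sub>3 \<noteq> 1\<close>, which are dense.
\<close>

lemma hol_Omega_eqI:
  assumes F: "F \<in> hol_Omega" and G: "G \<in> hol_Omega"
    and eq: "\<And>z w. z * w \<noteq> 1 \<Longrightarrow> F (Fin z, Fin w) = G (Fin z, Fin w)"
  shows "F = G"
proof
  fix p
  show "F p = G p"
  proof (cases "p \<in> Omega")
    case False
    then show ?thesis using hol_Omega_outside[OF F] hol_Omega_outside[OF G] by simp
  next
    case True
    have "pullback_S F (S_map p) = pullback_S G (S_map p)"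
    proof (rule continuous_eq_on_csphere)
      show "continuous_on csphere (pullback_S F)" "continuous_on csphere (pullback_S G)"
        using hol_Omega_imp_sep_holomorphic[OF F] hol_Omega_imp_sep_holomorphic[OF G] by (auto simp: sep_holomorphic_def)
      show "S_map p \<in> csphere" using S_map_in_csphere(1)[OF True] .
      fix z :: "complex^3" assume z: "z \<in> csphere" "z $ 3 \<noteq> 1"
      have S: "S_inv z = (Fin (cA z / (1 - z $ 3)), Fin (- (cB z / (1 - z $ 3))))"
        using S_inv_pt_chart_north[OF z(2), of "cA z" "cB z"] by simp
      have "1 - cA z / (1 - z $ 3) * (- (cB z / (1 - z $ 3))) \<noteq> 0"
        using S_inv_in_Omega(1)[OF z(1)] unfolding S Omega_Fin_Fin .
      then have "cA z / (1 - z $ 3) * (- (cB z / (1 - z $ 3))) \<noteq> 1"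
        unfolding right_minus_eq by (rule not_sym)
      then show "pullback_S F z = pullback_S G z" using z(1) S eq by (simp add: pullback_S_def)
    qed
    then show ?thesis using S_map_in_csphere[OF True] by (simp add: pullback_S_def)
  qed
qed

lemma hol_ext_eqI:
  assumes "F \<in> hol_Omega" "\<And>z w. z * w \<noteq> 1 \<Longrightarrow> F (Fin z, Fin w) = g z w"
  shows "hol_ext g = F"
  unfolding hol_ext_def
  by (rule the_equality) (use assms in \<open>auto intro!: hol_Omega_eqI\<close>)

lemma hol_Omega_mode_expansion:
  assumes F: "F \<in> hol_Omega"
  obtains c where "rapid c" "F = lift (mode_series c)" "\<And>z. z \<in> csphere \<Longrightarrow> pullback_S F z = mode_series c z"
proof -
  obtain c where c: "rapid c" "\<And>z. z \<in> csphere \<Longrightarrow> pullback_S F z = mode_series c z"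
    using sep_holomorphic_mode_expansion[OF hol_Omega_imp_sep_holomorphic[OF F]] by blast
  have "F p = lift (mode_series c) p" for p
  proof (cases "p \<in> Omega")
    case True
    then show ?thesis
      using c(2)[OF S_map_in_csphere(1)[OF True]] S_map_in_csphere[OF True] by (simp add: lift_def pullback_S_def)
  next
    case False
    then show ?thesis using hol_Omega_outside[OF F] by (simp add: lift_def)
  qed
  then show ?thesis using that c by blast
qed

section \<open>The Poisson modes\<close>

lemma pochhammer_neg_of_nat: "pochhammer (- of_nat N) k = ((-1) ^ k * fact k * of_nat (N choose k) :: complex)"
proof -
  have "of_nat (N choose k) = ((-1) ^ k * pochhammer (- of_nat N) k / fact k :: complex)"
    by (simp add: binomial_gbinomial gbinomial_pochhammer)
  then have "(-1) ^ k * fact k * of_nat (N choose k) = ((-1) ^ k * (-1) ^ k) * (pochhammer (- of_nat N) k :: complex)"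
    by simp
  also have "(-1) ^ k * (-1) ^ k = (1 :: complex)" by (simp flip: power_mult_distrib)
  finally show ?thesis by simp
qed

lemma pochhammer_of_nat_Suc: "pochhammer (of_nat n + 1) k = (fact (n + k) / fact n :: complex)"
proof (induction k)
  case (Suc k)
  show ?case unfolding pochhammer_Suc Suc.IH by (simp add: algebra_simps add_divide_distrib)
qed simp

text \<open>
  The parameter \<open>|n| - m\<close> terminates the hypergeometric series, and the Pochhammer symbols of negative integers are
  binomial coefficients.
\<close>

lemma choose_mult_hyp2F1:
  assumes "n \<le> m"
  shows "of_nat (m choose n) * hyp2F1 (- of_nat m) (of_int (int n - int m)) (of_int (int n + 1)) t
     = (\<Sum>k\<le>m - n. of_nat (m choose k) * of_nat (m choose (k + n)) * t ^ k)"
proof -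
  have a: "of_int (int n - int m) = (- of_nat (m - n) :: complex)" "of_int (int n + 1) = (of_nat n + 1 :: complex)"
    using assms by (auto simp: of_nat_diff)
  have "hyp2F1 (- of_nat m) (of_int (int n - int m)) (of_int (int n + 1)) t
     = (\<Sum>k\<le>m - n. pochhammer (- of_nat m) k * pochhammer (- of_nat (m - n)) k / pochhammer (of_nat n + 1) k * (t ^ k / fact k))"
    unfolding hyp2F1_def a by (rule suminf_finite) (auto simp: pochhammer_neg_of_nat binomial_eq_0)
  also have "of_nat (m choose n) * \<dots> = (\<Sum>k\<le>m - n. of_nat (m choose k) * of_nat (m choose (k + n)) * t ^ k)"
    unfolding sum_distrib_left
  proof (intro sum.cong refl)
    fix k assume k: "k \<in> {..m - n}"
    have 1: "of_nat (m choose n) = (fact m / (fact n * fact (m - n)) :: complex)"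
      by (rule binomial_fact[OF assms])
    have 2: "of_nat ((m - n) choose k) = (fact (m - n) / (fact k * fact (m - n - k)) :: complex)"
      by (rule binomial_fact) (use k in auto)
    have 3: "of_nat (m choose (k + n)) = (fact m / (fact (n + k) * fact (m - n - k)) :: complex)"
      using binomial_fact[of "k + n" m, where ?'a = complex] k assms by (simp add: add.commute)
    have s: "(-1) ^ k * (-1) ^ k = (1 :: complex)" by (simp flip: power_mult_distrib)
    have "of_nat (m choose n) * (pochhammer (- of_nat m) k * pochhammer (- of_nat (m - n)) k / pochhammer (of_nat n + 1) k * (t ^ k / fact k))
      = ((-1) ^ k * (-1) ^ k) * (of_nat (m choose n) * (fact k * of_nat (m choose k) * (fact k * of_nat ((m - n) choose k)) / (fact (n + k) / fact n) * (t ^ k / fact k)))"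
      unfolding pochhammer_neg_of_nat pochhammer_of_nat_Suc by (simp only: mult_ac times_divide_eq_right times_divide_eq_left)
    also have "\<dots> = of_nat (m choose k) * of_nat (m choose (k + n)) * t ^ k"
      unfolding s 1 2 3 by (simp add: field_simps)
    finally show "of_nat (m choose n) * (pochhammer (- of_nat m) k * pochhammer (- of_nat (m - n)) k / pochhammer (of_nat n + 1) k * (t ^ k / fact k))
      = of_nat (m choose k) * of_nat (m choose (k + n)) * t ^ k" .
  qed
  finally show ?thesis .
qed

text \<open>
  With \<open>E = 1 - z w\<close> one has \<open>1 + c = -2 z w / E\<close> and \<open>1 - c = 2 / E\<close>, so the two kinds of factors of the Jacobi
  polynomial turn into powers of \<open>z w\<close> and of \<open>E\<close>.
\<close>

lemma md_S_map_finite: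
  fixes z w :: complex and n :: int
  assumes D: "1 - z * w \<noteq> 0"
  defines "p \<equiv> nat \<bar>n\<bar>"
  shows "md n N (S_map (Fin z, Fin w)) = (-1) ^ p * (if n \<ge> 0 then w ^ p else z ^ p)
     * (\<Sum>k\<le>N. of_nat ((p + N) choose k) * of_nat ((p + N) choose (k + p)) * (z * w) ^ k) / (1 - z * w) ^ (p + N)"
proof -
  define E where "E = 1 - z * w"
  have t: "z * w = 1 - E" and E: "E \<noteq> 0" using D by (simp_all add: E_def)
  have c: "1 + - (1 + z * w) / (1 - z * w) = - 2 * (z * w) / E" "1 - - (1 + z * w) / (1 - z * w) = 2 / E"
    unfolding t using E by (simp_all add: field_simps)
  have circ: "circ n (S_map (Fin z, Fin w)) = (-1) ^ p * (if n \<ge> 0 then w ^ p else z ^ p) * (2 / E) ^ p"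
  proof (cases "n \<ge> 0")
    case True
    have "- (2 * w) / (1 - z * w) = (-1) * w * (2 / E)" by (simp add: E_def)
    then show ?thesis using True unfolding circ_def S_map.simps cB_pt p_def by (simp only: power_mult_distrib if_True abs_of_nonneg)
  next
    case False
    have "- (2 * z / (1 - z * w)) = (-1) * z * (2 / E)" by (simp add: E_def)
    moreover have "nat (- n) = p" using False by (simp add: p_def)
    ultimately show ?thesis using False unfolding circ_def S_map.simps cA_pt by (simp only: power_mult_distrib if_False)
  qed
  have "jac p N (S_map (Fin z, Fin w) $ 3) = (\<Sum>k\<le>N. of_nat ((p + N) choose k) * of_nat ((p + N) choose (k + p)) * (z * w) ^ k) * (2 / E) ^ N / 2 ^ (p + N)"
    unfolding jac_def S_map.simps pt_nth c sum_distrib_right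
  proof (intro arg_cong2[where f = "(/)"] sum.cong refl)
    fix k assume k: "k \<in> {..N}"
    have "(- 1) ^ k * (- 2 * (z * w) / E) ^ k * (2 / E) ^ (N - k) = ((-1) * (- 2 * (z * w) / E)) ^ k * (2 / E) ^ (N - k)"
      by (simp only: power_mult_distrib)
    also have "(-1) * (- 2 * (z * w) / E) = (z * w) * (2 / E)" by simp
    also have "((z * w) * (2 / E)) ^ k * (2 / E) ^ (N - k) = (z * w) ^ k * ((2 / E) ^ k * (2 / E) ^ (N - k))"
      by (simp only: power_mult_distrib mult.assoc)
    also have "(2 / E) ^ k * (2 / E) ^ (N - k) = (2 / E) ^ N" using k by (simp flip: power_add)
    finally show "of_nat (p + N choose k) * of_nat (p + N choose (k + p)) * (- 1) ^ k * (- 2 * (z * w) / E) ^ k * (2 / E) ^ (N - k)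
      = of_nat (p + N choose k) * of_nat (p + N choose (k + p)) * (z * w) ^ k * (2 / E) ^ N"
      by (simp only: mult.assoc)
  qed
  then have "md n N (S_map (Fin z, Fin w)) = (-1) ^ p * (if n \<ge> 0 then w ^ p else z ^ p)
     * (\<Sum>k\<le>N. of_nat ((p + N) choose k) * of_nat ((p + N) choose (k + p)) * (z * w) ^ k) * ((2 / E) ^ p * (2 / E) ^ N / 2 ^ (p + N))"
    unfolding md_def circ p_def[symmetric] by (simp only: mult_ac times_divide_eq_right times_divide_eq_left)
  also have "(2 / E) ^ p * (2 / E) ^ N / 2 ^ (p + N) = 1 / E ^ (p + N)"
    unfolding power_add[symmetric] by (simp add: power_divide)
  finally show ?thesis unfolding E_def by simp
qed

theorem poisson_mode_eq_lift_md:
  assumes "nat \<bar>n\<bar> \<le> m"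
  shows "poisson_mode m n = lift (md n (m - nat \<bar>n\<bar>))"
  unfolding poisson_mode_def
proof (rule hol_ext_eqI[OF lift_hol_Omega[OF holv_md]])
  fix z w :: complex assume zw: "z * w \<noteq> 1"
  define p where "p = nat \<bar>n\<bar>"
  have n: "\<bar>n\<bar> = int p" and pm: "p + (m - p) = m" using assms by (auto simp: p_def)
  have D: "1 - z * w \<noteq> 0" using zw by simp
  have "lift (md n (m - nat \<bar>n\<bar>)) (Fin z, Fin w) = md n (m - p) (S_map (Fin z, Fin w))"
    using D by (simp add: lift_def Omega_Fin_Fin p_def del: S_map.simps)
  also have "\<dots> = (-1) ^ p * (if n \<ge> 0 then w ^ p else z ^ p)
     * (of_nat (m choose p) * hyp2F1 (- of_nat m) (of_int (int p - int m)) (of_int (int p + 1)) (z * w)) / (1 - z * w) ^ m"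
    unfolding md_S_map_finite[OF D] p_def[symmetric] pm choose_mult_hyp2F1[OF assms[folded p_def]] ..
  also have "\<dots> = (- 1) ^ p * of_nat (m choose p) * inverse ((1 - z * w) ^ m)
     * hyp2F1 (- of_nat m) (of_int (int p - int m)) (of_int (int p + 1)) (z * w) * (if n \<ge> 0 then w ^ p else z ^ p)"
    by (simp only: divide_inverse mult_ac)
  finally show "lift (md n (m - nat \<bar>n\<bar>)) (Fin z, Fin w) = (- 1) ^ nat \<bar>n\<bar> * of_nat (m choose nat \<bar>n\<bar>) * inverse ((1 - z * w) ^ m)
     * hyp2F1 (- of_nat m) (of_int (\<bar>n\<bar> - int m)) (of_int (\<bar>n\<bar> + 1)) (z * w) * (if 0 \<le> n then w ^ nat n else z ^ nat \<bar>n\<bar>)"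
    unfolding n by (cases "n \<ge> 0") (auto simp: p_def)
qed

section \<open>The Laplacian\<close>

lemma mode_term_deriv_w:
  assumes "1 - z * w \<noteq> 0"
  shows "((\<lambda>w. z ^ p * w ^ l / (1 - z * w) ^ m) has_field_derivative
     (of_nat l * z ^ p * w ^ (l - 1) / (1 - z * w) ^ m + of_nat m * z ^ (p + 1) * w ^ l / (1 - z * w) ^ (m + 1))) (at w)"
proof -
  define D where "D = 1 - z * w"
  have D: "D \<noteq> 0" using assms by (simp add: D_def)
  have "((\<lambda>w. inverse ((1 - z * w) ^ m)) has_field_derivative
     (- (of_nat m * (1 - z * w) ^ (m - 1) * (- z)) * inverse (((1 - z * w) ^ m) ^ 2))) (at w)"
    using assms by (auto intro!: derivative_eq_intros simp: power2_eq_square)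
  also have "- (of_nat m * (1 - z * w) ^ (m - 1) * (- z)) * inverse (((1 - z * w) ^ m) ^ 2) = of_nat m * z / (1 - z * w) ^ (m + 1)"
    unfolding D_def[symmetric] using D by (cases m) (auto simp: field_simps power2_eq_square)
  finally have 1: "((\<lambda>w. inverse ((1 - z * w) ^ m)) has_field_derivative (of_nat m * z / (1 - z * w) ^ (m + 1))) (at w)" .
  have 2: "((\<lambda>w. z ^ p * w ^ l) has_field_derivative (of_nat l * z ^ p * w ^ (l - 1))) (at w)"
    by (auto intro!: derivative_eq_intros)
  from DERIV_mult[OF 2 1] show ?thesis unfolding divide_inverse by (simp add: algebra_simps)
qed

lemma mode_term_deriv_z:
  assumes "1 - z * w \<noteq> 0"
  shows "((\<lambda>z. z ^ p * w ^ l / (1 - z * w) ^ m) has_field_derivative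
     (of_nat p * z ^ (p - 1) * w ^ l / (1 - z * w) ^ m + of_nat m * z ^ p * w ^ (l + 1) / (1 - z * w) ^ (m + 1))) (at z)"
  using mode_term_deriv_w[of w z l p m] assms by (simp add: mult_ac)

text \<open>
  The mixed derivative of \<open>z\<^sup>p w\<^sup>l / (1 - z w)\<^sup>m\<close>. The exponents are left as differentiation produces them; wherever the
  truncated \<open>p - 1\<close> or \<open>l - 1\<close> differs from the true difference, the factor \<open>p\<close> or \<open>l\<close> is 0.
\<close>

definition mode_term_zw :: "nat \<Rightarrow> nat \<Rightarrow> nat \<Rightarrow> complex \<Rightarrow> complex \<Rightarrow> complex" where
  "mode_term_zw p l m z w =
     of_nat l * (of_nat p * z ^ (p - 1) * w ^ (l - 1) / (1 - z * w) ^ m + of_nat m * z ^ p * w ^ (l - 1 + 1) / (1 - z * w) ^ (m + 1))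
   + of_nat m * (of_nat (p + 1) * z ^ p * w ^ l / (1 - z * w) ^ (m + 1) + of_nat (m + 1) * z ^ (p + 1) * w ^ (l + 1) / (1 - z * w) ^ (m + 1 + 1))"

lemma mode_term_deriv_zw:
  assumes "1 - z * w \<noteq> 0"
  shows "((\<lambda>z. of_nat l * z ^ p * w ^ (l - 1) / (1 - z * w) ^ m + of_nat m * z ^ (p + 1) * w ^ l / (1 - z * w) ^ (m + 1))
     has_field_derivative mode_term_zw p l m z w) (at z)"
proof -
  have "((\<lambda>z. of_nat l * (z ^ p * w ^ (l - 1) / (1 - z * w) ^ m) + of_nat m * (z ^ (p + 1) * w ^ l / (1 - z * w) ^ (m + 1)))
     has_field_derivative mode_term_zw p l m z w) (at z)"
    unfolding mode_term_zw_def
    using DERIV_add[OF DERIV_cmult[OF mode_term_deriv_z[OF assms, of p "l - 1" m], of "of_nat l"]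
                       DERIV_cmult[OF mode_term_deriv_z[OF assms, of "p + 1" l "m + 1"], of "of_nat m"]]
    by simp
  then show ?thesis by (simp only: mult.assoc times_divide_eq_right)
qed

text \<open>
  Applied to a single term, \<open>(1 - z w)\<^sup>2 \<partial>\<^sub>z \<partial>\<^sub>w - m (m + 1)\<close> leaves a combination of two neighbouring terms, which
  prepares the telescoping sum below.
\<close>

lemma mode_term_laplace:
  assumes "1 - z * w \<noteq> 0"
  shows "(1 - z * w)\<^sup>2 * mode_term_zw p l m z w - of_nat (m * (m + 1)) * (z ^ p * w ^ l / (1 - z * w) ^ m)
     = (1 - z * w) / (1 - z * w) ^ m * (of_nat p * of_nat l * (z ^ (p - 1) * w ^ (l - 1))
          - (of_nat m - of_nat p) * (of_nat m - of_nat l) * (z ^ p * w ^ l))"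
proof -
  define D where "D = 1 - z * w"
  have D: "D \<noteq> 0" using assms by (simp add: D_def)
  define X where "X = z ^ (p - 1) * w ^ (l - 1)"
  define T where "T = z ^ p * w ^ l"
  have l: "of_nat l * w ^ (l - 1 + 1) = of_nat l * w ^ l" by (cases l) auto
  have pl: "of_nat p * of_nat l * T = of_nat p * of_nat l * (z * w) * X"
    unfolding T_def X_def by (cases p; cases l) (auto simp: mult_ac)
  have zw: "z * w = 1 - D" by (simp add: D_def)
  have "D\<^sup>2 * mode_term_zw p l m z w = (of_nat p * of_nat l * X * D\<^sup>2 + of_nat m * (of_nat l + of_nat p + 1) * T * D
      + of_nat m * (of_nat m + 1) * T * (z * w)) / D ^ m"
  proof -
    have e: "mode_term_zw p l m z w = of_nat l * of_nat p * X / D ^ m + of_nat m * (of_nat l * w ^ (l - 1 + 1)) * z ^ p / D ^ (m + 1)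
        + of_nat m * (of_nat p + 1) * T / D ^ (m + 1) + of_nat m * (of_nat m + 1) * (T * (z * w)) / D ^ (m + 2)"
      unfolding mode_term_zw_def D_def[symmetric] X_def T_def by (simp add: field_simps)
    have "of_nat m * (of_nat l * w ^ (l - 1 + 1)) * z ^ p = of_nat m * of_nat l * T"
      unfolding l T_def by (simp add: mult_ac)
    then show ?thesis unfolding e using D by (simp add: field_simps power2_eq_square)
  qed
  also have "\<dots> - of_nat (m * (m + 1)) * (T / D ^ m) = D / D ^ m * (of_nat p * of_nat l * X
      - (of_nat m - of_nat p) * (of_nat m - of_nat l) * T)"
  proof -
    have "(of_nat p * of_nat l * X * D\<^sup>2 + of_nat m * (of_nat l + of_nat p + 1) * T * D
      + of_nat m * (of_nat m + 1) * T * (z * w)) - of_nat (m * (m + 1)) * T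
      = D * (of_nat p * of_nat l * X * D + of_nat m * (of_nat l + of_nat p - of_nat m) * T)"
      unfolding zw by (simp add: algebra_simps power2_eq_square)
    also have "of_nat p * of_nat l * X * D = of_nat p * of_nat l * X - of_nat p * of_nat l * (z * w) * X"
      by (simp add: D_def algebra_simps)
    also have "\<dots> = of_nat p * of_nat l * X - of_nat p * of_nat l * T" unfolding pl ..
    finally have "(of_nat p * of_nat l * X * D\<^sup>2 + of_nat m * (of_nat l + of_nat p + 1) * T * D
      + of_nat m * (of_nat m + 1) * T * (z * w)) - of_nat (m * (m + 1)) * T
      = D * (of_nat p * of_nat l * X - (of_nat m - of_nat p) * (of_nat m - of_nat l) * T)"
      by (simp add: algebra_simps)
    then show ?thesis by (simp add: diff_divide_distrib[symmetric] del: of_nat_mult of_nat_add)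
  qed
  finally show ?thesis unfolding D_def X_def T_def .
qed

lemma mode_coeff_recursion:
  "of_nat (m choose Suc k) * of_nat (m choose (Suc k + n)) * (of_nat (Suc k) * of_nat (Suc k + n))
   = (of_nat (m choose k) * of_nat (m choose (k + n)) * ((of_nat m - of_nat k) * (of_nat m - of_nat (k + n))) :: complex)"
proof -
  have *: "of_nat (Suc j) * of_nat (m choose Suc j) = ((of_nat m - of_nat j) * of_nat (m choose j) :: complex)" for j
  proof (cases "j \<le> m")
    case True
    have "Suc j * (m choose Suc j) = (m - j) * (m choose j)"
      using binomial_absorb_comp[of m j] binomial_absorption[of j m] by (metis Suc_times_binomial_eq binomial_absorption mult.commute)
    then have "of_nat (Suc j * (m choose Suc j)) = (of_nat ((m - j) * (m choose j)) :: complex)" by simp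
    then show ?thesis using True by (simp only: of_nat_mult of_nat_diff)
  qed (simp add: binomial_eq_0)
  have "of_nat (m choose Suc k) * of_nat (m choose (Suc k + n)) * (of_nat (Suc k) * of_nat (Suc k + n))
     = (of_nat (Suc k) * of_nat (m choose Suc k)) * (of_nat (Suc (k + n)) * of_nat (m choose Suc (k + n)) :: complex)"
    by (simp only: mult_ac add_Suc)
  also have "\<dots> = of_nat (m choose k) * of_nat (m choose (k + n)) * ((of_nat m - of_nat k) * (of_nat m - of_nat (k + n)))"
    unfolding * by (simp only: mult_ac)
  finally show ?thesis .
qed

text \<open>
  By the recursion of the binomial coefficients the two neighbours from consecutive terms cancel, and the boundary terms
  are 0. The exponents \<open>p\<close> and \<open>l\<close> are abstract in order to treat both signs of \<open>n\<close> at once.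
\<close>

lemma mode_sum_laplace:
  assumes D: "1 - z * w \<noteq> 0" and m: "m = n + N"
    and pl: "\<And>k. (p k = k \<and> l k = k + n) \<or> (p k = k + n \<and> l k = k)"
    and step: "\<And>k. p (Suc k) = Suc (p k)" "\<And>k. l (Suc k) = Suc (l k)"
  shows "(1 - z * w)\<^sup>2 * (\<Sum>k\<le>N. of_nat (m choose k) * of_nat (m choose (k + n)) * mode_term_zw (p k) (l k) m z w)
     = of_nat (m * (m + 1)) * (\<Sum>k\<le>N. of_nat (m choose k) * of_nat (m choose (k + n)) * (z ^ p k * w ^ l k / (1 - z * w) ^ m))"
proof -
  define A where "A k = (of_nat (m choose k) * of_nat (m choose (k + n)) :: complex)" for k
  define a where "a k = A k * (of_nat (p k) * of_nat (l k)) * (z ^ (p k - 1) * w ^ (l k - 1))" for k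
  have plk: "of_nat (p k) * of_nat (l k) = (of_nat k * of_nat (k + n) :: complex)" for k
    using pl[of k] by (auto simp: mult.commute)
  have mpl: "(of_nat m - of_nat (p k)) * (of_nat m - of_nat (l k)) = ((of_nat m - of_nat k) * (of_nat m - of_nat (k + n)) :: complex)" for k
    using pl[of k] by (auto simp: mult.commute)
  have nxt: "A k * ((of_nat m - of_nat (p k)) * (of_nat m - of_nat (l k))) * (z ^ p k * w ^ l k) = a (Suc k)" for k
  proof -
    have "a (Suc k) = A (Suc k) * (of_nat (Suc k) * of_nat (Suc k + n)) * (z ^ p k * w ^ l k)"
      unfolding a_def plk by (simp add: step del: of_nat_Suc of_nat_add)
    then show ?thesis unfolding A_def mode_coeff_recursion mpl by simp
  qed
  have "(1 - z * w)\<^sup>2 * (\<Sum>k\<le>N. A k * mode_term_zw (p k) (l k) m z w)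
      - of_nat (m * (m + 1)) * (\<Sum>k\<le>N. A k * (z ^ p k * w ^ l k / (1 - z * w) ^ m))
    = (\<Sum>k\<le>N. A k * ((1 - z * w)\<^sup>2 * mode_term_zw (p k) (l k) m z w - of_nat (m * (m + 1)) * (z ^ p k * w ^ l k / (1 - z * w) ^ m)))"
    by (simp only: sum_distrib_left sum_subtractf[symmetric] right_diff_distrib mult.left_commute)
  also have "\<dots> = (\<Sum>k\<le>N. (1 - z * w) / (1 - z * w) ^ m * (a k - a (Suc k)))"
  proof (intro sum.cong refl)
    fix k
    have gen: "x * (c * (y - z)) = c * (x * y - x * z)" for x y z c :: complex by (simp add: algebra_simps)
    show "A k * ((1 - z * w)\<^sup>2 * mode_term_zw (p k) (l k) m z w - of_nat (m * (m + 1)) * (z ^ p k * w ^ l k / (1 - z * w) ^ m))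
        = (1 - z * w) / (1 - z * w) ^ m * (a k - a (Suc k))"
      unfolding mode_term_laplace[OF D] nxt[symmetric] a_def[of k] mult.assoc by (rule gen)
  qed
  also have "\<dots> = (1 - z * w) / (1 - z * w) ^ m * (a 0 - a (Suc N))"
    unfolding sum_distrib_left[symmetric] by (subst sum_telescope) simp
  also have "a 0 = 0" unfolding a_def plk by simp
  also have "a (Suc N) = 0" unfolding a_def A_def m by (simp add: binomial_eq_0)
  finally show ?thesis unfolding A_def by simp
qed

lemma md_derivatives:
  fixes n :: int and N :: nat
  defines "M \<equiv> \<lambda>z w. md n N (S_map (Fin z, Fin w))"
  obtains M' M'' where "\<And>z w. 1 - z * w \<noteq> 0 \<Longrightarrow> (M z has_field_derivative M' z w) (at w)"
    "\<And>z w. 1 - z * w \<noteq> 0 \<Longrightarrow> ((\<lambda>z. M' z w) has_field_derivative M'' z w) (at z)"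
    "\<And>z w. 1 - z * w \<noteq> 0 \<Longrightarrow> (1 - z * w)\<^sup>2 * M'' z w = of_nat ((nat \<bar>n\<bar> + N) * (nat \<bar>n\<bar> + N + 1)) * M z w"
proof -
  define q where "q = nat \<bar>n\<bar>"
  define m where "m = q + N"
  define p l where "p = (\<lambda>k. if n \<ge> 0 then k else k + q)" and "l = (\<lambda>k. if n \<ge> 0 then k + q else k)"
  define B where "B k = (-1) ^ q * (of_nat (m choose k) * of_nat (m choose (k + q)) :: complex)" for k
  define M' where "M' z w = (\<Sum>k\<le>N. B k * (of_nat (l k) * z ^ p k * w ^ (l k - 1) / (1 - z * w) ^ m + of_nat m * z ^ (p k + 1) * w ^ l k / (1 - z * w) ^ (m + 1)))" for z w
  define M'' where "M'' z w = (\<Sum>k\<le>N. B k * mode_term_zw (p k) (l k) m z w)" for z w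
  have M: "M z w = (\<Sum>k\<le>N. B k * (z ^ p k * w ^ l k / (1 - z * w) ^ m))" if "1 - z * w \<noteq> 0" for z w
  proof -
    have "M z w = (\<Sum>k\<le>N. (-1) ^ q * (if n \<ge> 0 then w ^ q else z ^ q)
      * (of_nat (m choose k) * of_nat (m choose (k + q)) * (z * w) ^ k) / (1 - z * w) ^ m)"
      unfolding M_def md_S_map_finite[OF that] q_def[symmetric] m_def[symmetric] sum_distrib_left sum_divide_distrib ..
    also have "\<dots> = (\<Sum>k\<le>N. B k * (z ^ p k * w ^ l k / (1 - z * w) ^ m))"
      unfolding B_def p_def l_def by (intro sum.cong refl) (auto simp: power_mult_distrib power_add)
    finally show ?thesis .
  qed
  show ?thesis
  proof (rule that[of M' M''])
    fix z w :: complex assume D: "1 - z * w \<noteq> 0"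
    have op: "open {w. 1 - z * w \<noteq> 0}" by (intro open_Collect_neq continuous_intros)
    have "((\<lambda>w. \<Sum>k\<le>N. B k * (z ^ p k * w ^ l k / (1 - z * w) ^ m)) has_field_derivative M' z w) (at w)"
      unfolding M'_def by (intro DERIV_sum DERIV_cmult mode_term_deriv_w D)
    then show "(M z has_field_derivative M' z w) (at w)"
      by (rule has_field_derivative_transform_within_open[OF _ op]) (use D M in auto)
    show "((\<lambda>z. M' z w) has_field_derivative M'' z w) (at z)"
      unfolding M'_def M''_def by (intro DERIV_sum DERIV_cmult mode_term_deriv_zw D)
    have "(1 - z * w)\<^sup>2 * (\<Sum>k\<le>N. of_nat (m choose k) * of_nat (m choose (k + q)) * mode_term_zw (p k) (l k) m z w)
     = of_nat (m * (m + 1)) * (\<Sum>k\<le>N. of_nat (m choose k) * of_nat (m choose (k + q)) * (z ^ p k * w ^ l k / (1 - z * w) ^ m))"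
      by (rule mode_sum_laplace[OF D m_def]) (auto simp: p_def l_def)
    then have "(-1) ^ q * ((1 - z * w)\<^sup>2 * (\<Sum>k\<le>N. of_nat (m choose k) * of_nat (m choose (k + q)) * mode_term_zw (p k) (l k) m z w))
     = (-1) ^ q * (of_nat (m * (m + 1)) * (\<Sum>k\<le>N. of_nat (m choose k) * of_nat (m choose (k + q)) * (z ^ p k * w ^ l k / (1 - z * w) ^ m)))"
      by simp
    then have "(1 - z * w)\<^sup>2 * M'' z w = of_nat (m * (m + 1)) * M z w"
      unfolding M''_def M[OF D] B_def by (simp add: sum_distrib_left mult_ac del: of_nat_mult of_nat_add)
    then show "(1 - z * w)\<^sup>2 * M'' z w = of_nat ((nat \<bar>n\<bar> + N) * (nat \<bar>n\<bar> + N + 1)) * M z w"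
      by (simp only: m_def q_def)
  qed
qed

lemma continuous_on_S_map_finite:
  "continuous_on {x :: complex \<times> complex. 1 - fst x * snd x \<noteq> 0} (\<lambda>x. S_map (Fin (fst x), Fin (snd x)))"
  unfolding S_map.simps by (intro continuous_intros) auto

lemma deriv_uniform_bound:
  fixes u :: "complex \<Rightarrow> complex"
  assumes hol: "\<And>x. x \<in> ball w r \<Longrightarrow> (u has_field_derivative u' x) (at x)" and r: "0 < r"
    and B: "\<And>x. x \<in> ball w r \<Longrightarrow> norm (u x) \<le> B"
  shows "norm (u' w) \<le> 2 * B / r"
proof -
  have "norm ((deriv ^^ 1) u w) \<le> fact 1 * B / (r / 2) ^ 1"
  proof (rule Cauchy_inequality)
    show "u holomorphic_on ball w (r / 2)"
      unfolding holomorphic_on_def field_differentiable_def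
      by (intro ballI exI, rule has_field_derivative_at_within, rule hol) (use r in auto)
    have "continuous_on (ball w r) u"
      using hol by (auto intro!: continuous_at_imp_continuous_on DERIV_isCont)
    then show "continuous_on (cball w (r / 2)) u" by (rule continuous_on_subset) (use r in auto)
  qed (use r B in \<open>auto simp: dist_norm\<close>)
  moreover have "deriv u w = u' w" using hol[of w] r by (intro DERIV_imp_deriv) auto
  ultimately show ?thesis by (simp add: field_simps)
qed

text \<open>
  Uniform convergence on a bidisc gives, by the Cauchy estimate in \<open>w\<close>, uniform convergence of the first derivatives
  in \<open>z\<close>, to which the one-variable theorem applies again.
\<close>

lemma mixed_deriv_uniform_limit:
  fixes F :: "nat \<Rightarrow> complex \<Rightarrow> complex \<Rightarrow> complex"
  assumes r: "0 < r"
    and lim: "uniform_limit (cball z r \<times> cball w r) (\<lambda>K (\<zeta>, \<omega>). F K \<zeta> \<omega>) (\<lambda>(\<zeta>, \<omega>). f \<zeta> \<omega>) sequentially"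
    and F': "\<And>K \<zeta> \<omega>. \<zeta> \<in> cball z r \<Longrightarrow> \<omega> \<in> cball w r \<Longrightarrow> (F K \<zeta> has_field_derivative F' K \<zeta> \<omega>) (at \<omega>)"
    and F'': "\<And>K \<zeta> \<omega>. \<zeta> \<in> cball z r \<Longrightarrow> \<omega> \<in> cball w r \<Longrightarrow> ((\<lambda>\<zeta>. F' K \<zeta> \<omega>) has_field_derivative F'' K \<zeta> \<omega>) (at \<zeta>)"
  shows "(\<lambda>K. F'' K z w) \<longlonglongrightarrow> deriv (\<lambda>\<zeta>. deriv (f \<zeta>) w) z"
proof -
  have fder: "\<exists>g'. \<forall>\<omega>\<in>ball w r. (f \<zeta> has_field_derivative g' \<omega>) (at \<omega>)" if \<zeta>: "\<zeta> \<in> cball z r" for \<zeta>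
  proof -
    have "\<exists>g'. \<forall>\<omega>\<in>ball w r. (f \<zeta> has_field_derivative g' \<omega>) (at \<omega>) \<and> (\<lambda>K. F' K \<zeta> \<omega>) \<longlonglongrightarrow> g' \<omega>"
    proof (rule has_complex_derivative_uniform_sequence[OF open_ball])
      show "(F K \<zeta> has_field_derivative F' K \<zeta> \<omega>) (at \<omega>)" if "\<omega> \<in> ball w r" for K \<omega>
        using F'[OF \<zeta>] that by auto
      fix \<omega> assume \<omega>: "\<omega> \<in> ball w r"
      then obtain d where d: "0 < d" "cball \<omega> d \<subseteq> ball w r" using open_contains_cball open_ball by metis
      have "uniform_limit (cball \<omega> d) (\<lambda>K. F K \<zeta>) (f \<zeta>) sequentially"
        unfolding uniform_limit_iff
      proof (intro allI impI)
        fix e :: real assume "0 < e"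
        from uniform_limitD[OF lim this]
        show "\<forall>\<^sub>F K in sequentially. \<forall>x\<in>cball \<omega> d. dist (F K \<zeta> x) (f \<zeta> x) < e"
        proof eventually_elim
          case (elim K)
          show ?case
          proof
            fix x assume "x \<in> cball \<omega> d"
            then have "(\<zeta>, x) \<in> cball z r \<times> cball w r" using d \<zeta> by auto
            then show "dist (F K \<zeta> x) (f \<zeta> x) < e" using elim by fastforce
          qed
        qed
      qed
      then show "\<exists>d>0. cball \<omega> d \<subseteq> ball w r \<and> uniform_limit (cball \<omega> d) (\<lambda>K. F K \<zeta>) (f \<zeta>) sequentially"
        using d by blast
    qed
    then show ?thesis by blast
  qed
  define g where "g \<zeta> = deriv (f \<zeta>) w" for \<zeta>
  have ul: "uniform_limit (cball z r) (\<lambda>K \<zeta>. F' K \<zeta> w) g sequentially"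
    unfolding uniform_limit_iff
  proof (intro allI impI)
    fix e :: real assume e: "0 < e"
    have "0 < e * r / 4" using e r by simp
    from uniform_limitD[OF lim this]
    show "\<forall>\<^sub>F K in sequentially. \<forall>\<zeta>\<in>cball z r. dist (F' K \<zeta> w) (g \<zeta>) < e"
    proof eventually_elim
      case (elim K)
      show ?case
      proof
        fix \<zeta> assume \<zeta>: "\<zeta> \<in> cball z r"
        obtain g' where g': "\<And>\<omega>. \<omega> \<in> ball w r \<Longrightarrow> (f \<zeta> has_field_derivative g' \<omega>) (at \<omega>)" using fder[OF \<zeta>] by blast
        have "norm (F' K \<zeta> w - g' w) \<le> 2 * (e * r / 4) / r"
        proof (rule deriv_uniform_bound[OF _ r, where u = "\<lambda>\<omega>. F K \<zeta> \<omega> - f \<zeta> \<omega>" and u' = "\<lambda>\<omega>. F' K \<zeta> \<omega> - g' \<omega>"])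
          fix x assume x: "x \<in> ball w r"
          show "((\<lambda>\<omega>. F K \<zeta> \<omega> - f \<zeta> \<omega>) has_field_derivative F' K \<zeta> x - g' x) (at x)"
            by (intro DERIV_diff F' g' \<zeta>) (use x in auto)
          have "(\<zeta>, x) \<in> cball z r \<times> cball w r" using \<zeta> x by auto
          then have "dist (F K \<zeta> x) (f \<zeta> x) < e * r / 4" using elim by fastforce
          then show "norm (F K \<zeta> x - f \<zeta> x) \<le> e * r / 4" by (simp add: dist_norm)
        qed
        also have "2 * (e * r / 4) / r = e / 2" using r by simp
        finally have "norm (F' K \<zeta> w - g' w) < e" using e by linarith
        moreover have "g \<zeta> = g' w" unfolding g_def using g'[of w] r by (intro DERIV_imp_deriv) auto
        ultimately show "dist (F' K \<zeta> w) (g \<zeta>) < e" by (simp add: dist_norm)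
      qed
    qed
  qed
  have "\<exists>g'. \<forall>\<zeta>\<in>ball z r. (g has_field_derivative g' \<zeta>) (at \<zeta>) \<and> (\<lambda>K. F'' K \<zeta> w) \<longlonglongrightarrow> g' \<zeta>"
  proof (rule has_complex_derivative_uniform_sequence[OF open_ball, where f = "\<lambda>K \<zeta>. F' K \<zeta> w"])
    show "((\<lambda>\<zeta>. F' K \<zeta> w) has_field_derivative F'' K \<zeta> w) (at \<zeta>)" if "\<zeta> \<in> ball z r" for K \<zeta>
      by (rule F'') (use that r in auto)
    fix \<zeta> assume "\<zeta> \<in> ball z r"
    then obtain d where d: "0 < d" "cball \<zeta> d \<subseteq> ball z r" using open_contains_cball open_ball by metis
    have "uniform_limit (cball \<zeta> d) (\<lambda>K \<zeta>. F' K \<zeta> w) g sequentially"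
      by (rule uniform_limit_on_subset[OF ul]) (use d in auto)
    then show "\<exists>d>0. cball \<zeta> d \<subseteq> ball z r \<and> uniform_limit (cball \<zeta> d) (\<lambda>K \<zeta>. F' K \<zeta> w) g sequentially"
      using d by blast
  qed
  then obtain g' where "(g has_field_derivative g') (at z)" "(\<lambda>K. F'' K z w) \<longlonglongrightarrow> g'"
    using r by (metis centre_in_ball)
  then show ?thesis using DERIV_imp_deriv unfolding g_def by metis
qed

text \<open>
  The eigenvalue \<open>4 m (m + 1)\<close> of the mode \<open>md n N\<close>, where \<open>m = |n| + N\<close>.
\<close>

definition lap_ev :: "int \<Rightarrow> nat \<Rightarrow> complex" where
  "lap_ev n N = of_nat (4 * (nat \<bar>n\<bar> + N) * (nat \<bar>n\<bar> + N + 1))"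

lemma rapid_lap_ev:
  assumes "rapid c" shows "rapid (\<lambda>n N. lap_ev n N * c n N)"
  unfolding rapid_def
proof (intro allI impI)
  fix r :: real assume r: "0 < r"
  then have "0 < r / 8" by simp
  then obtain C where C: "\<And>n N. norm (c n N) \<le> C * (r / 8) ^ (nat \<bar>n\<bar> + N)" using assms unfolding rapid_def by blast
  have "norm (c 0 0) \<le> C" using C[of 0 0] by simp
  then have C0: "0 \<le> C" using norm_ge_zero order_trans by blast
  have "norm (lap_ev n N * c n N) \<le> (4 * C) * r ^ (nat \<bar>n\<bar> + N)" for n N
  proof -
    define m where "m = nat \<bar>n\<bar> + N"
    have 1: "m \<le> 2 ^ m" "m + 1 \<le> 2 ^ m" using less_exp[of m] by (auto intro: less_imp_le Suc_leI)
    have "m * (m + 1) \<le> 2 ^ m * 2 ^ m" by (rule mult_le_mono[OF 1])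
    also have "\<dots> = 4 ^ m" by (simp flip: power_mult_distrib)
    also have "\<dots> \<le> 8 ^ m" by (rule power_mono) auto
    finally have "real (4 * m * (m + 1)) \<le> real (4 * 8 ^ m)" unfolding of_nat_le_iff by simp
    then have 2: "norm (lap_ev n N) \<le> 4 * 8 ^ m" unfolding lap_ev_def m_def[symmetric] norm_of_nat by simp
    have "norm (lap_ev n N * c n N) \<le> (4 * 8 ^ m) * (C * (r / 8) ^ m)"
      unfolding norm_mult using C[of n N] 2 unfolding m_def[symmetric] by (intro mult_mono) auto
    also have "\<dots> = (4 * C) * (8 * (r / 8)) ^ m" by (simp only: power_mult_distrib mult_ac)
    finally show ?thesis by (simp add: m_def)
  qed
  then show "\<exists>C. \<forall>n k. norm (lap_ev n k * c n k) \<le> C * r ^ (nat \<bar>n\<bar> + k)" by blast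
qed

text \<open>
  Near a finite point of \<open>\<Omega>\<close> the Laplacian may be applied term by term. The resulting series is holomorphic on all of
  \<open>\<Omega>\<close>, because the eigenvalues grow only polynomially, and so it is the extension that the definition
  of the Laplacian asks for.
\<close>

theorem laplacian_mode_series:
  assumes c: "rapid c"
  shows "laplacian_zw (lift (mode_series c)) = lift (mode_series (\<lambda>n N. lap_ev n N * c n N))"
  unfolding laplacian_zw_def
proof (rule hol_ext_eqI[OF lift_hol_Omega[OF holv_mode_series[OF rapid_lap_ev[OF c]]]])
  fix z w :: complex assume "z * w \<noteq> 1"
  then have D: "1 - z * w \<noteq> 0" by simp
  define S where "S = (\<lambda>z w. S_map (Fin z, Fin w))"
  have "\<exists>M' M''. \<forall>z w. 1 - z * w \<noteq> 0 \<longrightarrow> ((\<lambda>w. md n N (S z w)) has_field_derivative M' z w) (at w)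
     \<and> ((\<lambda>z. M' z w) has_field_derivative M'' z w) (at z)
     \<and> (1 - z * w)\<^sup>2 * M'' z w = of_nat ((nat \<bar>n\<bar> + N) * (nat \<bar>n\<bar> + N + 1)) * md n N (S z w)" for n N
    unfolding S_def by (rule md_derivatives[of n N]) blast
  then obtain M' M'' where M: "\<And>n N z w. 1 - z * w \<noteq> 0 \<Longrightarrow> ((\<lambda>w. md n N (S z w)) has_field_derivative M' n N z w) (at w)"
     "\<And>n N z w. 1 - z * w \<noteq> 0 \<Longrightarrow> ((\<lambda>z. M' n N z w) has_field_derivative M'' n N z w) (at z)"
     "\<And>n N z w. 1 - z * w \<noteq> 0 \<Longrightarrow> (1 - z * w)\<^sup>2 * M'' n N z w = of_nat ((nat \<bar>n\<bar> + N) * (nat \<bar>n\<bar> + N + 1)) * md n N (S z w)"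
    by metis
  define U where "U = {x :: complex \<times> complex. 1 - fst x * snd x \<noteq> 0}"
  have "open U" unfolding U_def by (intro open_Collect_neq continuous_intros)
  moreover have "(z, w) \<in> U" using D by (simp add: U_def)
  ultimately obtain \<epsilon> where \<epsilon>: "0 < \<epsilon>" "ball (z, w) \<epsilon> \<subseteq> U" using openE by blast
  define r where "r = \<epsilon> / 4"
  have r: "0 < r" using \<epsilon> by (simp add: r_def)
  have sub: "cball z r \<times> cball w r \<subseteq> U"
  proof
    fix x assume x: "x \<in> cball z r \<times> cball w r"
    have "dist (z, w) x \<le> dist z (fst x) + dist w (snd x)"
      unfolding dist_prod_def fst_conv snd_conv by (rule sqrt_sum_squares_le_sum) auto
    also have "\<dots> \<le> r + r" using x by (intro add_mono) auto
    finally have "dist (z, w) x < \<epsilon>" using \<epsilon>(1) by (simp add: r_def)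
    then show "x \<in> U" using \<epsilon>(2) by auto
  qed
  have nz: "1 - \<zeta> * \<omega> \<noteq> 0" if "\<zeta> \<in> cball z r" "\<omega> \<in> cball w r" for \<zeta> \<omega>
  proof -
    have "(\<zeta>, \<omega>) \<in> cball z r \<times> cball w r" using that by simp
    then have "(\<zeta>, \<omega>) \<in> U" using sub by blast
    then show ?thesis by (simp add: U_def)
  qed
  have "compact ((\<lambda>x. S (fst x) (snd x)) ` (cball z r \<times> cball w r))"
    unfolding S_def
    by (intro compact_continuous_image continuous_on_subset[OF continuous_on_S_map_finite] compact_Times compact_cball)
       (use sub in \<open>auto simp: U_def\<close>)
  then obtain \<rho> where \<rho>: "\<forall>x\<in>(\<lambda>x. S (fst x) (snd x)) ` (cball z r \<times> cball w r). norm x \<le> \<rho>"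
    unfolding compact_eq_bounded_closed bounded_iff by blast
  define E where "E = upto_degree"
  note EL = filterlim_upto_degree[folded E_def]
  have "uniform_limit (cball 0 \<rho>) (\<lambda>K z. \<Sum>(n, k)\<in>E K. c n k * md n k z) (mode_series c) sequentially"
    by (rule filterlim_uniform_limit_compose[OF mode_uniform_limit[OF c] EL])
  then have ul: "uniform_limit (cball z r \<times> cball w r) (\<lambda>K (\<zeta>, \<omega>). \<Sum>(n, k)\<in>E K. c n k * md n k (S \<zeta> \<omega>))
      (\<lambda>(\<zeta>, \<omega>). mode_series c (S \<zeta> \<omega>)) sequentially"
    unfolding uniform_limit_iff
  proof (intro allI impI, goal_cases)
    case (1 e)
    from 1(1)[rule_format, OF 1(2)] show ?case
    proof eventually_elim
      case (elim K)
      show ?case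
      proof
        fix x assume x: "x \<in> cball z r \<times> cball w r"
        obtain \<zeta> \<omega> where x': "x = (\<zeta>, \<omega>)" by fastforce
        have "norm (S (fst x) (snd x)) \<le> \<rho>" by (rule bspec[OF \<rho> imageI[OF x]])
        then have "S (fst x) (snd x) \<in> cball 0 \<rho>" by simp
        then show "dist (case x of (\<zeta>, \<omega>) \<Rightarrow> \<Sum>(n, k)\<in>E K. c n k * md n k (S \<zeta> \<omega>)) (case x of (\<zeta>, \<omega>) \<Rightarrow> mode_series c (S \<zeta> \<omega>)) < e"
          using elim unfolding x' by simp
      qed
    qed
  qed
  have lim1: "(\<lambda>K. \<Sum>(n, k)\<in>E K. c n k * M'' n k z w) \<longlonglongrightarrow> deriv (\<lambda>\<zeta>. deriv (\<lambda>\<omega>. mode_series c (S \<zeta> \<omega>)) w) z"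
  proof (rule mixed_deriv_uniform_limit[OF r ul, where F' = "\<lambda>K \<zeta> \<omega>. \<Sum>(n, k)\<in>E K. c n k * M' n k \<zeta> \<omega>"])
    fix K \<zeta> \<omega> assume *: "\<zeta> \<in> cball z r" "\<omega> \<in> cball w r"
    show "((\<lambda>\<omega>. \<Sum>(n, k)\<in>E K. c n k * md n k (S \<zeta> \<omega>)) has_field_derivative (\<Sum>(n, k)\<in>E K. c n k * M' n k \<zeta> \<omega>)) (at \<omega>)"
      unfolding case_prod_unfold by (intro DERIV_sum DERIV_cmult M(1) nz *)
    show "((\<lambda>\<zeta>. \<Sum>(n, k)\<in>E K. c n k * M' n k \<zeta> \<omega>) has_field_derivative (\<Sum>(n, k)\<in>E K. c n k * M'' n k \<zeta> \<omega>)) (at \<zeta>)"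
      unfolding case_prod_unfold by (intro DERIV_sum DERIV_cmult M(2) nz *)
  qed
  have "4 * (1 - z * w)\<^sup>2 * (\<Sum>(n, k)\<in>E K. c n k * M'' n k z w) = (\<Sum>(n, k)\<in>E K. (lap_ev n k * c n k) * md n k (S z w))" for K
    unfolding sum_distrib_left case_prod_unfold
  proof (intro sum.cong refl)
    fix x :: "int \<times> nat"
    obtain n k where x: "x = (n, k)" by fastforce
    have "4 * (1 - z * w)\<^sup>2 * (c n k * M'' n k z w) = 4 * c n k * ((1 - z * w)\<^sup>2 * M'' n k z w)" by (simp only: mult_ac)
    also have "\<dots> = lap_ev n k * c n k * md n k (S z w)"
      unfolding M(3)[OF D] lap_ev_def by simp
    finally show "4 * (1 - z * w)\<^sup>2 * (c (fst x) (snd x) * M'' (fst x) (snd x) z w) = lap_ev (fst x) (snd x) * c (fst x) (snd x) * md (fst x) (snd x) (S z w)"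
      by (simp add: x)
  qed
  then have lim2: "(\<lambda>K. \<Sum>(n, k)\<in>E K. (lap_ev n k * c n k) * md n k (S z w)) \<longlonglongrightarrow>
     4 * (1 - z * w)\<^sup>2 * deriv (\<lambda>\<zeta>. deriv (\<lambda>\<omega>. mode_series c (S \<zeta> \<omega>)) w) z"
    using tendsto_mult[OF tendsto_const[of "4 * (1 - z * w)\<^sup>2"] lim1] by simp
  have mem: "S z w \<in> cball 0 (norm (S z w))" by simp
  have ul2: "uniform_limit (cball 0 (norm (S z w))) (\<lambda>K z. \<Sum>(n, k)\<in>E K. (lap_ev n k * c n k) * md n k z) (mode_series (\<lambda>n N. lap_ev n N * c n N)) sequentially"
    by (rule filterlim_uniform_limit_compose[OF mode_uniform_limit[OF rapid_lap_ev[OF c]] EL])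
  from tendsto_uniform_limitI[OF ul2 mem]
  have "(\<lambda>K. \<Sum>(n, k)\<in>E K. (lap_ev n k * c n k) * md n k (S z w)) \<longlonglongrightarrow> mode_series (\<lambda>n N. lap_ev n N * c n N) (S z w)"
    .
  then have eq: "mode_series (\<lambda>n N. lap_ev n N * c n N) (S z w) = 4 * (1 - z * w)\<^sup>2 * deriv (\<lambda>\<zeta>. deriv (\<lambda>\<omega>. mode_series c (S \<zeta> \<omega>)) w) z"
    using lim2 LIMSEQ_unique by blast
  have "deriv (\<lambda>\<zeta>. deriv (\<lambda>\<omega>. lift (mode_series c) (Fin \<zeta>, Fin \<omega>)) w) z = deriv (\<lambda>\<zeta>. deriv (\<lambda>\<omega>. mode_series c (S \<zeta> \<omega>)) w) z"
  proof (rule deriv_cong_ev)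
    have "open {\<zeta>. 1 - \<zeta> * w \<noteq> 0}" by (intro open_Collect_neq continuous_intros)
    then have "\<forall>\<^sub>F \<zeta> in nhds z. 1 - \<zeta> * w \<noteq> 0" using eventually_nhds_in_open[of _ z] D by fastforce
    then show "\<forall>\<^sub>F \<zeta> in nhds z. deriv (\<lambda>\<omega>. lift (mode_series c) (Fin \<zeta>, Fin \<omega>)) w = deriv (\<lambda>\<omega>. mode_series c (S \<zeta> \<omega>)) w"
    proof eventually_elim
      case (elim \<zeta>)
      show ?case
      proof (rule deriv_cong_ev)
        have "open {\<omega>. 1 - \<zeta> * \<omega> \<noteq> 0}" by (intro open_Collect_neq continuous_intros)
        then have "\<forall>\<^sub>F \<omega> in nhds w. 1 - \<zeta> * \<omega> \<noteq> 0" using eventually_nhds_in_open[of _ w] elim by fastforce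
        then show "\<forall>\<^sub>F \<omega> in nhds w. lift (mode_series c) (Fin \<zeta>, Fin \<omega>) = mode_series c (S \<zeta> \<omega>)"
          by eventually_elim (simp add: lift_def Omega_Fin_Fin S_def del: S_map.simps)
      qed simp
    qed
  qed simp
  then show "lift (mode_series (\<lambda>n N. lap_ev n N * c n N)) (Fin z, Fin w) =
     4 * (1 - z * w)\<^sup>2 * deriv (\<lambda>\<zeta>. deriv (\<lambda>\<omega>. lift (mode_series c) (Fin \<zeta>, Fin \<omega>)) w) z"
    using eq D by (simp add: lift_def Omega_Fin_Fin S_def del: S_map.simps)
qed

lemma mode_series_cmult: "mode_series (\<lambda>n k. l * c n k) z = l * mode_series c z"
  unfolding mode_series_def infsum_cmult_right'[symmetric] by (simp add: case_prod_unfold mult.assoc)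

lemma rapid_cmult: "rapid c \<Longrightarrow> rapid (\<lambda>n k. l * c n k)"
  unfolding rapid_def
proof (intro allI impI)
  fix r :: real assume *: "\<forall>r>0. \<exists>C. \<forall>n k. norm (c n k) \<le> C * r ^ (nat \<bar>n\<bar> + k)" "0 < r"
  then obtain C where C: "\<And>n k. norm (c n k) \<le> C * r ^ (nat \<bar>n\<bar> + k)" by blast
  have "norm (l * c n k) \<le> (norm l * C) * r ^ (nat \<bar>n\<bar> + k)" for n k
    unfolding norm_mult mult.assoc using C by (intro mult_left_mono) auto
  then show "\<exists>C. \<forall>n k. norm (l * c n k) \<le> C * r ^ (nat \<bar>n\<bar> + k)" by blast
qed

lemma rapid_finite_support:
  assumes fin: "finite X" and supp: "\<And>n k. (n, k) \<notin> X \<Longrightarrow> c n k = 0"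
  shows "rapid c"
  unfolding rapid_def
proof (intro allI impI)
  fix r :: real assume r: "0 < r"
  define C where "C = (\<Sum>(n, k)\<in>X. norm (c n k) / r ^ (nat \<bar>n\<bar> + k))"
  have "norm (c n k) \<le> C * r ^ (nat \<bar>n\<bar> + k)" for n k
  proof (cases "(n, k) \<in> X")
    case True
    have "norm (c n k) / r ^ (nat \<bar>n\<bar> + k) = (\<lambda>(n, k). norm (c n k) / r ^ (nat \<bar>n\<bar> + k)) (n, k)" by simp
    also have "\<dots> \<le> C" unfolding C_def
      by (rule member_le_sum[OF True _ fin]) (use r in auto)
    finally show ?thesis using r by (simp add: field_simps)
  next
    case False
    have "0 \<le> C" unfolding C_def by (rule sum_nonneg) (use r in auto)
    then show ?thesis using supp[OF False] r by simp
  qed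
  then show "\<exists>C. \<forall>n k. norm (c n k) \<le> C * r ^ (nat \<bar>n\<bar> + k)" by blast
qed

lemma mode_series_finite_support:
  assumes fin: "finite X" and supp: "\<And>n k. (n, k) \<notin> X \<Longrightarrow> c n k = 0"
  shows "mode_series c z = (\<Sum>(n, k)\<in>X. c n k * md n k z)"
proof -
  have "((\<lambda>(n, k). c n k * md n k z) has_sum (\<Sum>(n, k)\<in>X. c n k * md n k z)) UNIV"
    by (rule has_sum_finite_neutralI[OF fin]) (use supp in auto)
  then show ?thesis unfolding mode_series_def by (rule infsumI)
qed

section \<open>Modes and eigenspaces on the complex sphere\<close>

definition single_coeff :: "int \<Rightarrow> nat \<Rightarrow> int \<Rightarrow> nat \<Rightarrow> complex" where
  "single_coeff n N n' N' = (if n' = n \<and> N' = N then 1 else 0)"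

lemma rapid_single_coeff: "rapid (single_coeff n N)"
  by (rule rapid_finite_support[of "{(n, N)}"]) (auto simp: single_coeff_def)

lemma mode_series_single_coeff: "mode_series (single_coeff n N) = md n N"
  by (rule ext, subst mode_series_finite_support[of "{(n, N)}"]) (auto simp: single_coeff_def)

lemma Q_mode_eq:
  assumes "nat \<bar>n\<bar> \<le> m"
  shows "Q_mode m n z = (if z \<in> csphere then md n (m - nat \<bar>n\<bar>) z else 0)"
  unfolding Q_mode_def poisson_mode_eq_lift_md[OF assms] using pullback_S_lift by (auto simp: pullback_S_def)

lemma lift_cmult_eq: "p \<in> Omega \<Longrightarrow> lift (mode_series (\<lambda>n k. l * c n k)) p = l * lift (mode_series c) p"
  by (simp add: lift_def mode_series_cmult)

lemma poisson_mode_in_eigenspace: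
  assumes "nat \<bar>n\<bar> \<le> m"
  shows "poisson_mode m n \<in> eigenspace (of_nat (4 * m * (m + 1)))"
proof -
  define N where "N = m - nat \<bar>n\<bar>"
  have m: "nat \<bar>n\<bar> + N = m" using assms by (simp add: N_def)
  have eq: "poisson_mode m n = lift (mode_series (single_coeff n N))"
    unfolding poisson_mode_eq_lift_md[OF assms] mode_series_single_coeff N_def ..
  have "(\<lambda>n' N'. lap_ev n' N' * single_coeff n N n' N') = (\<lambda>n' N'. of_nat (4 * m * (m + 1)) * single_coeff n N n' N')"
  proof -
    have "lap_ev n N = of_nat (4 * m * (m + 1))" unfolding lap_ev_def m ..
    then show ?thesis by (auto simp: fun_eq_iff single_coeff_def simp del: of_nat_mult of_nat_add)
  qed
  then have "laplacian_zw (poisson_mode m n) = lift (mode_series (\<lambda>n' N'. of_nat (4 * m * (m + 1)) * single_coeff n N n' N'))"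
    unfolding eq laplacian_mode_series[OF rapid_single_coeff] by (simp only:)
  then show ?thesis unfolding eigenspace_def
    using lift_cmult_eq lift_hol_Omega[OF holv_mode_series[OF rapid_single_coeff]] by (simp add: eq)
qed

lemma sum_fun_apply: "(\<Sum>i\<in>I. f i) x = (\<Sum>i\<in>I. f i x)" for f :: "'i \<Rightarrow> 'a \<Rightarrow> complex"
  by (induction I rule: infinite_finite_induct) auto

text \<open>
  Coefficients of mode series are unique, so the eigenvalue equation holds for each coefficient. As \<open>m (m + 1)\<close> is strictly
  increasing, only the coefficients of degree \<open>m\<close> survive.
\<close>

lemma eigenspace_pullback_in_span:
  assumes F: "F \<in> eigenspace (of_nat (4 * m * (m + 1)))"
  shows "pullback_S F \<in> cfun.span (Q_mode m ` {- int m..int m})"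
proof -
  let ?l = "of_nat (4 * m * (m + 1)) :: complex"
  have hol: "F \<in> hol_Omega" and lap: "\<And>p. p \<in> Omega \<Longrightarrow> laplacian_zw F p = ?l * F p"
    using F by (auto simp: eigenspace_def)
  obtain c where c: "rapid c" "F = lift (mode_series c)" "\<And>z. z \<in> csphere \<Longrightarrow> pullback_S F z = mode_series c z"
    using hol_Omega_mode_expansion[OF hol] by blast
  have "mode_series (\<lambda>n N. lap_ev n N * c n N) z = mode_series (\<lambda>n N. ?l * c n N) z" if z: "z \<in> csphere" for z
  proof -
    have "lift (mode_series (\<lambda>n N. lap_ev n N * c n N)) (S_inv z) = ?l * lift (mode_series c) (S_inv z)"
      using lap[OF S_inv_in_Omega(1)[OF z]] unfolding c(2) laplacian_mode_series[OF c(1)] .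
    then show ?thesis using S_inv_in_Omega[OF z] by (simp add: lift_def mode_series_cmult del: of_nat_mult)
  qed
  then have "(\<lambda>n N. lap_ev n N * c n N) = (\<lambda>n N. ?l * c n N)"
    by (rule mode_series_inj[OF rapid_lap_ev[OF c(1)] rapid_cmult[OF c(1)]])
  then have ev: "lap_ev n N * c n N = ?l * c n N" for n N by (metis (no_types))
  define X where "X = (\<lambda>n. (n, m - nat \<bar>n\<bar>)) ` {- int m..int m}"
  have supp: "c n N = 0" if "(n, N) \<notin> X" for n N
  proof (rule ccontr)
    assume "c n N \<noteq> 0"
    then have "lap_ev n N = ?l" using ev[of n N] by simp
    then have eq: "4 * (nat \<bar>n\<bar> + N) * (nat \<bar>n\<bar> + N + 1) = 4 * m * (m + 1)"
      unfolding lap_ev_def of_nat_eq_iff .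
    have "nat \<bar>n\<bar> + N = m"
    proof (rule ccontr)
      assume "nat \<bar>n\<bar> + N \<noteq> m"
      then consider "nat \<bar>n\<bar> + N < m" | "m < nat \<bar>n\<bar> + N" by linarith
      then show False
      proof cases
        case 1
        then have "(nat \<bar>n\<bar> + N) * (nat \<bar>n\<bar> + N + 1) < m * (m + 1)" by (intro mult_strict_mono) auto
        then show False using eq by (simp only: mult.assoc)
      next
        case 2
        then have "m * (m + 1) < (nat \<bar>n\<bar> + N) * (nat \<bar>n\<bar> + N + 1)" by (intro mult_strict_mono) auto
        then show False using eq by (simp only: mult.assoc)
      qed
    qed
    then have "(n, N) \<in> X" unfolding X_def by (intro image_eqI[of _ _ n]) auto
    then show False using that by simp
  qed
  have "pullback_S F = (\<Sum>n\<in>{- int m..int m}. cfun_scale (c n (m - nat \<bar>n\<bar>)) (Q_mode m n))"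
  proof
    fix z
    show "pullback_S F z = (\<Sum>n\<in>{- int m..int m}. cfun_scale (c n (m - nat \<bar>n\<bar>)) (Q_mode m n)) z"
    proof (cases "z \<in> csphere")
      case True
      have "pullback_S F z = (\<Sum>(n, k)\<in>X. c n k * md n k z)"
        unfolding c(3)[OF True] by (rule mode_series_finite_support) (auto simp: X_def supp)
      also have "\<dots> = (\<Sum>n\<in>{- int m..int m}. c n (m - nat \<bar>n\<bar>) * md n (m - nat \<bar>n\<bar>) z)"
        unfolding X_def by (subst sum.reindex) (auto simp: inj_on_def)
      also have "\<dots> = (\<Sum>n\<in>{- int m..int m}. cfun_scale (c n (m - nat \<bar>n\<bar>)) (Q_mode m n)) z"
        unfolding sum_fun_apply by (intro sum.cong refl) (use True in \<open>auto simp: cfun_scale_def Q_mode_eq\<close>)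
      finally show ?thesis .
    next
      case False
      have "(\<Sum>n\<in>{- int m..int m}. cfun_scale (c n (m - nat \<bar>n\<bar>)) (Q_mode m n)) z = 0"
        unfolding sum_fun_apply by (rule sum.neutral) (use False in \<open>auto simp: cfun_scale_def Q_mode_eq\<close>)
      then show ?thesis using False by (simp add: pullback_S_def)
    qed
  qed
  also have "\<dots> \<in> cfun.span (Q_mode m ` {- int m..int m})"
    by (intro cfun.span_sum cfun.span_scale cfun.span_base) auto
  finally show ?thesis .
qed

theorem CSH_deg_eq_span: "CSH_deg m = cfun.span (Q_mode m ` {- int m..int m})"
proof
  show "CSH_deg m \<subseteq> cfun.span (Q_mode m ` {- int m..int m})"
    unfolding CSH_deg_def by (rule cfun.span_minimal) (auto intro: eigenspace_pullback_in_span)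
  have "Q_mode m n \<in> pullback_S ` eigenspace (of_nat (4 * m * (m + 1)))" if "n \<in> {- int m..int m}" for n
    unfolding Q_mode_def by (intro imageI poisson_mode_in_eigenspace) (use that in auto)
  then show "cfun.span (Q_mode m ` {- int m..int m}) \<subseteq> CSH_deg m"
    unfolding CSH_deg_def by (intro cfun.span_mono) blast
qed

section \<open>The space of holomorphic functions\<close>

lemma hol_csphere_mode_expansion:
  assumes "f \<in> hol_csphere"
  obtains c where "rapid c" "\<And>z. z \<in> csphere \<Longrightarrow> f z = mode_series c z"
  using sep_holomorphic_mode_expansion[OF hol_csphere_imp_sep_holomorphic[OF assms]] by blast

text \<open>
  The nontrivial direction goes through the mode expansion, whose sum is holomorphic in all variables jointly.
\<close>

lemma hol_csphere_iff: "f \<in> hol_csphere \<longleftrightarrow> sep_holomorphic f \<and> (\<forall>z. z \<notin> csphere \<longrightarrow> f z = 0)"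
proof
  assume "f \<in> hol_csphere"
  then show "sep_holomorphic f \<and> (\<forall>z. z \<notin> csphere \<longrightarrow> f z = 0)"
    using hol_csphere_imp_sep_holomorphic by (auto simp: hol_csphere_def)
next
  assume f: "sep_holomorphic f \<and> (\<forall>z. z \<notin> csphere \<longrightarrow> f z = 0)"
  then obtain c where "rapid c" "\<And>z. z \<in> csphere \<Longrightarrow> f z = mode_series c z"
    using sep_holomorphic_mode_expansion by blast
  then show "f \<in> hol_csphere" using f by (intro mode_series_hol_csphere) auto
qed

lemma hol_csphere_continuous: "f \<in> hol_csphere \<Longrightarrow> continuous_on rsphere f"
  unfolding hol_csphere_iff sep_holomorphic_def using continuous_on_subset[OF _ rsphere_subset_csphere] by blast

lemma subspace_hol_csphere: "cfun.subspace hol_csphere"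
  by (auto simp: cfun.subspace_def hol_csphere_iff sep_holomorphic_def cfun_scale_def
      intro!: continuous_intros holomorphic_intros)

lemma Q_mode_in_hol_csphere:
  assumes "nat \<bar>n\<bar> \<le> m" shows "Q_mode m n \<in> hol_csphere"
  by (rule mode_series_hol_csphere[OF rapid_single_coeff[of n "m - nat \<bar>n\<bar>"]])
     (auto simp: Q_mode_eq[OF assms] mode_series_single_coeff)

lemma CSH_deg_subset_hol_csphere: "CSH_deg m \<subseteq> hol_csphere"
  unfolding CSH_deg_eq_span
  by (rule cfun.span_minimal[OF _ subspace_hol_csphere]) (auto intro!: Q_mode_in_hol_csphere)

lemma CSH_subset_hol_csphere: "CSH \<subseteq> hol_csphere"
  unfolding CSH_def by (rule cfun.span_minimal[OF _ subspace_hol_csphere]) (use CSH_deg_subset_hol_csphere in blast)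

lemma Q_mode_in_CSH:
  assumes "nat \<bar>n\<bar> \<le> m" shows "Q_mode m n \<in> CSH_deg m" and "Q_mode m n \<in> CSH"
proof -
  show "Q_mode m n \<in> CSH_deg m"
    unfolding CSH_deg_eq_span by (intro cfun.span_base imageI) (use assms in auto)
  then show "Q_mode m n \<in> CSH" unfolding CSH_def by (intro cfun.span_base) blast
qed

lemma loc_uniform_limit_continuous:
  fixes S :: "'a :: t2_space set"
  assumes lim: "loc_uniform_limit S g f" and g: "\<And>k. continuous_on S (g k)"
  shows "continuous_on S f"
  unfolding continuous_on_eq_continuous_within
proof
  fix x assume x: "x \<in> S"
  obtain U where U: "open U" "x \<in> U" "uniform_limit (U \<inter> S) g f sequentially"
    using lim x unfolding loc_uniform_limit_def by blast
  have "continuous_on (U \<inter> S) f"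
    by (rule uniform_limit_theorem[OF _ U(3)]) (auto intro!: always_eventually continuous_on_subset[OF g])
  then have "continuous (at x within U \<inter> S) f" using x U by (simp add: continuous_on_eq_continuous_within)
  moreover have "at x within U \<inter> S = at x within S" by (rule at_within_nhd[OF U(2,1)]) auto
  ultimately show "continuous (at x within S) f" by simp
qed

lemma loc_uniform_limit_curve:
  fixes \<gamma> :: "complex \<Rightarrow> 'a :: topological_space"
  assumes lim: "loc_uniform_limit S g f" and T: "open T" and \<gamma>: "continuous_on T \<gamma>" "\<And>t. t \<in> T \<Longrightarrow> \<gamma> t \<in> S"
    and g: "\<And>k. (\<lambda>t. g k (\<gamma> t)) holomorphic_on T"
  shows "(\<lambda>t. f (\<gamma> t)) holomorphic_on T"
proof (rule holomorphic_uniform_sequence[OF T g])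
  fix t assume t: "t \<in> T"
  obtain U where U: "open U" "\<gamma> t \<in> U" "uniform_limit (U \<inter> S) g f sequentially"
    using lim \<gamma>(2)[OF t] unfolding loc_uniform_limit_def by blast
  have "open (\<gamma> -` U \<inter> T)" using continuous_open_preimage[OF \<gamma>(1) T U(1)] by (simp add: Int_commute)
  moreover have "t \<in> \<gamma> -` U \<inter> T" using t U by simp
  ultimately obtain d where d: "0 < d" "cball t d \<subseteq> \<gamma> -` U \<inter> T" using open_contains_cball by metis
  have "uniform_limit (cball t d) (\<lambda>k t. g k (\<gamma> t)) (\<lambda>t. f (\<gamma> t)) sequentially"
    unfolding uniform_limit_iff
  proof (intro allI impI)
    fix e :: real assume "0 < e"
    from uniform_limitD[OF U(3) this]
    show "\<forall>\<^sub>F k in sequentially. \<forall>x\<in>cball t d. dist (g k (\<gamma> x)) (f (\<gamma> x)) < e"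
      by eventually_elim (use d \<gamma>(2) in blast)
  qed
  then show "\<exists>d>0. cball t d \<subseteq> T \<and> uniform_limit (cball t d) (\<lambda>k t. g k (\<gamma> t)) (\<lambda>t. f (\<gamma> t)) sequentially"
    using d by blast
qed

lemma sep_holomorphic_loc_uniform_limit:
  assumes lim: "loc_uniform_limit csphere g f" and g: "\<And>k. sep_holomorphic (g k)"
  shows "sep_holomorphic f"
  unfolding sep_holomorphic_def
proof (intro conjI allI impI)
  show "continuous_on csphere f"
    by (rule loc_uniform_limit_continuous[OF lim]) (use g in \<open>auto simp: sep_holomorphic_def\<close>)
  show "(\<lambda>s. f (pt s ((1 - c\<^sup>2) / s) c)) holomorphic_on - {0}" for c
    by (rule loc_uniform_limit_curve[OF lim]) (use g in \<open>auto simp: sep_holomorphic_def intro!: continuous_intros\<close>)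
  show "(\<lambda>c. f (pt s ((1 - c\<^sup>2) / s) c)) holomorphic_on UNIV" if "s \<noteq> 0" for s
    by (rule loc_uniform_limit_curve[OF lim]) (use g that in \<open>auto simp: sep_holomorphic_def intro!: continuous_intros\<close>)
qed

lemma loc_uniform_limit_cong:
  assumes "\<And>k x. x \<in> S \<Longrightarrow> f k x = f' k x" "\<And>x. x \<in> S \<Longrightarrow> l x = l' x"
  shows "loc_uniform_limit S f l \<longleftrightarrow> loc_uniform_limit S f' l'"
proof -
  have "uniform_limit (U \<inter> S) f l sequentially \<longleftrightarrow> uniform_limit (U \<inter> S) f' l' sequentially" for U
    by (rule uniform_limit_cong') (use assms in auto)
  then show ?thesis unfolding loc_uniform_limit_def by simp
qed

lemma sum_upto_degree:
  "(\<Sum>m<M. \<Sum>n\<in>{- int m..int m}. h m n) = (\<Sum>(n, k)\<in>upto_degree M. h (nat \<bar>n\<bar> + k) n)" for h :: "nat \<Rightarrow> int \<Rightarrow> complex"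
proof -
  have "(\<Sum>m<M. \<Sum>n\<in>{- int m..int m}. h m n) = (\<Sum>(m, n)\<in>(SIGMA m:{..<M}. {- int m..int m}). h m n)"
    by (rule sum.Sigma) auto
  also have "\<dots> = (\<Sum>(n, k)\<in>upto_degree M. h (nat \<bar>n\<bar> + k) n)"
    by (rule sum.reindex_bij_witness[where i = "\<lambda>(n, k). (nat \<bar>n\<bar> + k, n)" and j = "\<lambda>(m, n). (n, m - nat \<bar>n\<bar>)"])
       (auto simp: upto_degree_def)
  finally show ?thesis .
qed

text \<open>
  Dictionary between the index pairs \<open>(m, n)\<close> with \<open>|n| \<le> m\<close> and the pairs \<open>(n, k)\<close> with \<open>m = |n| + k\<close>.
\<close>

lemma degree_partial_sum:
  assumes z: "z \<in> csphere"
  shows "(\<Sum>m<M. \<Sum>n\<in>{- int m..int m}. c n m * Q_mode m n z) = (\<Sum>(n, k)\<in>upto_degree M. c n (nat \<bar>n\<bar> + k) * md n k z)"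
  unfolding sum_upto_degree by (intro sum.cong refl) (auto simp: Q_mode_eq z)

theorem CSH_closure_eq: "CSH_closure = hol_csphere"
proof
  show "CSH_closure \<subseteq> hol_csphere"
  proof
    fix f assume "f \<in> CSH_closure"
    then obtain g where f: "\<And>z. z \<notin> csphere \<Longrightarrow> f z = 0" and g: "\<And>k. g k \<in> CSH" "loc_uniform_limit csphere g f"
      unfolding CSH_closure_def by blast
    have "sep_holomorphic f"
      by (rule sep_holomorphic_loc_uniform_limit[OF g(2)]) (use g(1) CSH_subset_hol_csphere hol_csphere_iff in blast)
    then show "f \<in> hol_csphere" using f by (simp add: hol_csphere_iff)
  qed
  show "hol_csphere \<subseteq> CSH_closure"
  proof
    fix f assume f: "f \<in> hol_csphere"
    obtain c where c: "rapid c" "\<And>z. z \<in> csphere \<Longrightarrow> f z = mode_series c z"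
      using hol_csphere_mode_expansion[OF f] by blast
    define g where "g M = (\<Sum>m<M. \<Sum>n\<in>{- int m..int m}. cfun_scale (c n (m - nat \<bar>n\<bar>)) (Q_mode m n))" for M
    have "g M \<in> CSH" for M
      unfolding g_def CSH_def
      by (intro cfun.subspace_sum[OF cfun.subspace_span] cfun.subspace_scale[OF cfun.subspace_span] Q_mode_in_CSH(2)[unfolded CSH_def]) auto
    moreover have "loc_uniform_limit csphere g f"
    proof -
      have "g M z = (\<Sum>(n, k)\<in>upto_degree M. c n k * md n k z)" if "z \<in> csphere" for M z
        using degree_partial_sum[OF that, of "\<lambda>n m. c n (m - nat \<bar>n\<bar>)" M]
        unfolding g_def sum_fun_apply cfun_scale_def by simp
      then show ?thesis
        using mode_series_loc_uniform_limit[OF c(1) filterlim_upto_degree, of csphere] c(2)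
        by (subst loc_uniform_limit_cong) auto
    qed
    moreover have "\<forall>z. z \<notin> csphere \<longrightarrow> f z = 0" using f by (simp add: hol_csphere_iff)
    ultimately show "f \<in> CSH_closure" unfolding CSH_closure_def by blast
  qed
qed

section \<open>Schauder bases and Fourier coefficients\<close>

lemma md_norm_formula:
  assumes "p \<le> m" "nat \<bar>n\<bar> = p"
  shows "1 / complex_of_real (md_norm n (m - p)) = (2 * of_nat m + 1) * inverse (of_nat (m choose p)) * of_nat ((m + p) choose p)"
proof -
  have s: "p + (m - p) = m" "2 * p + (m - p) = m + p" using assms by auto
  have 1: "of_nat (m choose p) = (fact m / (fact p * fact (m - p)) :: complex)" by (rule binomial_fact[OF assms(1)])
  have 2: "of_nat ((m + p) choose p) = (fact (m + p) / (fact p * fact m) :: complex)"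
    using binomial_fact[of p "m + p", where ?'a = complex] by simp
  have 3: "complex_of_real (md_norm n (m - p)) = fact m ^ 2 / (fact (m - p) * fact (m + p) * (2 * of_nat m + 1))"
    unfolding md_norm_def jac_norm_def assms(2) s by (simp add: of_nat_diff assms(1))
  have "2 * of_nat m + 1 \<noteq> (0 :: complex)" by (metis of_nat_Suc of_nat_mult of_nat_numeral of_nat_neq_0 add.commute)
  then show ?thesis unfolding 1 2 3 by (simp add: field_simps power2_eq_square)
qed

lemma sphere_ip_Q_mode_right:
  assumes "nat \<bar>n\<bar> \<le> m" shows "sphere_ip f (Q_mode m n) = sphere_ip f (md n (m - nat \<bar>n\<bar>))"
  by (rule sphere_ip_cong) (use rsphere_subset_csphere in \<open>auto simp: Q_mode_eq[OF assms]\<close>)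

lemma sphere_ip_Q_mode:
  assumes "nat \<bar>n\<bar> \<le> m" "nat \<bar>n'\<bar> \<le> m'"
  shows "sphere_ip (Q_mode m n) (Q_mode m' n') = (if m = m' \<and> n = n' then of_real (md_norm n (m - nat \<bar>n\<bar>)) else 0)"
proof -
  have "sphere_ip (Q_mode m n) (Q_mode m' n') = sphere_ip (md n (m - nat \<bar>n\<bar>)) (md n' (m' - nat \<bar>n'\<bar>))"
    by (rule sphere_ip_cong) (use rsphere_subset_csphere in \<open>auto simp: Q_mode_eq[OF assms(1)] Q_mode_eq[OF assms(2)]\<close>)
  also have "\<dots> = (if m = m' \<and> n = n' then of_real (md_norm n (m - nat \<bar>n\<bar>)) else 0)"
  proof -
    have "n = n' \<and> m - nat \<bar>n\<bar> = m' - nat \<bar>n'\<bar> \<longleftrightarrow> m = m' \<and> n = n'"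
      using assms by (metis eq_diff_iff)
    then show ?thesis unfolding md_orthogonal by auto
  qed
  finally show ?thesis .
qed

lemma bij_enumeration_filterlim:
  assumes "bij_betw e (UNIV :: nat set) (UNIV :: 'a set)"
  shows "filterlim (\<lambda>K. e ` {..<K}) (finite_subsets_at_top UNIV) sequentially"
  unfolding filterlim_finite_subsets_at_top
proof (intro allI impI)
  fix X :: "'a set" assume X: "finite X \<and> X \<subseteq> UNIV"
  then have "finite (inv e ` X)" by simp
  then obtain M where M: "\<forall>x\<in>inv e ` X. x < M" unfolding finite_nat_set_iff_bounded by (rule exE)
  have "X \<subseteq> e ` {..<K}" if "K \<ge> M" for K
  proof
    fix x assume "x \<in> X"
    then have "inv e x < M" using M by blast
    moreover have "e (inv e x) = x" using assms by (simp add: bij_betw_def surj_f_inv_f)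
    ultimately show "x \<in> e ` {..<K}" using that by (intro image_eqI[of _ _ "inv e x"]) auto
  qed
  then show "\<forall>\<^sub>F K in sequentially. finite (e ` {..<K}) \<and> X \<subseteq> e ` {..<K} \<and> e ` {..<K} \<subseteq> UNIV"
    unfolding eventually_sequentially by blast
qed

text \<open>
  The partial sums along an enumeration are sums over an exhaustion of the index set by finite sets, so existence
  and uniqueness are those of the unordered mode series.
\<close>

theorem Q_mode_schauder_basis:
  assumes e: "bij_betw e (UNIV :: nat set) mode_index"
  shows "schauder_basis_on csphere CSH_closure (\<lambda>k. Q_mode (fst (e k)) (snd (e k)))"
proof -
  define \<eta> where "\<eta> k = (snd (e k), fst (e k) - nat \<bar>snd (e k)\<bar>)" for k
  have mem: "nat \<bar>snd (e k)\<bar> \<le> fst (e k)" for k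
    using bij_betwE[OF e, rule_format, of k] by (auto simp: mode_index_def case_prod_unfold)
  have "bij_betw (\<lambda>(m, n). (n, m - nat \<bar>n\<bar>)) mode_index (UNIV :: (int \<times> nat) set)"
    by (rule bij_betw_byWitness[where f' = "\<lambda>(n, k). (nat \<bar>n\<bar> + k, n)"]) (auto simp: mode_index_def)
  from bij_betw_trans[OF e this] have \<eta>: "bij_betw \<eta> UNIV UNIV"
    by (simp add: \<eta>_def[abs_def] o_def case_prod_unfold)
  have inj: "inj \<eta>" and inv: "inv \<eta> (\<eta> k) = k" for k using \<eta> by (auto simp: bij_betw_def)
  define E where "E K = \<eta> ` {..<K}" for K
  have E: "filterlim E (finite_subsets_at_top UNIV) sequentially"
    unfolding E_def by (rule bij_enumeration_filterlim[OF \<eta>])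
  have partial: "(\<Sum>k<K. c k * Q_mode (fst (e k)) (snd (e k)) z) = (\<Sum>(n, k)\<in>E K. c (inv \<eta> (n, k)) * md n k z)"
    if "z \<in> csphere" for c K z
  proof -
    have "(\<Sum>(n, k)\<in>E K. c (inv \<eta> (n, k)) * md n k z) = (\<Sum>k<K. (\<lambda>(n, k). c (inv \<eta> (n, k)) * md n k z) (\<eta> k))"
      unfolding E_def by (subst sum.reindex) (auto intro: inj_on_subset[OF inj])
    also have "\<dots> = (\<Sum>k<K. c k * Q_mode (fst (e k)) (snd (e k)) z)"
    proof (intro sum.cong refl)
      fix k
      have "(\<lambda>(n, k). c (inv \<eta> (n, k)) * md n k z) (\<eta> k) = c (inv \<eta> (\<eta> k)) * md (fst (\<eta> k)) (snd (\<eta> k)) z"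
        by (simp add: case_prod_unfold)
      then show "(\<lambda>(n, k). c (inv \<eta> (n, k)) * md n k z) (\<eta> k) = c k * Q_mode (fst (e k)) (snd (e k)) z"
        using that unfolding inv by (simp add: Q_mode_eq[OF mem] \<eta>_def)
    qed
    finally show ?thesis ..
  qed
  have lim_iff: "loc_uniform_limit csphere (\<lambda>K z. \<Sum>k<K. c k * Q_mode (fst (e k)) (snd (e k)) z) f
      \<longleftrightarrow> loc_uniform_limit csphere (\<lambda>K z. \<Sum>(n, k)\<in>E K. c (inv \<eta> (n, k)) * md n k z) f" for c f
    by (rule loc_uniform_limit_cong) (use partial in auto)
  show ?thesis unfolding schauder_basis_on_def CSH_closure_eq
  proof (intro conjI allI ballI)
    show "Q_mode (fst (e k)) (snd (e k)) \<in> hol_csphere" for k by (rule Q_mode_in_hol_csphere[OF mem])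
    fix f assume f: "f \<in> hol_csphere"
    obtain c where c: "rapid c" "\<And>z. z \<in> csphere \<Longrightarrow> f z = mode_series c z"
      using hol_csphere_mode_expansion[OF f] by blast
    show "\<exists>!c. loc_uniform_limit csphere (\<lambda>K z. \<Sum>k<K. c k * Q_mode (fst (e k)) (snd (e k)) z) f"
    proof (rule ex1I)
      define c' where "c' k = c (fst (\<eta> k)) (snd (\<eta> k))" for k
      have "c' (inv \<eta> (n, k)) = c n k" for n k
        using \<eta> by (simp add: c'_def bij_betw_def surj_f_inv_f)
      then show "loc_uniform_limit csphere (\<lambda>K z. \<Sum>k<K. c' k * Q_mode (fst (e k)) (snd (e k)) z) f"
        unfolding lim_iff using mode_series_loc_uniform_limit[OF c(1) E, of csphere] c(2)
        by (subst loc_uniform_limit_cong[where l' = "mode_series c"]) auto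
      fix d assume d: "loc_uniform_limit csphere (\<lambda>K z. \<Sum>k<K. d k * Q_mode (fst (e k)) (snd (e k)) z) f"
      show "d = c'"
      proof
        fix k
        have "d (inv \<eta> (n, j)) = c n j" for n j
          using mode_coeff_unique[OF E d[unfolded lim_iff], of n j] mode_series_coeff[OF c, of n j] by simp
        from this[of "fst (\<eta> k)" "snd (\<eta> k)"] show "d k = c' k" by (simp add: inv c'_def)
      qed
    qed
  qed
qed

theorem hol_csphere_Q_mode_expansion:
  assumes Q: "Q \<in> hol_csphere"
  shows "\<exists>c :: int \<Rightarrow> nat \<Rightarrow> complex.
    loc_uniform_limit csphere (\<lambda>N z. \<Sum>m<N. \<Sum>n\<in>{- int m..int m}. c n m * Q_mode m n z) Q
    \<and> (\<forall>c' :: int \<Rightarrow> nat \<Rightarrow> complex.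
         loc_uniform_limit csphere (\<lambda>N z. \<Sum>m<N. \<Sum>n\<in>{- int m..int m}. c' n m * Q_mode m n z) Q \<longrightarrow>
         (\<forall>(m, n)\<in>mode_index. c' n m = c n m))
    \<and> (\<forall>z\<in>csphere. (\<lambda>(m, n). norm (c n m * Q_mode m n z)) summable_on mode_index)
    \<and> (\<forall>m n :: nat. n \<le> m \<longrightarrow> (\<forall>s\<in>{int n, - int n}.
         c s m = (2 * of_nat m + 1) * inverse (of_nat (m choose n)) * of_nat ((m + n) choose n)
                 * (LINT x|sphere_area. Q x * cnj (Q_mode m s x))))"
proof -
  obtain d where d: "rapid d" "\<And>z. z \<in> csphere \<Longrightarrow> Q z = mode_series d z"
    using hol_csphere_mode_expansion[OF Q] by blast
  define c where "c n m = d n (m - nat \<bar>n\<bar>)" for n m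
  have cd: "c n (nat \<bar>n\<bar> + k) = d n k" for n k by (simp add: c_def)
  have lim_iff: "loc_uniform_limit csphere (\<lambda>N z. \<Sum>m<N. \<Sum>n\<in>{- int m..int m}. c' n m * Q_mode m n z) Q
      \<longleftrightarrow> loc_uniform_limit csphere (\<lambda>N z. \<Sum>(n, k)\<in>upto_degree N. c' n (nat \<bar>n\<bar> + k) * md n k z) Q" for c'
    by (rule loc_uniform_limit_cong) (use degree_partial_sum in auto)
  show ?thesis
  proof (intro exI[of _ c] conjI allI impI ballI)
    show "loc_uniform_limit csphere (\<lambda>N z. \<Sum>m<N. \<Sum>n\<in>{- int m..int m}. c n m * Q_mode m n z) Q"
      unfolding lim_iff cd using mode_series_loc_uniform_limit[OF d(1) filterlim_upto_degree, of csphere] d(2)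
      by (subst loc_uniform_limit_cong[where l' = "mode_series d"]) auto
  next
    fix c' x
    assume c': "loc_uniform_limit csphere (\<lambda>N z. \<Sum>m<N. \<Sum>n\<in>{- int m..int m}. c' n m * Q_mode m n z) Q"
      and x: "x \<in> mode_index"
    obtain m n where x': "x = (m, n)" "nat \<bar>n\<bar> \<le> m" using x by (auto simp: mode_index_def)
    have "c' n (nat \<bar>n\<bar> + (m - nat \<bar>n\<bar>)) = d n (m - nat \<bar>n\<bar>)"
      using mode_coeff_unique[OF filterlim_upto_degree c'[unfolded lim_iff], of n "m - nat \<bar>n\<bar>"]
        mode_series_coeff[OF d, of n "m - nat \<bar>n\<bar>"] by simp
    then show "case x of (m, n) \<Rightarrow> c' n m = c n m" using x' by (simp add: c_def)
  next
    fix z assume z: "z \<in> csphere"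
    have "(\<lambda>(m, n). norm (c n m * Q_mode m n z)) summable_on mode_index \<longleftrightarrow> (\<lambda>(n, k). norm (d n k * md n k z)) summable_on UNIV"
      by (rule summable_on_reindex_bij_witness[where i = "\<lambda>(n, k). (nat \<bar>n\<bar> + k, n)" and j = "\<lambda>(m, n). (n, m - nat \<bar>n\<bar>)"])
         (auto simp: mode_index_def c_def Q_mode_eq z)
    then show "(\<lambda>(m, n). norm (c n m * Q_mode m n z)) summable_on mode_index" using mode_abs_summable[OF d(1)] by simp
  next
    fix m n :: nat and s :: int assume n: "n \<le> m" and s: "s \<in> {int n, - int n}"
    have sn: "nat \<bar>s\<bar> = n" using s by auto
    have "c s m = sphere_ip Q (md s (m - n)) * (1 / of_real (md_norm s (m - n)))"
      unfolding c_def sn using mode_series_coeff[OF d, of s "m - n"] by simp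
    also have "\<dots> = (2 * of_nat m + 1) * inverse (of_nat (m choose n)) * of_nat ((m + n) choose n) * sphere_ip Q (Q_mode m s)"
      unfolding md_norm_formula[OF n sn] using sphere_ip_Q_mode_right[of s m Q] n sn by simp
    finally show "c s m = (2 * of_nat m + 1) * inverse (of_nat (m choose n)) * of_nat ((m + n) choose n)
                 * (LINT x|sphere_area. Q x * cnj (Q_mode m s x))"
      unfolding sphere_ip_def .
  qed
qed

section \<open>The inner product\<close>

text \<open>
  The coefficients of the mode expansion are Fourier coefficients.
\<close>

lemma hol_csphere_eq_0I:
  assumes f: "f \<in> hol_csphere" and 0: "\<And>n k. sphere_ip f (md n k) = 0"
  shows "f = 0"
proof
  fix z
  obtain c where c: "rapid c" "\<And>z. z \<in> csphere \<Longrightarrow> f z = mode_series c z"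
    using hol_csphere_mode_expansion[OF f] by blast
  have "c n k = 0" for n k using mode_series_coeff[OF c, of n k] 0 by simp
  then have "mode_series c z = 0" by (simp add: mode_series_def case_prod_unfold)
  then show "f z = 0 z" using c(2)[of z] f by (cases "z \<in> csphere") (auto simp: hol_csphere_iff)
qed

lemma sphere_ip_self: "sphere_ip f f = of_real (LINT x|sphere_area. (norm (f x))\<^sup>2)"
proof -
  have "sphere_ip f f = (LINT x|sphere_area. complex_of_real ((norm (f x))\<^sup>2))"
    unfolding sphere_ip_def by (rule Bochner_Integration.integral_cong) (auto simp only: complex_norm_square)
  then show ?thesis by (simp only: integral_complex_of_real)
qed

text \<open>
  If \<open>f\<close> vanishes almost everywhere on the real sphere, then all its Fourier coefficients vanish; the mode expansion thus
  replaces an identity theorem for the real sphere inside the complex one.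
\<close>

lemma sphere_ip_self_eq_0:
  assumes f: "f \<in> hol_csphere" and 0: "sphere_ip f f = 0"
  shows "f = 0"
proof (rule hol_csphere_eq_0I[OF f])
  fix n k
  have fc: "continuous_on rsphere f" by (rule hol_csphere_continuous[OF f])
  have int: "integrable sphere_area (\<lambda>x. (norm (f x))\<^sup>2)"
    by (rule sphere_area_integral(1)) (intro continuous_intros fc)
  have "(LINT x|sphere_area. (norm (f x))\<^sup>2) = 0" using 0 unfolding sphere_ip_self of_real_eq_0_iff .
  then have ae: "AE x in sphere_area. (norm (f x))\<^sup>2 = 0"
    using integral_nonneg_eq_0_iff_AE[OF int] by simp
  have "sphere_ip f (md n k) = (LINT x|sphere_area. 0)"
    unfolding sphere_ip_def
  proof (rule integral_cong_AE)
    show "(\<lambda>x. f x * cnj (md n k x)) \<in> borel_measurable sphere_area"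
      by (rule borel_measurable_sphere_area) (intro continuous_intros fc)
    show "AE x in sphere_area. f x * cnj (md n k x) = 0" using ae by eventually_elim simp
  qed simp
  then show "sphere_ip f (md n k) = 0" by simp
qed

lemma sphere_ip_integrable:
  assumes "f \<in> hol_csphere" "g \<in> hol_csphere" shows "integrable sphere_area (\<lambda>x. f x * cnj (g x))"
  by (rule sphere_area_integral(1)) (intro continuous_intros hol_csphere_continuous assms)

lemma sphere_ip_inner_product:
  assumes V: "cfun.subspace V" "V \<subseteq> hol_csphere" shows "complex_inner_product_on V sphere_ip"
  unfolding complex_inner_product_on_def
proof (intro conjI ballI allI)
  show "cfun.subspace V" by fact
  show "sphere_ip (f + g) h = sphere_ip f h + sphere_ip g h" if "f \<in> V" "g \<in> V" "h \<in> V" for f g h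
    unfolding sphere_ip_def plus_fun_apply distrib_right
    by (rule Bochner_Integration.integral_add; rule sphere_ip_integrable) (use that V in auto)
  show "sphere_ip (cfun_scale c f) g = c * sphere_ip f g" for c f g
    unfolding sphere_ip_def cfun_scale_def mult.assoc by (rule integral_mult_right_zero)
  show "sphere_ip g f = cnj (sphere_ip f g)" for f g by (rule sphere_ip_commute)
  show "sphere_ip f f \<in> \<real>" "0 \<le> Re (sphere_ip f f)" for f unfolding sphere_ip_self by simp_all
  show "sphere_ip f f = 0 \<longleftrightarrow> f = 0" if "f \<in> V" for f
  proof
    show "sphere_ip f f = 0 \<Longrightarrow> f = 0" using that V sphere_ip_self_eq_0 by blast
    show "f = 0 \<Longrightarrow> sphere_ip f f = 0" by (simp add: sphere_ip_def)
  qed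
qed

lemma inj_on_Q_mode: "inj_on (Q_mode m) {- int m..int m}"
proof
  fix n n' assume n: "n \<in> {- int m..int m}" "n' \<in> {- int m..int m}" and eq: "Q_mode m n = Q_mode m n'"
  show "n = n'"
  proof (rule ccontr)
    assume "n \<noteq> n'"
    then have "sphere_ip (Q_mode m n) (Q_mode m n') = 0" using n by (subst sphere_ip_Q_mode) auto
    moreover have "sphere_ip (Q_mode m n) (Q_mode m n) = of_real (md_norm n (m - nat \<bar>n\<bar>))" using n by (subst sphere_ip_Q_mode) auto
    ultimately show False using md_norm_pos[of n "m - nat \<bar>n\<bar>"] eq by simp
  qed
qed

lemma Q_mode_sum_ip:
  assumes n: "n \<in> {- int m..int m}"
  shows "sphere_ip (\<Sum>i\<in>{- int m..int m}. cfun_scale (a i) (Q_mode m i)) (Q_mode m n) = a n * of_real (md_norm n (m - nat \<bar>n\<bar>))"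
proof -
  have "sphere_ip (\<Sum>i\<in>{- int m..int m}. cfun_scale (a i) (Q_mode m i)) (Q_mode m n)
     = sphere_ip (\<lambda>x. \<Sum>i\<in>{- int m..int m}. a i * Q_mode m i x) (Q_mode m n)"
    by (rule sphere_ip_cong) (simp_all add: sum_fun_apply cfun_scale_def)
  also have "\<dots> = (\<Sum>i\<in>{- int m..int m}. a i * sphere_ip (Q_mode m i) (Q_mode m n))"
    by (rule sphere_ip_sum_left; intro hol_csphere_continuous Q_mode_in_hol_csphere) (use n in auto)
  also have "\<dots> = (\<Sum>i\<in>{- int m..int m}. if i = n then a n * of_real (md_norm n (m - nat \<bar>n\<bar>)) else 0)"
    by (intro sum.cong refl, subst sphere_ip_Q_mode) (use n in auto)
  finally show ?thesis using n by simp
qed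

lemma CSH_deg_coordinates:
  assumes "f \<in> CSH_deg m"
  obtains a where "f = (\<Sum>i\<in>{- int m..int m}. cfun_scale (a i) (Q_mode m i))"
proof -
  have "f \<in> range (\<lambda>u. \<Sum>v\<in>Q_mode m ` {- int m..int m}. cfun_scale (u v) v)"
    using assms unfolding CSH_deg_eq_span by (subst (asm) cfun.span_finite) auto
  then obtain u where "f = (\<Sum>v\<in>Q_mode m ` {- int m..int m}. cfun_scale (u v) v)" by blast
  also have "\<dots> = (\<Sum>i\<in>{- int m..int m}. cfun_scale (u (Q_mode m i)) (Q_mode m i))"
    by (subst sum.reindex[OF inj_on_Q_mode]) simp
  finally show ?thesis using that[of "\<lambda>i. u (Q_mode m i)"] by simp
qed

lemma CSH_deg_norm:
  "sphere_ip (\<Sum>i\<in>{- int m..int m}. cfun_scale (a i) (Q_mode m i)) (\<Sum>i\<in>{- int m..int m}. cfun_scale (a i) (Q_mode m i))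
     = of_real (\<Sum>i\<in>{- int m..int m}. (norm (a i))\<^sup>2 * md_norm i (m - nat \<bar>i\<bar>))" (is "sphere_ip ?f ?f = _")
proof -
  have "sphere_ip ?f ?f = sphere_ip (\<lambda>x. \<Sum>i\<in>{- int m..int m}. a i * Q_mode m i x) ?f"
    by (rule sphere_ip_cong) (simp_all add: sum_fun_apply cfun_scale_def)
  also have "\<dots> = (\<Sum>i\<in>{- int m..int m}. a i * sphere_ip (Q_mode m i) ?f)"
  proof (rule sphere_ip_sum_left)
    have "?f \<in> CSH_deg m" unfolding CSH_deg_eq_span
      by (intro cfun.span_sum cfun.span_scale cfun.span_base) auto
    then show "continuous_on rsphere ?f" using CSH_deg_subset_hol_csphere hol_csphere_continuous by blast
  qed (auto intro!: hol_csphere_continuous Q_mode_in_hol_csphere)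
  also have "\<dots> = (\<Sum>i\<in>{- int m..int m}. of_real ((norm (a i))\<^sup>2 * md_norm i (m - nat \<bar>i\<bar>)))"
  proof (intro sum.cong refl)
    fix i assume i: "i \<in> {- int m..int m}"
    have "sphere_ip (Q_mode m i) ?f = cnj (sphere_ip ?f (Q_mode m i))" by (rule sphere_ip_commute)
    also have "\<dots> = cnj (a i) * of_real (md_norm i (m - nat \<bar>i\<bar>))" unfolding Q_mode_sum_ip[OF i] by simp
    finally show "a i * sphere_ip (Q_mode m i) ?f = of_real ((norm (a i))\<^sup>2 * md_norm i (m - nat \<bar>i\<bar>))"
      by (simp only: of_real_mult complex_norm_square mult.assoc)
  qed
  finally show ?thesis by simp
qed

text \<open>
  In coordinates with respect to the modes the norm is a weighted Euclidean norm, so a Cauchy sequence converges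
  coordinatewise.
\<close>

theorem CSH_deg_hilbert: "complex_hilbert_space_on (CSH_deg m) sphere_ip"
  unfolding complex_hilbert_space_on_def
proof (intro conjI allI impI)
  show "complex_inner_product_on (CSH_deg m) sphere_ip"
    by (rule sphere_ip_inner_product[OF _ CSH_deg_subset_hol_csphere]) (simp add: CSH_deg_eq_span)
  fix X :: "nat \<Rightarrow> complex^3 \<Rightarrow> complex"
  let ?I = "{- int m..int m}"
  let ?S = "\<lambda>a. (\<Sum>i\<in>?I. cfun_scale (a i) (Q_mode m i))"
  let ?\<nu> = "\<lambda>i. md_norm i (m - nat \<bar>i\<bar>)"
  assume X: "(\<forall>k. X k \<in> CSH_deg m) \<and> (\<forall>e>0. \<exists>N. \<forall>j\<ge>N. \<forall>k\<ge>N. ip_norm sphere_ip (X j - X k) < e)"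
  have "\<forall>k. \<exists>a. X k = ?S a" using X CSH_deg_coordinates by metis
  then obtain a where a: "\<And>k. X k = ?S (a k)" by metis
  have diff: "?S b - ?S c = ?S (\<lambda>i. b i - c i)" for b c
    by (simp add: sum_subtractf[symmetric] cfun.scale_left_diff_distrib)
  have nrm: "ip_norm sphere_ip (?S b - ?S c) = sqrt (\<Sum>i\<in>?I. (norm (b i - c i))\<^sup>2 * ?\<nu> i)" for b c
    unfolding diff ip_norm_def CSH_deg_norm by simp
  have conv: "convergent (\<lambda>k. a k i)" if i: "i \<in> ?I" for i
  proof (rule Cauchy_convergent, rule CauchyI)
    fix e :: real assume e: "0 < e"
    have "0 < e * sqrt (?\<nu> i)" using e md_norm_pos by simp
    then obtain N where N: "\<And>j k. j \<ge> N \<Longrightarrow> k \<ge> N \<Longrightarrow> ip_norm sphere_ip (X j - X k) < e * sqrt (?\<nu> i)" using X by blast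
    have "norm (a j i - a k i) < e" if "j \<ge> N" "k \<ge> N" for j k
    proof -
      have "norm (a j i - a k i) * sqrt (?\<nu> i) = sqrt ((norm (a j i - a k i))\<^sup>2 * ?\<nu> i)"
        by (simp add: real_sqrt_mult)
      also have "\<dots> \<le> sqrt (\<Sum>i\<in>?I. (norm (a j i - a k i))\<^sup>2 * ?\<nu> i)"
      proof (rule real_sqrt_le_mono)
        show "(norm (a j i - a k i))\<^sup>2 * ?\<nu> i \<le> (\<Sum>i\<in>?I. (norm (a j i - a k i))\<^sup>2 * ?\<nu> i)"
          by (rule member_le_sum[OF i, where f = "\<lambda>i. (norm (a j i - a k i))\<^sup>2 * ?\<nu> i"]) (auto intro!: mult_nonneg_nonneg less_imp_le[OF md_norm_pos])
      qed
      also have "\<dots> < e * sqrt (?\<nu> i)" using N[OF that] unfolding a nrm .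
      finally show ?thesis using md_norm_pos[of i "m - nat \<bar>i\<bar>"] by simp
    qed
    then show "\<exists>N. \<forall>j\<ge>N. \<forall>k\<ge>N. norm (a j i - a k i) < e" by blast
  qed
  define b where "b i = lim (\<lambda>k. a k i)" for i
  have lim: "(\<lambda>k. a k i) \<longlonglongrightarrow> b i" if "i \<in> ?I" for i
    using conv[OF that] unfolding b_def by (simp add: convergent_LIMSEQ_iff)
  show "\<exists>f\<in>CSH_deg m. (\<lambda>k. ip_norm sphere_ip (X k - f)) \<longlonglongrightarrow> 0"
  proof (rule bexI[of _ "?S b"])
    have "(\<lambda>k. sqrt (\<Sum>i\<in>?I. (norm (a k i - b i))\<^sup>2 * ?\<nu> i)) \<longlonglongrightarrow> sqrt (\<Sum>i\<in>?I. (norm (b i - b i))\<^sup>2 * ?\<nu> i)"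
      by (intro tendsto_intros lim)
    then show "(\<lambda>k. ip_norm sphere_ip (X k - ?S b)) \<longlonglongrightarrow> 0" unfolding a nrm by simp
    show "?S b \<in> CSH_deg m" unfolding CSH_deg_eq_span
      by (intro cfun.span_sum cfun.span_scale cfun.span_base) auto
  qed
qed

lemma Q_mode_independent: "cfun.independent (Q_mode m ` {- int m..int m})"
proof (rule cfun.independent_if_scalars_zero)
  fix u v assume 0: "(\<Sum>v\<in>Q_mode m ` {- int m..int m}. cfun_scale (u v) v) = 0" and v: "v \<in> Q_mode m ` {- int m..int m}"
  then obtain n where n: "n \<in> {- int m..int m}" "v = Q_mode m n" by blast
  have "(\<Sum>i\<in>{- int m..int m}. cfun_scale (u (Q_mode m i)) (Q_mode m i)) = 0"
    using 0 by (subst (asm) sum.reindex[OF inj_on_Q_mode]) simp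
  then have "u (Q_mode m n) * of_real (md_norm n (m - nat \<bar>n\<bar>)) = sphere_ip 0 (Q_mode m n)"
    using Q_mode_sum_ip[OF n(1), of "\<lambda>i. u (Q_mode m i)"] by simp
  also have "sphere_ip 0 (Q_mode m n) = 0" by (simp add: sphere_ip_def)
  finally show "u v = 0" using md_norm_pos[of n "m - nat \<bar>n\<bar>"] n(2) by simp
qed simp

lemma dim_CSH_deg: "cfun.dim (CSH_deg m) = 2 * m + 1"
proof -
  have "cfun.dim (CSH_deg m) = card (Q_mode m ` {- int m..int m})"
    unfolding CSH_deg_eq_span by (rule cfun.dim_span_eq_card_independent[OF Q_mode_independent])
  also have "\<dots> = card {- int m..int m}" by (rule card_image[OF inj_on_Q_mode])
  finally show ?thesis by simp
qed

lemma CSH_deg_orthogonal: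
  assumes mp: "m \<noteq> p" and Q: "Q \<in> CSH_deg m" and P: "P \<in> CSH_deg p"
  shows "sphere_ip Q P = 0"
proof -
  have step: "sphere_ip f g = 0"
    if f: "f \<in> CSH_deg j" and g: "continuous_on rsphere g" and 0: "\<And>n. n \<in> {- int j..int j} \<Longrightarrow> sphere_ip (Q_mode j n) g = 0" for f g j
  proof -
    obtain a where a: "f = (\<Sum>i\<in>{- int j..int j}. cfun_scale (a i) (Q_mode j i))" by (rule CSH_deg_coordinates[OF f])
    have "sphere_ip f g = sphere_ip (\<lambda>x. \<Sum>i\<in>{- int j..int j}. a i * Q_mode j i x) g"
      unfolding a by (rule sphere_ip_cong) (simp_all add: sum_fun_apply cfun_scale_def)
    also have "\<dots> = (\<Sum>i\<in>{- int j..int j}. a i * sphere_ip (Q_mode j i) g)"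
      by (rule sphere_ip_sum_left[OF _ g]; intro hol_csphere_continuous Q_mode_in_hol_csphere) auto
    finally show ?thesis using 0 by simp
  qed
  have cont: "continuous_on rsphere P" "\<And>n j. n \<in> {- int j..int j} \<Longrightarrow> continuous_on rsphere (Q_mode j n)"
    using P CSH_deg_subset_hol_csphere by (auto intro!: hol_csphere_continuous Q_mode_in_hol_csphere)
  show ?thesis
  proof (rule step[OF Q cont(1)])
    fix n assume n: "n \<in> {- int m..int m}"
    have "sphere_ip P (Q_mode m n) = 0"
      by (rule step[OF P cont(2)[OF n]], subst sphere_ip_Q_mode) (use n mp in auto)
    then show "sphere_ip (Q_mode m n) P = 0" by (subst sphere_ip_commute) simp
  qed
qed

theorem theorem6p5:
  shows
    "((\<forall>e. bij_betw e (UNIV :: nat set) mode_index \<longrightarrow>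
        schauder_basis_on csphere CSH_closure (\<lambda>k. Q_mode (fst (e k)) (snd (e k))))
     \<and> CSH_closure = hol_csphere
     \<and> (\<forall>Q\<in>hol_csphere. \<exists>c :: int \<Rightarrow> nat \<Rightarrow> complex.
          loc_uniform_limit csphere
            (\<lambda>N z. \<Sum>m<N. \<Sum>n\<in>{- int m..int m}. c n m * Q_mode m n z) Q
          \<and> (\<forall>c' :: int \<Rightarrow> nat \<Rightarrow> complex.
               loc_uniform_limit csphere
                 (\<lambda>N z. \<Sum>m<N. \<Sum>n\<in>{- int m..int m}. c' n m * Q_mode m n z) Q \<longrightarrow>
               (\<forall>(m, n)\<in>mode_index. c' n m = c n m))
          \<and> (\<forall>z\<in>csphere. (\<lambda>(m, n). norm (c n m * Q_mode m n z)) summable_on mode_index)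
          \<and> (\<forall>m n :: nat. n \<le> m \<longrightarrow> (\<forall>s\<in>{int n, - int n}.
               c s m = (2 * of_nat m + 1) * inverse (of_nat (m choose n)) * of_nat ((m + n) choose n)
                       * (LINT x|sphere_area. Q x * cnj (Q_mode m s x))))))
    \<and>
    ((\<forall>Q\<in>hol_csphere. \<forall>P\<in>hol_csphere. integrable sphere_area (\<lambda>x. Q x * cnj (P x)))
     \<and> complex_inner_product_on hol_csphere sphere_ip
     \<and> (\<forall>m. complex_hilbert_space_on (CSH_deg m) sphere_ip
          \<and> cfun.dim (CSH_deg m) = 2 * m + 1
          \<and> cfun.independent (Q_mode m ` {- int m..int m})
          \<and> cfun.span (Q_mode m ` {- int m..int m}) = CSH_deg m
          \<and> (\<forall>n\<in>{- int m..int m}. \<forall>n'\<in>{- int m..int m}.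
               n \<noteq> n' \<longrightarrow> sphere_ip (Q_mode m n) (Q_mode m n') = 0))
     \<and> (\<forall>m p. m \<noteq> p \<longrightarrow> (\<forall>Q\<in>CSH_deg m. \<forall>P\<in>CSH_deg p. sphere_ip Q P = 0)))"
proof -
  have orth: "sphere_ip (Q_mode m n) (Q_mode m n') = 0"
    if "n \<in> {- int m..int m}" "n' \<in> {- int m..int m}" "n \<noteq> n'" for m n n'
    using that by (subst sphere_ip_Q_mode) auto
  show ?thesis
    by (intro conjI allI ballI impI Q_mode_schauder_basis CSH_closure_eq hol_csphere_Q_mode_expansion
        sphere_ip_integrable sphere_ip_inner_product[OF subspace_hol_csphere order_refl]
        CSH_deg_hilbert dim_CSH_deg Q_mode_independent CSH_deg_eq_span[symmetric] orth CSH_deg_orthogonal)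
qed

end
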